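(* Let $G$ be a finite solvable group, let $N_1$ and $N_2$ be distinct non-trivial maximal normal subgroups of $G$, and let $H = N_1 \cap N_2$. Assume that $(G, N_1, M_1)$ is a Camina triple. For $\alpha \in \mathrm{Irr}(H)$ consider the following conditions: (i) if $\gcd(|G/N_1|, |G/N_2|) = 1$, then $I_G(\alpha) = H$; (ii) if $\gcd(|G/N_1|, |G/N_2|) \neq 1$, then $I_G(\alpha)$ coincides with neither $N_1$ nor $N_2$. (The condition required is whichever of (i), (ii) is applicable according to the value of the gcd.) Then: (a) If there exist $\psi \in \mathrm{Irr}(N_1)$ and $\alpha \in \mathrm{Irr}(H \mid \psi)$ such that $\alpha$ satisfies the applicable one of conditions (i) and (ii), then there exists $\gamma \in \mathrm{Irr}(N_2)$ such that $\gamma^G = \psi^G$. (b) Conversely, if for a given $\psi \in \mathrm{Irr}(N_1 \mid M_1)$ there exists $\gamma \in \mathrm{Irr}(N_2)$ satisfying $\gamma^G = \psi^G$, then any $\alpha \in \mathrm{Irr}(H \mid \psi) \cap \mathrm{Irr}(H \mid \gamma)$ must satisfy the applicable one of conditions (i) and (ii).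
   Context: All groups are finite and all characters are complex characters. $\mathrm{Irr}(G)$ is the set of irreducible characters of $G$. For a subgroup $K \le G$ and a character $\xi$ of $K$, $\xi^G$ denotes the induced character; $\chi_K$ denotes the restriction to $K$ of a character $\chi$ of $G$. For $K \le G$ and $\chi \in \mathrm{Irr}(G)$, $\mathrm{Irr}(K \mid \chi) = \{\xi \in \mathrm{Irr}(K) : \langle \chi_K, \xi\rangle > 0\}$, the set of irreducible constituents of the restriction $\chi_K$. For a normal subgroup $M$ of a group $N$, $\mathrm{Irr}(N \mid M) = \mathrm{Irr}(N) \setminus \mathrm{Irr}(N/M)$, i.e. the set of irreducible characters of $N$ whose kernel does not contain $M$. (The notation is distinguished by whether the object after the bar is a character or a normal subgroup.) If $H$ is normal in $G$ and $\alpha \in \mathrm{Irr}(H)$, then $G$ acts on $\mathrm{Irr}(H)$ by conjugation and $I_G(\alpha) = \{g \in G : \alpha^g = \alpha\}$ is the inertia group (stabilizer) of $\alpha$. A triple $(G, N, M)$, where $N \ge M$ are nontrivial proper normal subgroups of $G$, is a Camina triple if every $g \in G \setminus N$ is conjugate in $G$ to every element of the coset $gM$. A maximal normal subgroup is a proper normal subgroup that is maximal among proper normal subgroups; non-trivial means different from the identity subgroup.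
   Formalization: In (a), when I_G(α) = G, ψ is required to lie in Irr(N_1 | M_1); without this (a) fails, e.g. for G dihedral of order 8, N_1, N_2 of index 2, M_1 = H = Z(G), ψ and α trivial. *)

theory Defs
  imports
    "HOL-Algebra.Algebra"
    "Jordan_Normal_Form.Matrix"
    "Jordan_Normal_Form.VS_Connect"
    "Jordan_Normal_Form.Conjugate"
begin

subsection \<open>Complex representations and characters\<close>

definition general_linear :: "nat \<Rightarrow> complex mat monoid" where
  "general_linear n = units_of (ring_mat TYPE(complex) n ())"

definition representation :: "('a, 'b) monoid_scheme \<Rightarrow> nat \<Rightarrow> ('a \<Rightarrow> complex mat) \<Rightarrow> bool" where
  "representation G n \<rho> \<longleftrightarrow> \<rho> \<in> hom G (general_linear n)"

definition irreducible_representation ::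
    "('a, 'b) monoid_scheme \<Rightarrow> nat \<Rightarrow> ('a \<Rightarrow> complex mat) \<Rightarrow> bool" where
  "irreducible_representation G n \<rho> \<longleftrightarrow>
     representation G n \<rho> \<and> n \<noteq> 0 \<and>
     (\<forall>W. VectorSpace.subspace class_ring W (module_vec TYPE(complex) n) \<and>
          (\<forall>g\<in>carrier G. \<forall>w\<in>W. \<rho> g *\<^sub>v w \<in> W)
        \<longrightarrow> W = {0\<^sub>v n} \<or> W = carrier_vec n)"

definition mat_trace :: "complex mat \<Rightarrow> complex" where
  "mat_trace A = (\<Sum>i<dim_row A. A $$ (i, i))"

text \<open>Characters of a group on a subset of the type \<^typ>\<open>'a\<close> are total functions on
  \<^typ>\<open>'a\<close>. They are set to 0 off the carrier, so that equality of characters is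
  equality of functions.\<close>

definition character_of :: "('a, 'b) monoid_scheme \<Rightarrow> ('a \<Rightarrow> complex mat) \<Rightarrow> 'a \<Rightarrow> complex" where
  "character_of G \<rho> = (\<lambda>g. if g \<in> carrier G then mat_trace (\<rho> g) else 0)"

definition Irr :: "('a, 'b) monoid_scheme \<Rightarrow> ('a \<Rightarrow> complex) set" where
  "Irr G = {character_of G \<rho> | n \<rho>. irreducible_representation G n \<rho>}"

definition restrict_char :: "'a set \<Rightarrow> ('a \<Rightarrow> complex) \<Rightarrow> 'a \<Rightarrow> complex" where
  "restrict_char K \<chi> = (\<lambda>g. if g \<in> K then \<chi> g else 0)"

definition char_inner :: "'a set \<Rightarrow> ('a \<Rightarrow> complex) \<Rightarrow> ('a \<Rightarrow> complex) \<Rightarrow> complex" where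
  "char_inner K \<chi> \<xi> = (1 / of_nat (card K)) * (\<Sum>k\<in>K. \<chi> k * cnj (\<xi> k))"

definition induced_char ::
    "('a, 'b) monoid_scheme \<Rightarrow> 'a set \<Rightarrow> ('a \<Rightarrow> complex) \<Rightarrow> 'a \<Rightarrow> complex" where
  "induced_char G K \<xi> = (\<lambda>g. if g \<in> carrier G
     then (1 / of_nat (card K)) *
       (\<Sum>x\<in>carrier G. restrict_char K \<xi> (x \<otimes>\<^bsub>G\<^esub> g \<otimes>\<^bsub>G\<^esub> inv\<^bsub>G\<^esub> x))
     else 0)"

definition char_kernel :: "('a, 'b) monoid_scheme \<Rightarrow> ('a \<Rightarrow> complex) \<Rightarrow> 'a set" where
  "char_kernel G \<chi> = {g \<in> carrier G. \<chi> g = \<chi> \<one>\<^bsub>G\<^esub>}"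

text \<open>The two meanings of the notation Irr(- | -): below a character \<open>\<chi>\<close> of an overgroup
  of \<open>K\<close> inside \<open>G\<close>, and not containing a normal subgroup \<open>M\<close> in the kernel. The order in
  the first is the one of \<^theory>\<open>HOL-Library.Complex_Order\<close>: \<open>0 < z\<close> says that \<open>z\<close> is a
  positive real.\<close>

definition Irr_constituents ::
    "('a, 'b) monoid_scheme \<Rightarrow> 'a set \<Rightarrow> ('a \<Rightarrow> complex) \<Rightarrow> ('a \<Rightarrow> complex) set" where
  "Irr_constituents G K \<chi> =
     {\<xi> \<in> Irr (G\<lparr>carrier := K\<rparr>). 0 < char_inner K (restrict_char K \<chi>) \<xi>}"

definition Irr_relative :: "('a, 'b) monoid_scheme \<Rightarrow> 'a set \<Rightarrow> ('a \<Rightarrow> complex) set" where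
  "Irr_relative N M = {\<chi> \<in> Irr N. \<not> M \<subseteq> char_kernel N \<chi>}"

text \<open>The convention is \<open>\<alpha>\<^sup>g(h) = \<alpha>(g h g\<^sup>-\<^sup>1)\<close>, a right action of \<open>G\<close> on Irr(H).\<close>

definition conj_char ::
    "('a, 'b) monoid_scheme \<Rightarrow> 'a set \<Rightarrow> 'a \<Rightarrow> ('a \<Rightarrow> complex) \<Rightarrow> 'a \<Rightarrow> complex" where
  "conj_char G H g \<alpha> =
     restrict_char H (\<lambda>h. \<alpha> (g \<otimes>\<^bsub>G\<^esub> h \<otimes>\<^bsub>G\<^esub> inv\<^bsub>G\<^esub> g))"

definition inertia_group ::
    "('a, 'b) monoid_scheme \<Rightarrow> 'a set \<Rightarrow> ('a \<Rightarrow> complex) \<Rightarrow> 'a set" where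
  "inertia_group G H \<alpha> = {g \<in> carrier G. conj_char G H g \<alpha> = \<alpha>}"

subsection \<open>Camina triples and maximal normal subgroups\<close>

definition camina_triple :: "('a, 'b) monoid_scheme \<Rightarrow> 'a set \<Rightarrow> 'a set \<Rightarrow> bool" where
  "camina_triple G N M \<longleftrightarrow>
     group G \<and> N \<lhd> G \<and> M \<lhd> G \<and> M \<subseteq> N \<and>
     N \<noteq> {\<one>\<^bsub>G\<^esub>} \<and> N \<noteq> carrier G \<and> M \<noteq> {\<one>\<^bsub>G\<^esub>} \<and> M \<noteq> carrier G \<and>
     (\<forall>g\<in>carrier G - N. \<forall>y\<in>g <#\<^bsub>G\<^esub> M. \<exists>x\<in>carrier G. y = inv\<^bsub>G\<^esub> x \<otimes>\<^bsub>G\<^esub> g \<otimes>\<^bsub>G\<^esub> x)"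

definition maximal_normal :: "('a, 'b) monoid_scheme \<Rightarrow> 'a set \<Rightarrow> bool" where
  "maximal_normal G N \<longleftrightarrow> N \<lhd> G \<and> N \<noteq> carrier G \<and>
     (\<forall>K. K \<lhd> G \<and> N \<subseteq> K \<and> K \<noteq> carrier G \<longrightarrow> K = N)"

text \<open>Pitfall: when the indices are not coprime, the condition below allows the inertia
  group to be all of \<open>G\<close>, and then it does not by itself yield a \<open>\<gamma>\<close> with
  \<open>\<gamma>\<^sup>G = \<psi>\<^sup>G\<close> for arbitrary \<open>\<psi> \<in> Irr(N1)\<close>. In the dihedral group of order 8 with
  \<open>N1\<close>, \<open>N2\<close> two maximal subgroups and \<open>H = M1\<close> the centre, take \<open>\<psi> = 1\<close> and \<open>\<alpha> = 1\<close>: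
  \<open>\<psi>\<^sup>G\<close> takes the value 2 on \<open>N1\<close>, whereas every \<open>\<gamma>\<^sup>G\<close> vanishes off \<open>N2\<close>. For such
  G-invariant \<open>\<alpha>\<close> one needs \<open>\<psi>\<close> to lie in Irr(N1 | M1).\<close>

definition inertia_condition ::
    "('a, 'b) monoid_scheme \<Rightarrow> 'a set \<Rightarrow> 'a set \<Rightarrow> ('a \<Rightarrow> complex) \<Rightarrow> bool" where
  "inertia_condition G N1 N2 \<alpha> \<longleftrightarrow>
     (gcd (Coset.order (G Mod N1)) (Coset.order (G Mod N2)) = 1 \<longrightarrow>
        inertia_group G (N1 \<inter> N2) \<alpha> = N1 \<inter> N2) \<and>
     (gcd (Coset.order (G Mod N1)) (Coset.order (G Mod N2)) \<noteq> 1 \<longrightarrow>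
        inertia_group G (N1 \<inter> N2) \<alpha> \<noteq> N1 \<and> inertia_group G (N1 \<inter> N2) \<alpha> \<noteq> N2)"

end

theory Submission
  imports Defs "Jordan_Normal_Form.DL_Rank" "Jordan_Normal_Form.Char_Poly"
    "HOL-Computational_Algebra.Fundamental_Theorem_Algebra" "HOL-Library.Complex_Order"
begin

text \<open>Since \<open>G\<close> is solvable, \<open>N1\<close> and \<open>N2\<close> have prime indices \<open>p\<close> and \<open>q\<close>, and \<open>H\<close> has index \<open>q\<close> in
  \<open>N1\<close> and index \<open>p\<close> in \<open>N2\<close>. In a normal subgroup of prime index, an irreducible character \<open>\<psi>\<close>
  over \<open>\<alpha>\<close> is induced from \<open>\<alpha>\<close> if \<open>\<alpha>\<close> is not invariant and extends \<open>\<alpha>\<close> if it is.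

  (a) If the inertia group of \<open>\<alpha>\<close> meets both \<open>N1\<close> and \<open>N2\<close> in \<open>H\<close>, then \<open>\<psi> = \<alpha>\<^bsup>N1\<^esup>\<close>, and
  \<open>\<gamma> = \<alpha>\<^bsup>N2\<^esup>\<close> is irreducible with \<open>\<gamma>\<^sup>G = \<alpha>\<^sup>G = \<psi>\<^sup>G\<close>. Otherwise \<open>\<alpha>\<close> is \<open>G\<close>-invariant; characters in
  Irr(G | M1) vanish off \<open>N1\<close> by the Camina condition, so \<open>\<psi>\<close> cannot extend to \<open>G\<close>, whence
  \<open>\<chi> = \<psi>\<^sup>G\<close> is irreducible of degree \<open>p \<alpha>(1)\<close>. A constituent \<open>\<gamma>\<close> of \<open>\<chi>\<close> on \<open>N2\<close> over \<open>\<alpha>\<close> extends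
  \<open>\<alpha>\<close>, so \<open>\<chi>\<close> does not extend \<open>\<gamma>\<close> for reasons of degree, and \<open>\<chi> = \<gamma>\<^sup>G\<close>.

  (b) Each of \<open>\<psi>(1)/\<alpha>(1)\<close> and \<open>\<gamma>(1)/\<alpha>(1)\<close> is determined by the dichotomy, and
  \<open>p \<psi>(1) = q \<gamma>(1)\<close> excludes the forbidden inertia groups.\<close>

subsection \<open>Sums and traces of matrices\<close>

text \<open>Induction is only a formula on functions here. An induced function is recognised as
  irreducible by comparing it with an irreducible character that is already at hand: both have norm
  1 and their inner product is a positive integer, so they agree. Hence \<open>\<gamma>\<close> in
  (a) is picked as a constituent and identified afterwards; the existence of characters above a
  given one rests on the regular character.

  Extensions are not constructed either: a given character over an invariant \<open>\<alpha>\<close>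
  is shown to restrict to it with multiplicity 1. One identity yields both the multiple
  \<open>e\<alpha>\<close> and the vanishing in a Camina triple: a class function, summed against an
  irreducible representation, gives a scalar matrix.

  In (b), for \<open>p \<noteq> q\<close> the degrees leave only inertia groups meeting
  \<open>N1\<close> and \<open>N2\<close> in \<open>H\<close>, and coprime orders in
  \<open>G/H\<close> make such a group equal to \<open>H\<close>. For \<open>p = q\<close> a further
  subgroup between \<open>H\<close> and \<open>G\<close>, or \<open>G\<close> itself, may remain,
  which is why (ii) excludes only \<open>N1\<close> and \<open>N2\<close>.\<close>

lemma mat_trace_mult_comm:
  assumes "A \<in> carrier_mat n m" "B \<in> carrier_mat m n"
  shows "mat_trace (A * B) = mat_trace (B * A)"
proof -
  have "mat_trace (A * B) = (\<Sum>i<n. \<Sum>j<m. A $$ (i,j) * B $$ (j,i))"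
    using assms by (simp add: mat_trace_def scalar_prod_def atLeast0LessThan)
  also have "\<dots> = (\<Sum>j<m. \<Sum>i<n. B $$ (j,i) * A $$ (i,j))"
    by (subst sum.swap) (simp add: mult.commute)
  also have "\<dots> = mat_trace (B * A)"
    using assms by (simp add: mat_trace_def scalar_prod_def atLeast0LessThan)
  finally show ?thesis .
qed

text \<open>The dimensions are arguments because the matrix type holds all sizes at once: even an
  empty sum must know its shape.\<close>

definition mat_sum :: "nat \<Rightarrow> nat \<Rightarrow> ('i \<Rightarrow> complex mat) \<Rightarrow> 'i set \<Rightarrow> complex mat" where
  "mat_sum n m F S = mat n m (\<lambda>ij. \<Sum>g\<in>S. F g $$ ij)"

lemma mat_sum_carrier [simp]: "mat_sum n m F S \<in> carrier_mat n m"
  by (simp add: mat_sum_def)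

lemma mat_sum_index: "i < n \<Longrightarrow> j < m \<Longrightarrow> mat_sum n m F S $$ (i,j) = (\<Sum>g\<in>S. F g $$ (i,j))"
  by (simp add: mat_sum_def)

lemma mat_sum_cong: "(\<And>g. g \<in> S \<Longrightarrow> F g = F' g) \<Longrightarrow> mat_sum n m F S = mat_sum n m F' S"
  by (auto simp: mat_sum_def intro!: eq_matI sum.cong)

lemma mat_sum_reindex: "bij_betw h S T \<Longrightarrow> mat_sum n m F T = mat_sum n m (\<lambda>g. F (h g)) S"
  unfolding mat_sum_def by (intro eq_matI) (auto simp: sum.reindex_bij_betw[of h S T "\<lambda>g. F g $$ _"])

lemma mult_mat_sum:
  assumes "A \<in> carrier_mat l n" "\<And>g. g \<in> S \<Longrightarrow> F g \<in> carrier_mat n m"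
  shows "A * mat_sum n m F S = mat_sum l m (\<lambda>g. A * F g) S"
proof (rule eq_matI)
  fix i j assume ij: "i < dim_row (mat_sum l m (\<lambda>g. A * F g) S)" "j < dim_col (mat_sum l m (\<lambda>g. A * F g) S)"
  then have ij: "i < l" "j < m" by (auto simp: mat_sum_def)
  have "(A * mat_sum n m F S) $$ (i,j) = (\<Sum>k<n. A $$ (i,k) * (\<Sum>g\<in>S. F g $$ (k,j)))"
    using assms(1) ij by (simp add: mat_sum_def scalar_prod_def atLeast0LessThan)
  also have "\<dots> = (\<Sum>g\<in>S. \<Sum>k<n. A $$ (i,k) * F g $$ (k,j))"
    by (subst sum.swap) (simp add: sum_distrib_left)
  also have "\<dots> = (\<Sum>g\<in>S. (A * F g) $$ (i,j))"
    using assms ij by (intro sum.cong) (auto simp: scalar_prod_def atLeast0LessThan dest!: assms(2))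
  finally show "(A * mat_sum n m F S) $$ (i,j) = mat_sum l m (\<lambda>g. A * F g) S $$ (i,j)"
    using ij by (simp add: mat_sum_def)
qed (use assms in \<open>auto simp: mat_sum_def\<close>)

lemma mat_sum_mult:
  assumes "A \<in> carrier_mat m l" "\<And>g. g \<in> S \<Longrightarrow> F g \<in> carrier_mat n m"
  shows "mat_sum n m F S * A = mat_sum n l (\<lambda>g. F g * A) S"
proof (rule eq_matI)
  fix i j assume ij: "i < dim_row (mat_sum n l (\<lambda>g. F g * A) S)" "j < dim_col (mat_sum n l (\<lambda>g. F g * A) S)"
  then have ij: "i < n" "j < l" by (auto simp: mat_sum_def)
  have "(mat_sum n m F S * A) $$ (i,j) = (\<Sum>k<m. (\<Sum>g\<in>S. F g $$ (i,k)) * A $$ (k,j))"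
    using assms(1) ij by (simp add: mat_sum_def scalar_prod_def atLeast0LessThan)
  also have "\<dots> = (\<Sum>g\<in>S. \<Sum>k<m. F g $$ (i,k) * A $$ (k,j))"
    by (subst sum.swap) (simp add: sum_distrib_right)
  also have "\<dots> = (\<Sum>g\<in>S. (F g * A) $$ (i,j))"
    using assms ij by (intro sum.cong) (auto simp: scalar_prod_def atLeast0LessThan dest!: assms(2))
  finally show "(mat_sum n m F S * A) $$ (i,j) = mat_sum n l (\<lambda>g. F g * A) S $$ (i,j)"
    using ij by (simp add: mat_sum_def)
qed (use assms in \<open>auto simp: mat_sum_def\<close>)

lemma mat_trace_mat_sum:
  assumes "\<And>g. g \<in> S \<Longrightarrow> F g \<in> carrier_mat n n"
  shows "mat_trace (mat_sum n n F S) = (\<Sum>g\<in>S. mat_trace (F g))"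
proof -
  have "mat_trace (mat_sum n n F S) = (\<Sum>i<n. \<Sum>g\<in>S. F g $$ (i,i))"
    by (simp add: mat_trace_def mat_sum_def)
  also have "\<dots> = (\<Sum>g\<in>S. \<Sum>i<n. F g $$ (i,i))" by (rule sum.swap)
  also have "\<dots> = (\<Sum>g\<in>S. mat_trace (F g))"
    by (intro sum.cong refl) (auto simp: mat_trace_def dest!: assms)
  finally show ?thesis .
qed

lemma mat_trace_smult: "A \<in> carrier_mat n n \<Longrightarrow> mat_trace (c \<cdot>\<^sub>m A) = c * mat_trace A"
  by (simp add: mat_trace_def sum_distrib_left)

lemma mat_trace_one: "mat_trace (1\<^sub>m n) = of_nat n"
  by (simp add: mat_trace_def)

section \<open>Representations and subspaces in terms of matrices and vectors\<close>

lemma subspace_module_vec_iff: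
  "VectorSpace.subspace class_ring W (module_vec TYPE(complex) n) \<longleftrightarrow>
     W \<subseteq> carrier_vec n \<and> 0\<^sub>v n \<in> W \<and> (\<forall>v\<in>W. \<forall>w\<in>W. v + w \<in> W) \<and> (\<forall>c. \<forall>v\<in>W. c \<cdot>\<^sub>v v \<in> W)"
proof -
  have "vectorspace (class_ring :: complex ring) (module_vec TYPE(complex) n)" by (rule vec_vs)
  then show ?thesis
    unfolding VectorSpace.subspace_def submodule_def vectorspace_def
    by (auto simp: module_vec_simps)
qed

text \<open>The unit group behind \<open>general_linear\<close> is traded for plain matrix
  identities: by multiplicativity and the value at \<open>\<one>\<close>, the matrix
  \<open>\<rho> (inv g)\<close> inverts \<open>\<rho> g\<close>.\<close>

lemma representation_iff:
  assumes "group G"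
  shows "representation G n \<rho> \<longleftrightarrow>
     (\<forall>g\<in>carrier G. \<rho> g \<in> carrier_mat n n) \<and> \<rho> \<one>\<^bsub>G\<^esub> = 1\<^sub>m n \<and>
     (\<forall>g\<in>carrier G. \<forall>h\<in>carrier G. \<rho> (g \<otimes>\<^bsub>G\<^esub> h) = \<rho> g * \<rho> h)" (is "?l \<longleftrightarrow> ?r")
proof -
  interpret group G by fact
  let ?R = "ring_mat TYPE(complex) n ()"
  interpret R: ring ?R by (rule ring_mat)
  have grp: "group (general_linear n)" unfolding general_linear_def by (rule R.units_group)
  have mult: "(\<otimes>\<^bsub>general_linear n\<^esub>) = (*)" and one: "\<one>\<^bsub>general_linear n\<^esub> = 1\<^sub>m n"
    and carr: "carrier (general_linear n) = {A \<in> carrier_mat n n. \<exists>B\<in>carrier_mat n n. B * A = 1\<^sub>m n \<and> A * B = 1\<^sub>m n}"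
    by (auto simp: general_linear_def units_of_def Units_def ring_mat_simps)
  show ?thesis
  proof
    assume l: ?l
    then have hom: "\<rho> \<in> hom G (general_linear n)" by (simp add: representation_def)
    have "\<rho> \<one>\<^bsub>G\<^esub> = 1\<^sub>m n"
      using group_hom.hom_one[of G "general_linear n" \<rho>] grp hom one
      by (simp add: group_hom_def group_hom_axioms_def is_group)
    then show ?r using hom by (auto simp: hom_def mult carr)
  next
    assume r: ?r
    have "\<rho> g \<in> carrier (general_linear n)" if g: "g \<in> carrier G" for g
    proof -
      have "\<rho> (inv\<^bsub>G\<^esub> g) \<in> carrier_mat n n" "\<rho> (inv\<^bsub>G\<^esub> g) * \<rho> g = 1\<^sub>m n" "\<rho> g * \<rho> (inv\<^bsub>G\<^esub> g) = 1\<^sub>m n"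
        using r g by (metis inv_closed, metis inv_closed l_inv, metis inv_closed r_inv)
      then show ?thesis using r g by (auto simp: carr)
    qed
    then show ?l using r by (auto simp: representation_def hom_def mult)
  qed
qed

lemma representationD:
  assumes "group G" "representation G n \<rho>"
  shows "g \<in> carrier G \<Longrightarrow> \<rho> g \<in> carrier_mat n n" "\<rho> \<one>\<^bsub>G\<^esub> = 1\<^sub>m n"
    "g \<in> carrier G \<Longrightarrow> h \<in> carrier G \<Longrightarrow> \<rho> (g \<otimes>\<^bsub>G\<^esub> h) = \<rho> g * \<rho> h"
    "g \<in> carrier G \<Longrightarrow> \<rho> (inv\<^bsub>G\<^esub> g) * \<rho> g = 1\<^sub>m n" "g \<in> carrier G \<Longrightarrow> \<rho> g * \<rho> (inv\<^bsub>G\<^esub> g) = 1\<^sub>m n"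
proof -
  interpret group G by fact
  note r = assms(2)[unfolded representation_iff[OF assms(1)]]
  show "g \<in> carrier G \<Longrightarrow> \<rho> g \<in> carrier_mat n n" "\<rho> \<one>\<^bsub>G\<^esub> = 1\<^sub>m n"
    "g \<in> carrier G \<Longrightarrow> h \<in> carrier G \<Longrightarrow> \<rho> (g \<otimes>\<^bsub>G\<^esub> h) = \<rho> g * \<rho> h" using r by auto
  show "g \<in> carrier G \<Longrightarrow> \<rho> (inv\<^bsub>G\<^esub> g) * \<rho> g = 1\<^sub>m n" using r by (metis inv_closed l_inv)
  show "g \<in> carrier G \<Longrightarrow> \<rho> g * \<rho> (inv\<^bsub>G\<^esub> g) = 1\<^sub>m n" using r by (metis inv_closed r_inv)
qed

lemma subspace_kernel:
  fixes A :: "complex mat"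
  assumes "A \<in> carrier_mat m n"
  shows "VectorSpace.subspace class_ring {v \<in> carrier_vec n. A *\<^sub>v v = 0\<^sub>v m} (module_vec TYPE(complex) n)"
  unfolding subspace_module_vec_iff using assms
  by (auto simp: mult_add_distrib_mat_vec[of _ m n] mult_mat_vec[of _ m n])

lemma subspace_range:
  fixes A :: "complex mat"
  assumes A: "A \<in> carrier_mat m n"
  shows "VectorSpace.subspace class_ring {A *\<^sub>v v |v. v \<in> carrier_vec n} (module_vec TYPE(complex) m)"
  unfolding subspace_module_vec_iff
proof (intro conjI ballI allI)
  show "{A *\<^sub>v v |v. v \<in> carrier_vec n} \<subseteq> carrier_vec m" using A by auto
  show "0\<^sub>v m \<in> {A *\<^sub>v v |v. v \<in> carrier_vec n}"
    using A by (auto intro!: exI[of _ "0\<^sub>v n"])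
next
  fix v w assume "v \<in> {A *\<^sub>v v |v. v \<in> carrier_vec n}" "w \<in> {A *\<^sub>v v |v. v \<in> carrier_vec n}"
  then obtain v' w' where vw: "v = A *\<^sub>v v'" "w = A *\<^sub>v w'" "v' \<in> carrier_vec n" "w' \<in> carrier_vec n" by auto
  then have "v + w = A *\<^sub>v (v' + w')" using A by (simp add: mult_add_distrib_mat_vec[of _ m n])
  then show "v + w \<in> {A *\<^sub>v v |v. v \<in> carrier_vec n}" using vw(3,4) by auto
next
  fix c v assume "v \<in> {A *\<^sub>v v |v. v \<in> carrier_vec n}"
  then obtain v' where vw: "v = A *\<^sub>v v'" "v' \<in> carrier_vec n" by auto
  then have "c \<cdot>\<^sub>v v = A *\<^sub>v (c \<cdot>\<^sub>v v')" using A by (simp add: mult_mat_vec[of _ m n])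
  then show "c \<cdot>\<^sub>v v \<in> {A *\<^sub>v v |v. v \<in> carrier_vec n}" using vw(2) by auto
qed

lemma mat_eq_0_iff_mult_vec:
  fixes A :: "complex mat"
  assumes "A \<in> carrier_mat m n"
  shows "A = 0\<^sub>m m n \<longleftrightarrow> (\<forall>v\<in>carrier_vec n. A *\<^sub>v v = 0\<^sub>v m)"
proof
  assume z: "\<forall>v\<in>carrier_vec n. A *\<^sub>v v = 0\<^sub>v m"
  show "A = 0\<^sub>m m n"
  proof (rule eq_matI)
    fix i j assume ij: "i < dim_row (0\<^sub>m m n :: complex mat)" "j < dim_col (0\<^sub>m m n :: complex mat)"
    then have "A *\<^sub>v unit_vec n j = 0\<^sub>v m" using z by auto
    then have "(A *\<^sub>v unit_vec n j) $ i = 0" using ij by simp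
    then show "A $$ (i,j) = (0\<^sub>m m n :: complex mat) $$ (i,j)" using ij assms by simp
  qed (use assms in auto)
qed (use assms in auto)

subsection \<open>Schur's lemma\<close>

lemma irreducible_representationD:
  assumes "irreducible_representation G n \<rho>"
  shows "representation G n \<rho>" "n \<noteq> 0"
    "VectorSpace.subspace class_ring W (module_vec TYPE(complex) n) \<Longrightarrow>
       (\<And>g w. g \<in> carrier G \<Longrightarrow> w \<in> W \<Longrightarrow> \<rho> g *\<^sub>v w \<in> W) \<Longrightarrow> W = {0\<^sub>v n} \<or> W = carrier_vec n"
  using assms unfolding irreducible_representation_def by blast+

lemma intertwiner_kernel_invariant:
  assumes G: "group G" and \<rho>: "representation G n \<rho>" and \<sigma>: "representation G m \<sigma>"
    and A: "A \<in> carrier_mat n m" and comm: "\<And>g. g \<in> carrier G \<Longrightarrow> \<rho> g * A = A * \<sigma> g"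
    and g: "g \<in> carrier G" and w: "w \<in> {v \<in> carrier_vec m. A *\<^sub>v v = 0\<^sub>v n}"
  shows "\<sigma> g *\<^sub>v w \<in> {v \<in> carrier_vec m. A *\<^sub>v v = 0\<^sub>v n}"
proof -
  have r: "\<rho> g \<in> carrier_mat n n" "\<sigma> g \<in> carrier_mat m m" using representationD(1)[OF G \<rho> g] representationD(1)[OF G \<sigma> g] by auto
  have "A *\<^sub>v (\<sigma> g *\<^sub>v w) = (A * \<sigma> g) *\<^sub>v w" using r A w by (simp add: assoc_mult_mat_vec[of _ n m _ m])
  also have "\<dots> = (\<rho> g * A) *\<^sub>v w" using comm g by simp
  also have "\<dots> = \<rho> g *\<^sub>v (A *\<^sub>v w)" using r A w by (simp add: assoc_mult_mat_vec[of _ n n _ m])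
  also have "\<dots> = 0\<^sub>v n" using r w by (intro eq_vecI) (auto simp: scalar_prod_def)
  finally show ?thesis using r w by auto
qed

text \<open>Over the complex numbers \<open>A\<close> has an eigenvalue \<open>c\<close>. Then
  \<open>A - c\<close> still commutes with \<open>\<rho>\<close>, so its kernel is an invariant
  subspace; it contains an eigenvector and is therefore everything.\<close>

lemma schur_scalar:
  assumes G: "group G" and irr: "irreducible_representation G n \<rho>"
    and A: "A \<in> carrier_mat n n" and comm: "\<And>g. g \<in> carrier G \<Longrightarrow> \<rho> g * A = A * \<rho> g"
  obtains c where "A = c \<cdot>\<^sub>m 1\<^sub>m n"
proof -
  note \<rho> = irreducible_representationD(1)[OF irr] and n = irreducible_representationD(2)[OF irr]
  have "degree (char_poly A) = n" using degree_monic_char_poly[OF A] by simp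
  then have "\<not> constant (poly (char_poly A))" using n by (simp add: constant_degree)
  then obtain c where "poly (char_poly A) c = 0" using fundamental_theorem_of_algebra by blast
  then have "eigenvalue A c" using eigenvalue_root_char_poly[OF A] by simp
  then obtain v where v: "v \<in> carrier_vec n" "v \<noteq> 0\<^sub>v n" "A *\<^sub>v v = c \<cdot>\<^sub>v v"
    using A unfolding eigenvalue_def eigenvector_def by auto
  define B where "B = A - c \<cdot>\<^sub>m 1\<^sub>m n"
  have B: "B \<in> carrier_mat n n" unfolding B_def by (intro minus_carrier_mat) auto
  have commB: "\<rho> g * B = B * \<rho> g" if g: "g \<in> carrier G" for g
  proof -
    have r: "\<rho> g \<in> carrier_mat n n" using representationD(1)[OF G \<rho> g] .
    have "\<rho> g * B = \<rho> g * A - c \<cdot>\<^sub>m \<rho> g"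
      using r A unfolding B_def by (simp add: mult_minus_distrib_mat[of _ n n _ n] mult_smult_distrib[of _ n n _ n])
    also have "\<dots> = B * \<rho> g"
      using r A comm[OF g] unfolding B_def by (simp add: minus_mult_distrib_mat[of _ n n _ _ n] mult_smult_assoc_mat[of _ n n _ n])
    finally show ?thesis .
  qed
  define W where "W = {v \<in> carrier_vec n. B *\<^sub>v v = 0\<^sub>v n}"
  have "B *\<^sub>v v = 0\<^sub>v n"
  proof -
    have "B *\<^sub>v v = A *\<^sub>v v - (c \<cdot>\<^sub>m 1\<^sub>m n) *\<^sub>v v"
      unfolding B_def using A v by (intro minus_mult_distrib_mat_vec[of _ n n]) auto
    also have "(c \<cdot>\<^sub>m 1\<^sub>m n) *\<^sub>v v = c \<cdot>\<^sub>v v"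
    proof (rule eq_vecI)
      fix i assume "i < dim_vec (c \<cdot>\<^sub>v v)"
      then have i: "i < n" using v by simp
      have "row (c \<cdot>\<^sub>m 1\<^sub>m n) i = c \<cdot>\<^sub>v unit_vec n i" using i by (intro eq_vecI) auto
      then show "((c \<cdot>\<^sub>m 1\<^sub>m n) *\<^sub>v v) $ i = (c \<cdot>\<^sub>v v) $ i" using i v(1) by simp
    qed (use v in auto)
    finally show ?thesis using v by simp
  qed
  then have "v \<in> W" using v by (simp add: W_def)
  moreover have "W = {0\<^sub>v n} \<or> W = carrier_vec n"
    unfolding W_def
    by (rule irreducible_representationD(3)[OF irr subspace_kernel[OF B]])
      (rule intertwiner_kernel_invariant[OF G \<rho> \<rho> B commB])
  ultimately have "W = carrier_vec n" using v by auto
  then have "B = 0\<^sub>m n n" using mat_eq_0_iff_mult_vec[OF B] by (auto simp: W_def)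
  then have "A = c \<cdot>\<^sub>m 1\<^sub>m n"
  proof -
    have "A $$ (i,j) = (c \<cdot>\<^sub>m 1\<^sub>m n) $$ (i,j)" if "i < n" "j < n" for i j
    proof -
      have "(A - c \<cdot>\<^sub>m 1\<^sub>m n) $$ (i,j) = 0" using \<open>B = 0\<^sub>m n n\<close> that unfolding B_def by simp
      then show ?thesis using that A by simp
    qed
    then show ?thesis using A by (intro eq_matI) auto
  qed
  then show ?thesis by (rule that)
qed

text \<open>Kernel and range of an intertwiner are invariant, so a nonzero one is bijective and
  conjugates \<open>\<sigma>\<close> into \<open>\<rho>\<close>. Only the equality of the traces is
  recorded, since later arguments compare characters rather than isomorphism classes.\<close>

lemma schur_iso:
  assumes G: "group G" and irr: "irreducible_representation G n \<rho>" and irr': "irreducible_representation G m \<sigma>"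
    and A: "A \<in> carrier_mat n m" and comm: "\<And>g. g \<in> carrier G \<Longrightarrow> \<rho> g * A = A * \<sigma> g"
    and nz: "A \<noteq> 0\<^sub>m n m"
  shows "character_of G \<rho> = character_of G \<sigma>"
proof -
  note \<rho> = irreducible_representationD(1)[OF irr] and \<sigma> = irreducible_representationD(1)[OF irr']
  define W where "W = {v \<in> carrier_vec m. A *\<^sub>v v = 0\<^sub>v n}"
  define V where "V = {A *\<^sub>v v |v. v \<in> carrier_vec m}"
  have "W = {0\<^sub>v m} \<or> W = carrier_vec m"
    unfolding W_def
    by (rule irreducible_representationD(3)[OF irr' subspace_kernel[OF A]])
      (rule intertwiner_kernel_invariant[OF G \<rho> \<sigma> A comm])
  moreover have "W \<noteq> carrier_vec m" using nz mat_eq_0_iff_mult_vec[OF A] by (auto simp: W_def)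
  ultimately have inj: "W = {0\<^sub>v m}" by blast
  have inv: "\<rho> g *\<^sub>v w \<in> V" if g: "g \<in> carrier G" and w: "w \<in> V" for g w
  proof -
    obtain v where v: "v \<in> carrier_vec m" "w = A *\<^sub>v v" using w unfolding V_def by blast
    have r: "\<rho> g \<in> carrier_mat n n" "\<sigma> g \<in> carrier_mat m m" using representationD(1)[OF G \<rho> g] representationD(1)[OF G \<sigma> g] by auto
    have "\<rho> g *\<^sub>v w = (\<rho> g * A) *\<^sub>v v"
      unfolding v(2) by (rule assoc_mult_mat_vec[OF r(1) A v(1), symmetric])
    also have "\<dots> = A *\<^sub>v (\<sigma> g *\<^sub>v v)" unfolding comm[OF g] by (rule assoc_mult_mat_vec[OF A r(2) v(1)])
    finally show ?thesis using mult_mat_vec_carrier[OF r(2) v(1)] unfolding V_def by blast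
  qed
  have "V = {0\<^sub>v n} \<or> V = carrier_vec n"
    unfolding V_def by (rule irreducible_representationD(3)[OF irr subspace_range[OF A]])
      (rule inv[unfolded V_def])
  moreover have "V \<noteq> {0\<^sub>v n}"
  proof -
    obtain v where v: "v \<in> carrier_vec m" "A *\<^sub>v v \<noteq> 0\<^sub>v n" using nz mat_eq_0_iff_mult_vec[OF A] by blast
    then have "A *\<^sub>v v \<in> V" unfolding V_def by blast
    then show ?thesis using v(2) by blast
  qed
  ultimately have surj: "V = carrier_vec n" by blast
  have "\<forall>i<n. \<exists>v\<in>carrier_vec m. A *\<^sub>v v = unit_vec n i"
  proof (intro allI impI)
    fix i assume "i < n"
    then have "unit_vec n i \<in> V" unfolding surj by simp
    then show "\<exists>v\<in>carrier_vec m. A *\<^sub>v v = unit_vec n i" unfolding V_def by fastforce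
  qed
  then obtain b where b: "\<And>i. i < n \<Longrightarrow> b i \<in> carrier_vec m" "\<And>i. i < n \<Longrightarrow> A *\<^sub>v b i = unit_vec n i" by metis
  define B where "B = mat m n (\<lambda>(i,j). b j $ i)"
  have B: "B \<in> carrier_mat m n" by (simp add: B_def)
  have colB: "col B j = b j" if "j < n" for j
    using b(1)[OF that] that by (intro eq_vecI) (auto simp: B_def)
  have AB: "A * B = 1\<^sub>m n"
  proof (rule eq_matI)
    fix i j assume ij: "i < dim_row (1\<^sub>m n :: complex mat)" "j < dim_col (1\<^sub>m n :: complex mat)"
    then have "(A * B) $$ (i,j) = (A *\<^sub>v col B j) $ i" using A B by simp
    also have "\<dots> = unit_vec n j $ i" using colB b ij by simp
    finally show "(A * B) $$ (i,j) = 1\<^sub>m n $$ (i,j)" using ij by (simp add: unit_vec_def)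
  qed (use A B in auto)
  \<comment> \<open>Equality of \<open>n\<close> and \<open>m\<close> has not been established, so
    the right inverse \<open>B\<close> is not automatically a left inverse. It becomes one because
    \<open>A (B A - 1) = 0\<close> and \<open>A\<close> is injective.\<close>
  have BA: "B * A = 1\<^sub>m m"
  proof -
    have c: "B * A - 1\<^sub>m m \<in> carrier_mat m m" by (intro minus_carrier_mat) auto
    have "(B * A - 1\<^sub>m m) *\<^sub>v v = 0\<^sub>v m" if v: "v \<in> carrier_vec m" for v
    proof -
      have w: "(B * A - 1\<^sub>m m) *\<^sub>v v \<in> carrier_vec m" using c v by simp
      have "A * (B * A - 1\<^sub>m m) = (A * B) * A - A"
        using A B by (simp add: mult_minus_distrib_mat[of _ n m _ m] assoc_mult_mat[of _ n m _ n _ m])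
      also have "\<dots> = 0\<^sub>m n m" using AB A by simp
      finally have "A *\<^sub>v ((B * A - 1\<^sub>m m) *\<^sub>v v) = 0\<^sub>v n"
        using A c v mat_eq_0_iff_mult_vec[of "0\<^sub>m n m" n m] by (simp flip: assoc_mult_mat_vec[of _ n m _ m])
      then have "(B * A - 1\<^sub>m m) *\<^sub>v v \<in> W" unfolding W_def using w by blast
      then show ?thesis unfolding inj by blast
    qed
    then have "B * A - 1\<^sub>m m = 0\<^sub>m m m" using mat_eq_0_iff_mult_vec[OF c] by blast
    then have "(B * A) $$ (i,j) - 1\<^sub>m m $$ (i,j) = 0" if "i < m" "j < m" for i j
      using that A B by (metis carrier_matD index_minus_mat(1) index_one_mat(2,3) index_zero_mat(1))
    then show ?thesis using A B by (intro eq_matI) auto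
  qed
  show ?thesis
  proof
    fix g
    show "character_of G \<rho> g = character_of G \<sigma> g"
    proof (cases "g \<in> carrier G")
      case g: True
      have r: "\<rho> g \<in> carrier_mat n n" "\<sigma> g \<in> carrier_mat m m" using representationD(1)[OF G \<rho> g] representationD(1)[OF G \<sigma> g] by auto
      have "mat_trace (\<rho> g) = mat_trace (\<rho> g * (A * B))" using AB r by simp
      also have "\<dots> = mat_trace ((A * \<sigma> g) * B)"
        using A B r comm[OF g] by (simp flip: assoc_mult_mat[of _ n n _ m _ n])
      also have "\<dots> = mat_trace (B * (A * \<sigma> g))" using A B r by (intro mat_trace_mult_comm[of _ n m]) auto
      also have "\<dots> = mat_trace (\<sigma> g)" using A B r BA by (simp flip: assoc_mult_mat[of _ m n _ m _ m])
      finally show ?thesis using g by (simp add: character_of_def)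
    qed (simp add: character_of_def)
  qed
qed

lemma bij_betw_mult_left:
  fixes G (structure)
  assumes "group G" "h \<in> carrier G"
  shows "bij_betw (\<lambda>g. h \<otimes>\<^bsub>G\<^esub> g) (carrier G) (carrier G)"
proof -
  interpret group G by fact
  show ?thesis
    by (rule bij_betwI[where g = "\<lambda>g. inv h \<otimes> g"]) (use assms in \<open>auto simp flip: m_assoc\<close>)
qed

lemma bij_betw_mult_right:
  fixes G (structure)
  assumes "group G" "h \<in> carrier G"
  shows "bij_betw (\<lambda>g. g \<otimes>\<^bsub>G\<^esub> h) (carrier G) (carrier G)"
proof -
  interpret group G by fact
  show ?thesis
    by (rule bij_betwI[where g = "\<lambda>g. g \<otimes> inv h"]) (use assms in \<open>auto simp: m_assoc\<close>)
qed

lemma bij_betw_conj: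
  fixes G (structure)
  assumes "group G" "h \<in> carrier G"
  shows "bij_betw (\<lambda>g. h \<otimes> g \<otimes> inv h) (carrier G) (carrier G)"
proof -
  interpret group G by fact
  have "inv h \<otimes> (h \<otimes> g) = g" "h \<otimes> (inv h \<otimes> g) = g" if "g \<in> carrier G" for g
    using assms that by (simp_all flip: m_assoc)
  then show ?thesis
    by (intro bij_betwI[where g = "\<lambda>g. inv h \<otimes> g \<otimes> h"]) (use assms in \<open>auto simp: m_assoc\<close>)
qed

text \<open>Substituting \<open>h \<otimes> g\<close> for \<open>g\<close> in the sum moves
  \<open>\<rho> h\<close> across to \<open>\<sigma> h\<close>. The matrix \<open>Y\<close> stays
  free, so that elementary matrices can be inserted to isolate single coefficients.\<close>

lemma intertwiner_average:
  fixes G (structure)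
  assumes G: "group G" and \<rho>: "representation G n \<rho>" and \<sigma>: "representation G m \<sigma>"
    and Y: "Y \<in> carrier_mat n m" and h: "h \<in> carrier G"
    and A_def: "A = mat_sum n m (\<lambda>g. \<rho> g * Y * \<sigma> (inv\<^bsub>G\<^esub> g)) (carrier G)"
  shows "\<rho> h * A = A * \<sigma> h"
proof -
  interpret group G by fact
  note r = representationD(1)[OF G \<rho>] representationD(1)[OF G \<sigma>]
  have c: "\<rho> g * Y * \<sigma> (inv g) \<in> carrier_mat n m" if "g \<in> carrier G" for g
    using r(1)[OF that] r(2)[of "inv g"] Y that by auto
  have "A * \<sigma> h = mat_sum n m (\<lambda>g. \<rho> g * Y * \<sigma> (inv g) * \<sigma> h) (carrier G)"
    unfolding A_def using r(2)[OF h] c by (rule mat_sum_mult)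
  also have "\<dots> = mat_sum n m (\<lambda>g. \<rho> (h \<otimes> g) * Y * \<sigma> (inv (h \<otimes> g)) * \<sigma> h) (carrier G)"
    by (rule mat_sum_reindex[OF bij_betw_mult_left[OF G h]])
  also have "\<dots> = mat_sum n m (\<lambda>g. \<rho> h * (\<rho> g * Y * \<sigma> (inv g))) (carrier G)"
  proof (rule mat_sum_cong)
    fix g assume g: "g \<in> carrier G"
    have rr: "\<rho> g \<in> carrier_mat n n" "\<rho> h \<in> carrier_mat n n" "\<sigma> (inv g) \<in> carrier_mat m m" "\<sigma> (inv h) \<in> carrier_mat m m"
      "\<sigma> h \<in> carrier_mat m m"
      using r g h by auto
    have "\<sigma> (inv (h \<otimes> g)) * \<sigma> h = \<sigma> (inv (h \<otimes> g) \<otimes> h)"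
      using g h by (simp add: representationD(3)[OF G \<sigma>])
    also have "inv (h \<otimes> g) \<otimes> h = inv g" using g h by (simp add: inv_mult_group m_assoc)
    finally have s: "\<sigma> (inv (h \<otimes> g)) * \<sigma> h = \<sigma> (inv g)" .
    have "\<rho> (h \<otimes> g) * Y * \<sigma> (inv (h \<otimes> g)) * \<sigma> h = \<rho> (h \<otimes> g) * Y * (\<sigma> (inv (h \<otimes> g)) * \<sigma> h)"
      using r(1)[of "h \<otimes> g"] r(2)[of "inv (h \<otimes> g)"] rr Y g h by (intro assoc_mult_mat[of _ n m _ m _ m]) auto
    also have "\<dots> = \<rho> h * \<rho> g * Y * \<sigma> (inv g)" using s g h by (simp add: representationD(3)[OF G \<rho>])
    also have "\<dots> = \<rho> h * (\<rho> g * Y * \<sigma> (inv g))"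
      using rr Y by (simp add: assoc_mult_mat[of _ n n _ n _ m] assoc_mult_mat[of _ n n _ m _ m])
    finally show "\<rho> (h \<otimes> g) * Y * \<sigma> (inv (h \<otimes> g)) * \<sigma> h = \<rho> h * (\<rho> g * Y * \<sigma> (inv g))" .
  qed
  also have "\<dots> = \<rho> h * A" unfolding A_def by (rule mult_mat_sum[symmetric]) (use r(1)[OF h] c in auto)
  finally show ?thesis by simp
qed

section \<open>The conjugate transpose and the trace at an inverse element\<close>

lemma mult_vec_index:
  "A \<in> carrier_mat n m \<Longrightarrow> v \<in> carrier_vec m \<Longrightarrow> i < n \<Longrightarrow> (A *\<^sub>v v) $ i = (\<Sum>j<m. A $$ (i,j) * v $ j)"
  by (simp add: scalar_prod_def atLeast0LessThan)

definition mat_adj :: "complex mat \<Rightarrow> complex mat" where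
  "mat_adj A = mat (dim_col A) (dim_row A) (\<lambda>(i,j). cnj (A $$ (j,i)))"

lemma mat_adj_carrier [simp]: "A \<in> carrier_mat n m \<Longrightarrow> mat_adj A \<in> carrier_mat m n"
  by (auto simp: mat_adj_def)

lemma mat_adj_mult:
  assumes "A \<in> carrier_mat n m" "B \<in> carrier_mat m l"
  shows "mat_adj (A * B) = mat_adj B * mat_adj A"
  using assms by (intro eq_matI) (auto simp: mat_adj_def scalar_prod_def mult.commute)

lemma mat_trace_adj: "A \<in> carrier_mat n n \<Longrightarrow> mat_trace (mat_adj A) = cnj (mat_trace A)"
  by (auto simp: mat_trace_def mat_adj_def)

text \<open>Averaging the standard Hermitian form over \<open>G\<close> gives an invertible \<open>P\<close> with
  \<open>\<rho>(h)\<^sup>* P \<rho>(h) = P\<close>, so that \<open>\<rho>(h\<^sup>-\<^sup>1)\<close> is similar to \<open>\<rho>(h)\<^sup>*\<close>.\<close>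

lemma mat_trace_representation_inv:
  fixes G (structure)
  assumes G: "group G" and fin: "finite (carrier G)" and \<rho>: "representation G n \<rho>" and h: "h \<in> carrier G"
  shows "mat_trace (\<rho> (inv\<^bsub>G\<^esub> h)) = cnj (mat_trace (\<rho> h))"
proof -
  interpret group G by fact
  note r = representationD(1)[OF G \<rho>]
  define P where "P = mat_sum n n (\<lambda>g. mat_adj (\<rho> g) * \<rho> g) (carrier G)"
  have P: "P \<in> carrier_mat n n" by (simp add: P_def)
  have c: "mat_adj (\<rho> g) * \<rho> g \<in> carrier_mat n n" if "g \<in> carrier G" for g
    using mult_carrier_mat[OF mat_adj_carrier[OF r[OF that]] r[OF that]] .
  \<comment> \<open>The invariance of the form, multiplied on the right by
    \<open>\<rho> (inv h)\<close>; it comes from shifting the summation variable to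
    \<open>g \<otimes> h\<close>.\<close>
  have PP: "P * \<rho> (inv h) = mat_adj (\<rho> h) * P"
  proof -
    have "P * \<rho> (inv h) = mat_sum n n (\<lambda>g. mat_adj (\<rho> g) * \<rho> g * \<rho> (inv h)) (carrier G)"
      unfolding P_def using r[of "inv h"] h c by (intro mat_sum_mult) auto
    also have "\<dots> = mat_sum n n (\<lambda>g. mat_adj (\<rho> (g \<otimes> h)) * \<rho> (g \<otimes> h) * \<rho> (inv h)) (carrier G)"
      by (rule mat_sum_reindex[OF bij_betw_mult_right[OF G h]])
    also have "\<dots> = mat_sum n n (\<lambda>g. mat_adj (\<rho> h) * (mat_adj (\<rho> g) * \<rho> g)) (carrier G)"
    proof (rule mat_sum_cong)
      fix g assume g: "g \<in> carrier G"
      have rr: "\<rho> g \<in> carrier_mat n n" "\<rho> h \<in> carrier_mat n n" "\<rho> (inv h) \<in> carrier_mat n n"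
        "mat_adj (\<rho> g) \<in> carrier_mat n n" "mat_adj (\<rho> h) \<in> carrier_mat n n"
        using r g h by auto
      have "\<rho> (g \<otimes> h) * \<rho> (inv h) = \<rho> (g \<otimes> h \<otimes> inv h)" using g h by (simp add: representationD(3)[OF G \<rho>, of _ "inv h"])
      also have "g \<otimes> h \<otimes> inv h = g" using g h by (simp add: m_assoc)
      finally have s: "\<rho> (g \<otimes> h) * \<rho> (inv h) = \<rho> g" .
      have "mat_adj (\<rho> (g \<otimes> h)) * \<rho> (g \<otimes> h) * \<rho> (inv h) = mat_adj (\<rho> (g \<otimes> h)) * (\<rho> (g \<otimes> h) * \<rho> (inv h))"
        using r[of "g \<otimes> h"] rr g h by (intro assoc_mult_mat[of _ n n _ n _ n]) auto
      also have "\<dots> = mat_adj (\<rho> h) * mat_adj (\<rho> g) * \<rho> g"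
        using rr g h by (simp only: s) (simp add: representationD(3)[OF G \<rho>] mat_adj_mult[of _ n n _ n])
      also have "\<dots> = mat_adj (\<rho> h) * (mat_adj (\<rho> g) * \<rho> g)"
        using rr by (intro assoc_mult_mat[of _ n n _ n _ n]) auto
      finally show "mat_adj (\<rho> (g \<otimes> h)) * \<rho> (g \<otimes> h) * \<rho> (inv h) = mat_adj (\<rho> h) * (mat_adj (\<rho> g) * \<rho> g)" .
    qed
    also have "\<dots> = mat_adj (\<rho> h) * P" unfolding P_def using r[OF h] c by (intro mult_mat_sum[symmetric]) auto
    finally show ?thesis .
  qed
  \<comment> \<open>\<open>P\<close> is positive definite: its form at \<open>v\<close> is the sum
    over \<open>g\<close> of the squared norms of \<open>\<rho> g *\<^sub>v v\<close>, and the
    summand at the identity is the squared norm of \<open>v\<close> itself.\<close>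
  have "det P \<noteq> 0"
  proof
    assume "det P = 0"
    then obtain v where v: "v \<in> carrier_vec n" "v \<noteq> 0\<^sub>v n" "P *\<^sub>v v = 0\<^sub>v n"
      using det_0_iff_vec_prod_zero[OF P] by auto
    have sq: "(\<Sum>i<n. cnj (v $ i) * ((mat_adj (\<rho> g) * \<rho> g) *\<^sub>v v) $ i) = of_real (\<Sum>k<n. (cmod ((\<rho> g *\<^sub>v v) $ k))\<^sup>2)"
      if g: "g \<in> carrier G" for g
    proof -
      have rg: "\<rho> g \<in> carrier_mat n n" using r g by auto
      have "(mat_adj (\<rho> g) * \<rho> g) *\<^sub>v v = mat_adj (\<rho> g) *\<^sub>v (\<rho> g *\<^sub>v v)"
        using rg v by (intro assoc_mult_mat_vec[of _ n n _ n]) auto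
      then have "(\<Sum>i<n. cnj (v $ i) * ((mat_adj (\<rho> g) * \<rho> g) *\<^sub>v v) $ i)
          = (\<Sum>i<n. \<Sum>k<n. cnj (v $ i) * (cnj (\<rho> g $$ (k,i)) * (\<rho> g *\<^sub>v v) $ k))"
        using rg by (simp add: mat_adj_def scalar_prod_def atLeast0LessThan sum_distrib_left del: index_mult_mat_vec)
          (simp add: mult_mat_vec_def scalar_prod_def atLeast0LessThan sum_distrib_left mat_adj_def)
      also have "\<dots> = (\<Sum>k<n. cnj (\<Sum>i<n. \<rho> g $$ (k,i) * v $ i) * (\<rho> g *\<^sub>v v) $ k)"
        by (subst sum.swap) (simp add: sum_distrib_left mult_ac)
      also have "\<dots> = (\<Sum>k<n. of_real ((cmod ((\<rho> g *\<^sub>v v) $ k))\<^sup>2))"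
      proof (intro sum.cong refl)
        fix k assume k: "k \<in> {..<n}"
        have "(\<Sum>i<n. \<rho> g $$ (k,i) * v $ i) = (\<rho> g *\<^sub>v v) $ k"
          using k rg v by (simp add: scalar_prod_def atLeast0LessThan)
        then show "cnj (\<Sum>i<n. \<rho> g $$ (k,i) * v $ i) * (\<rho> g *\<^sub>v v) $ k = of_real ((cmod ((\<rho> g *\<^sub>v v) $ k))\<^sup>2)"
          by (simp only: complex_norm_square) (simp add: mult.commute)
      qed
      finally show ?thesis by simp
    qed
    have "(\<Sum>i<n. cnj (v $ i) * (P *\<^sub>v v) $ i) = (\<Sum>g\<in>carrier G. \<Sum>i<n. cnj (v $ i) * ((mat_adj (\<rho> g) * \<rho> g) *\<^sub>v v) $ i)"
    proof -
      have "(P *\<^sub>v v) $ i = (\<Sum>g\<in>carrier G. ((mat_adj (\<rho> g) * \<rho> g) *\<^sub>v v) $ i)" if i: "i < n" for i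
      proof -
        have "(P *\<^sub>v v) $ i = (\<Sum>j<n. \<Sum>g\<in>carrier G. (mat_adj (\<rho> g) * \<rho> g) $$ (i,j) * v $ j)"
          using i v(1) by (simp add: P_def mat_sum_def scalar_prod_def atLeast0LessThan sum_distrib_right del: index_mult_mat)
        also have "\<dots> = (\<Sum>g\<in>carrier G. \<Sum>j<n. (mat_adj (\<rho> g) * \<rho> g) $$ (i,j) * v $ j)" by (rule sum.swap)
        also have "\<dots> = (\<Sum>g\<in>carrier G. ((mat_adj (\<rho> g) * \<rho> g) *\<^sub>v v) $ i)"
        proof (intro sum.cong refl)
          fix g assume "g \<in> carrier G"
          then show "(\<Sum>j<n. (mat_adj (\<rho> g) * \<rho> g) $$ (i,j) * v $ j) = ((mat_adj (\<rho> g) * \<rho> g) *\<^sub>v v) $ i"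
            using mult_vec_index[OF c] i v(1) by simp
        qed
        finally show ?thesis .
      qed
      then show ?thesis by (simp add: sum_distrib_left sum.swap[of _ "carrier G"])
    qed
    also have "\<dots> = of_real (\<Sum>g\<in>carrier G. \<Sum>k<n. (cmod ((\<rho> g *\<^sub>v v) $ k))\<^sup>2)"
      by (simp add: sq)
    finally have "(\<Sum>g\<in>carrier G. \<Sum>k<n. (cmod ((\<rho> g *\<^sub>v v) $ k))\<^sup>2) = 0"
      using v by (metis (no_types, lifting) index_zero_vec(1) lessThan_iff mult_zero_right of_real_eq_0_iff sum.neutral)
    then have "(\<Sum>k<n. (cmod ((\<rho> \<one> *\<^sub>v v) $ k))\<^sup>2) = 0"
      using fin by (subst (asm) sum_nonneg_eq_0_iff) (auto intro!: sum_nonneg)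
    then have "\<forall>k<n. v $ k = 0"
      using v by (subst (asm) sum_nonneg_eq_0_iff) (auto simp: representationD(2)[OF G \<rho>])
    then have "v = 0\<^sub>v n" using v by (intro eq_vecI) auto
    then show False using v by simp
  qed
  then have "P \<in> Units (ring_mat TYPE(complex) n ())" using det_non_zero_imp_unit[OF P, where b = "()"] by blast
  then obtain Q where Q: "Q \<in> carrier_mat n n" "Q * P = 1\<^sub>m n" "P * Q = 1\<^sub>m n"
    by (auto simp: Units_def ring_mat_simps)
  have rh: "\<rho> h \<in> carrier_mat n n" "\<rho> (inv h) \<in> carrier_mat n n" "mat_adj (\<rho> h) \<in> carrier_mat n n" using r h by auto
  have "\<rho> (inv h) = Q * P * \<rho> (inv h)" using Q rh by simp
  also have "\<dots> = Q * (mat_adj (\<rho> h) * P)"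
    unfolding PP[symmetric] using Q P rh by (intro assoc_mult_mat[of _ n n _ n _ n])
  finally have "mat_trace (\<rho> (inv h)) = mat_trace (Q * (mat_adj (\<rho> h) * P))" by simp
  also have "\<dots> = mat_trace ((mat_adj (\<rho> h) * P) * Q)"
    by (rule mat_trace_mult_comm[OF Q(1) mult_carrier_mat[OF rh(3) P]])
  also have "\<dots> = mat_trace (mat_adj (\<rho> h))"
    by (simp add: assoc_mult_mat[OF rh(3) P Q(1)] Q(3) right_mult_one_mat[OF rh(3)])
  also have "\<dots> = cnj (mat_trace (\<rho> h))" using rh by (rule_tac mat_trace_adj)
  finally show ?thesis .
qed

subsection \<open>Orthogonality and class sums\<close>

text \<open>An elementary matrix placed between two factors splits an entry of the product into one
  coefficient of each. After averaging over the group, sums of products of coefficients become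
  entries of intertwiners.\<close>

lemma mat_mult_elementary_index:
  fixes A B :: "complex mat"
  assumes "A \<in> carrier_mat n n" "B \<in> carrier_mat m m" "i < n" "k < m" "a < n" "b < m"
  shows "(A * mat n m (\<lambda>(c,d). if c = i \<and> d = k then 1 else 0) * B) $$ (a,b) = A $$ (a,i) * B $$ (k,b)"
proof -
  let ?E = "mat n m (\<lambda>(c,d). if c = i \<and> d = k then 1 else 0) :: complex mat"
  have AE: "(A * ?E) $$ (a,d) = (if d = k then A $$ (a,i) else 0)" if "d < m" for d
  proof -
    have "(A * ?E) $$ (a,d) = (\<Sum>c<n. A $$ (a,c) * (if c = i \<and> d = k then 1 else 0))"
      using assms that by (simp add: scalar_prod_def atLeast0LessThan)
    also have "\<dots> = (\<Sum>c<n. if c = i then (if d = k then A $$ (a,c) else 0) else 0)"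
      by (intro sum.cong) auto
    also have "\<dots> = (if d = k then A $$ (a,i) else 0)" using assms by simp
    finally show ?thesis .
  qed
  have "(A * ?E * B) $$ (a,b) = (\<Sum>d<m. (A * ?E) $$ (a,d) * B $$ (d,b))"
    using assms by (simp add: scalar_prod_def atLeast0LessThan)
  also have "\<dots> = (\<Sum>d<m. if d = k then A $$ (a,i) * B $$ (d,b) else 0)"
    by (intro sum.cong) (auto simp: AE)
  also have "\<dots> = A $$ (a,i) * B $$ (k,b)" using assms by simp
  finally show ?thesis .
qed

text \<open>With \<open>\<sigma> (inv g)\<close> in place of the conjugate, expanding both traces
  turns the inner product, up to \<open>1 / card (carrier G)\<close>, into the sum over all
  \<open>(i, k)\<close> of the \<open>(i, k)\<close> entry of the averaged elementary matrix at
  \<open>(i, k)\<close>. Each average is an intertwiner, and Schur's lemma evaluates it.\<close>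

lemma irreducible_character_orthogonality:
  fixes G (structure)
  assumes G: "group G" and fin: "finite (carrier G)"
    and irr: "irreducible_representation G n \<rho>" and irr': "irreducible_representation G m \<sigma>"
  shows "char_inner (carrier G) (character_of G \<rho>) (character_of G \<sigma>)
    = (if character_of G \<rho> = character_of G \<sigma> then 1 else 0)"
proof -
  interpret group G by fact
  have card: "card (carrier G) \<noteq> 0" using fin by (auto simp: card_eq_0_iff)
  have expand: "(\<Sum>g\<in>carrier G. character_of G \<rho> g * cnj (character_of G \<sigma> g)) =
      (\<Sum>i<n. \<Sum>k<m. mat_sum n m
        (\<lambda>g. \<rho> g * mat n m (\<lambda>(c,d). if c = i \<and> d = k then 1 else 0) * \<sigma> (inv g)) (carrier G) $$ (i,k))"
    if irr: "irreducible_representation G n \<rho>" and irr': "irreducible_representation G m \<sigma>" for n m \<rho> \<sigma>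
  proof -
    note \<rho> = irreducible_representationD(1)[OF irr] and \<sigma> = irreducible_representationD(1)[OF irr']
    have "(\<Sum>g\<in>carrier G. character_of G \<rho> g * cnj (character_of G \<sigma> g))
        = (\<Sum>g\<in>carrier G. \<Sum>i<n. \<Sum>k<m. \<rho> g $$ (i,i) * \<sigma> (inv g) $$ (k,k))"
    proof (intro sum.cong refl)
      fix g assume g: "g \<in> carrier G"
      then have ig: "inv g \<in> carrier G" by simp
      have "cnj (character_of G \<sigma> g) = mat_trace (\<sigma> (inv g))"
        using mat_trace_representation_inv[OF G fin \<sigma> g] g by (simp add: character_of_def)
      then show "character_of G \<rho> g * cnj (character_of G \<sigma> g) = (\<Sum>i<n. \<Sum>k<m. \<rho> g $$ (i,i) * \<sigma> (inv g) $$ (k,k))"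
        using g representationD(1)[OF G \<rho> g] representationD(1)[OF G \<sigma> ig]
        by (simp add: character_of_def mat_trace_def sum_product)
    qed
    also have "\<dots> = (\<Sum>i<n. \<Sum>k<m. \<Sum>g\<in>carrier G. \<rho> g $$ (i,i) * \<sigma> (inv g) $$ (k,k))"
      by (subst sum.swap, intro sum.cong refl, subst sum.swap) simp
    also have "\<dots> = (\<Sum>i<n. \<Sum>k<m. mat_sum n m
        (\<lambda>g. \<rho> g * mat n m (\<lambda>(c,d). if c = i \<and> d = k then 1 else 0) * \<sigma> (inv g)) (carrier G) $$ (i,k))"
    proof (intro sum.cong refl)
      fix i k assume ik: "i \<in> {..<n}" "k \<in> {..<m}"
      show "(\<Sum>g\<in>carrier G. \<rho> g $$ (i,i) * \<sigma> (inv g) $$ (k,k)) = mat_sum n m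
        (\<lambda>g. \<rho> g * mat n m (\<lambda>(c,d). if c = i \<and> d = k then 1 else 0) * \<sigma> (inv g)) (carrier G) $$ (i,k)"
        using ik by (subst mat_sum_index)
          (auto intro!: sum.cong simp: mat_mult_elementary_index[OF representationD(1)[OF G \<rho>] representationD(1)[OF G \<sigma>]])
    qed
    finally show ?thesis .
  qed
  show ?thesis
  proof (cases "character_of G \<rho> = character_of G \<sigma>")
    case False
    have "mat_sum n m (\<lambda>g. \<rho> g * mat n m (\<lambda>(c,d). if c = i \<and> d = k then 1 else 0) * \<sigma> (inv g)) (carrier G) = 0\<^sub>m n m" for i k
    proof (rule ccontr)
      assume nz: "mat_sum n m (\<lambda>g. \<rho> g * mat n m (\<lambda>(c,d). if c = i \<and> d = k then 1 else 0) * \<sigma> (inv g)) (carrier G) \<noteq> 0\<^sub>m n m"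
      have "character_of G \<rho> = character_of G \<sigma>"
        by (rule schur_iso[OF G irr irr' mat_sum_carrier _ nz],
            rule intertwiner_average[OF G irreducible_representationD(1)[OF irr] irreducible_representationD(1)[OF irr']]) auto
      then show False using False by simp
    qed
    then have "(\<Sum>g\<in>carrier G. character_of G \<rho> g * cnj (character_of G \<sigma> g)) = 0"
      using expand[OF irr irr'] by simp
    then show ?thesis using False by (simp add: char_inner_def)
  next
    case True
    note \<rho> = irreducible_representationD(1)[OF irr] and n = irreducible_representationD(2)[OF irr]
    \<comment> \<open>The average is a scalar \<open>c\<close>. Comparing traces gives
      \<open>c n = card (carrier G)\<close> for \<open>i = k\<close> and \<open>c = 0\<close>
      otherwise; the \<open>n\<close> diagonal pairs then add up to the group order.\<close>
    have diag: "mat_sum n n (\<lambda>g. \<rho> g * mat n n (\<lambda>(c,d). if c = i \<and> d = k then 1 else 0) * \<rho> (inv g)) (carrier G) $$ (i,k)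
       = (if i = k then of_nat (card (carrier G)) / of_nat n else 0)" if ik: "i < n" "k < n" for i k
    proof -
      let ?E = "mat n n (\<lambda>(c,d). if c = i \<and> d = k then 1 else 0) :: complex mat"
      let ?A = "mat_sum n n (\<lambda>g. \<rho> g * ?E * \<rho> (inv g)) (carrier G)"
      have E: "?E \<in> carrier_mat n n" by simp
      obtain c where c: "?A = c \<cdot>\<^sub>m 1\<^sub>m n"
        using schur_scalar[OF G irr mat_sum_carrier intertwiner_average[OF G \<rho> \<rho> E _ refl]] by blast
      have "c * of_nat n = mat_trace ?A" by (simp add: c mat_trace_smult[of _ n] mat_trace_one)
      also have "\<dots> = (\<Sum>g\<in>carrier G. mat_trace (\<rho> g * ?E * \<rho> (inv g)))"
        by (rule mat_trace_mat_sum, rule mult_carrier_mat[of _ _ n], rule mult_carrier_mat[of _ _ n])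
          (auto intro: representationD(1)[OF G \<rho>])
      also have "\<dots> = (\<Sum>g\<in>carrier G. if i = k then 1 else 0)"
      proof (intro sum.cong refl)
        fix g assume g: "g \<in> carrier G"
        then have r: "\<rho> g \<in> carrier_mat n n" "\<rho> (inv g) \<in> carrier_mat n n" by (auto intro: representationD(1)[OF G \<rho>])
        have "mat_trace (\<rho> g * ?E * \<rho> (inv g)) = mat_trace (\<rho> (inv g) * (\<rho> g * ?E))"
          using r E by (intro mat_trace_mult_comm[of _ n n]) auto
        also have "\<rho> (inv g) * (\<rho> g * ?E) = ?E"
          using r E representationD(4)[OF G \<rho> g] by (simp flip: assoc_mult_mat[of _ n n _ n _ n])
        also have "mat_trace ?E = (\<Sum>a<n. if a = i then (if i = k then 1 else 0) else 0)"
          unfolding mat_trace_def by (auto intro!: sum.cong)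
        also have "\<dots> = (if i = k then 1 else 0)" using ik by simp
        finally show "mat_trace (\<rho> g * ?E * \<rho> (inv g)) = (if i = k then 1 else 0)" .
      qed
      finally have "c = (if i = k then of_nat (card (carrier G)) / of_nat n else 0)"
        using n by (auto simp: field_simps)
      then show ?thesis using ik unfolding c by simp
    qed
    have "(\<Sum>g\<in>carrier G. character_of G \<rho> g * cnj (character_of G \<rho> g)) =
       (\<Sum>i<n. \<Sum>k<n. if i = k then of_nat (card (carrier G)) / of_nat n else 0)"
      unfolding expand[OF irr irr] by (intro sum.cong refl) (simp add: diag)
    also have "\<dots> = of_nat (card (carrier G))" using n by simp
    finally show ?thesis using True card by (simp add: char_inner_def)
  qed
qed

text \<open>Reindexing by conjugation with \<open>h\<close> shows that the sum commutes with
  \<open>\<rho> h\<close>, because the weights are constant on classes.\<close>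

lemma class_sum_scalar:
  fixes G (structure)
  assumes G: "group G" and irr: "irreducible_representation G n \<rho>"
    and f: "\<And>x g. x \<in> carrier G \<Longrightarrow> g \<in> carrier G \<Longrightarrow> f (x \<otimes> g \<otimes> inv x) = f g"
  obtains c where "mat_sum n n (\<lambda>g. f g \<cdot>\<^sub>m \<rho> g) (carrier G) = c \<cdot>\<^sub>m 1\<^sub>m n"
proof -
  interpret group G by fact
  note \<rho> = irreducible_representationD(1)[OF irr]
  note r = representationD(1)[OF G \<rho>]
  let ?B = "mat_sum n n (\<lambda>g. f g \<cdot>\<^sub>m \<rho> g) (carrier G)"
  have "\<rho> h * ?B = ?B * \<rho> h" if h: "h \<in> carrier G" for h
  proof -
    have bij: "bij_betw (\<lambda>g. h \<otimes> g \<otimes> inv h) (carrier G) (carrier G)"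
      by (rule bij_betw_conj[OF G h])
    have "?B * \<rho> h = mat_sum n n (\<lambda>g. (f g \<cdot>\<^sub>m \<rho> g) * \<rho> h) (carrier G)"
      using r h by (intro mat_sum_mult) auto
    also have "\<dots> = mat_sum n n (\<lambda>g. (f (h \<otimes> g \<otimes> inv h) \<cdot>\<^sub>m \<rho> (h \<otimes> g \<otimes> inv h)) * \<rho> h) (carrier G)"
      by (rule mat_sum_reindex[OF bij])
    also have "\<dots> = mat_sum n n (\<lambda>g. \<rho> h * (f g \<cdot>\<^sub>m \<rho> g)) (carrier G)"
    proof (rule mat_sum_cong)
      fix g assume g: "g \<in> carrier G"
      have rr: "\<rho> g \<in> carrier_mat n n" "\<rho> h \<in> carrier_mat n n" "\<rho> (h \<otimes> g \<otimes> inv h) \<in> carrier_mat n n" using r g h by auto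
      have "(f (h \<otimes> g \<otimes> inv h) \<cdot>\<^sub>m \<rho> (h \<otimes> g \<otimes> inv h)) * \<rho> h = f g \<cdot>\<^sub>m (\<rho> (h \<otimes> g \<otimes> inv h) * \<rho> h)"
        using rr f[OF h g] by (simp add: mult_smult_assoc_mat[of _ n n _ n])
      also have "\<rho> (h \<otimes> g \<otimes> inv h) * \<rho> h = \<rho> (h \<otimes> g \<otimes> inv h \<otimes> h)" using g h by (simp add: representationD(3)[OF G \<rho>, of _ h])
      also have "h \<otimes> g \<otimes> inv h \<otimes> h = h \<otimes> g" using g h by (simp add: m_assoc)
      also have "\<rho> (h \<otimes> g) = \<rho> h * \<rho> g" using g h by (simp add: representationD(3)[OF G \<rho>])
      also have "f g \<cdot>\<^sub>m (\<rho> h * \<rho> g) = \<rho> h * (f g \<cdot>\<^sub>m \<rho> g)" using rr by (simp add: mult_smult_distrib[of _ n n _ n])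
      finally show "(f (h \<otimes> g \<otimes> inv h) \<cdot>\<^sub>m \<rho> (h \<otimes> g \<otimes> inv h)) * \<rho> h = \<rho> h * (f g \<cdot>\<^sub>m \<rho> g)" .
    qed
    also have "\<dots> = \<rho> h * ?B" using r h by (intro mult_mat_sum[symmetric]) auto
    finally show ?thesis by simp
  qed
  then show ?thesis using schur_scalar[OF G irr mat_sum_carrier] that by blast
qed

lemma Irr_cases:
  assumes "\<chi> \<in> Irr G"
  obtains n \<rho> where "irreducible_representation G n \<rho>" "\<chi> = character_of G \<rho>"
  using assms unfolding Irr_def by blast

lemma Irr_orthonormal:
  assumes "group G" "finite (carrier G)" "\<chi> \<in> Irr G" "\<xi> \<in> Irr G"
  shows "char_inner (carrier G) \<chi> \<xi> = (if \<chi> = \<xi> then 1 else 0)"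
  using irreducible_character_orthogonality[OF assms(1,2)] assms(3,4) by (metis Irr_cases)

lemma Irr_degree:
  assumes "group G" "\<chi> \<in> Irr G"
  obtains n where "n \<noteq> 0" "\<chi> \<one>\<^bsub>G\<^esub> = of_nat n"
proof -
  interpret group G by fact
  obtain n \<rho> where \<rho>: "irreducible_representation G n \<rho>" "\<chi> = character_of G \<rho>" using Irr_cases[OF assms(2)] .
  have "\<chi> \<one>\<^bsub>G\<^esub> = of_nat n"
    using representationD(2)[OF assms(1) irreducible_representationD(1)[OF \<rho>(1)]]
    by (simp add: \<rho>(2) character_of_def mat_trace_one)
  then show ?thesis using that irreducible_representationD(2)[OF \<rho>(1)] by blast
qed

lemma Irr_outside: "\<chi> \<in> Irr G \<Longrightarrow> g \<notin> carrier G \<Longrightarrow> \<chi> g = 0"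
  by (auto simp: Irr_def character_of_def)

lemma character_of_class_function:
  fixes G (structure)
  assumes G: "group G" and \<rho>: "representation G n \<rho>" and x: "x \<in> carrier G" and g: "g \<in> carrier G"
  shows "character_of G \<rho> (x \<otimes> g \<otimes> inv x) = character_of G \<rho> g"
proof -
  interpret group G by fact
  have r: "\<rho> g \<in> carrier_mat n n" "\<rho> x \<in> carrier_mat n n" "\<rho> (inv x) \<in> carrier_mat n n"
    using x g by (auto intro: representationD(1)[OF G \<rho>])
  have "mat_trace (\<rho> (x \<otimes> g \<otimes> inv x)) = mat_trace ((\<rho> x * \<rho> g) * \<rho> (inv x))"
    using x g by (simp add: representationD(3)[OF G \<rho>])
  also have "\<dots> = mat_trace (\<rho> (inv x) * (\<rho> x * \<rho> g))" using r by (intro mat_trace_mult_comm[of _ n n]) auto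
  also have "\<dots> = mat_trace (\<rho> g)"
    using r representationD(4)[OF G \<rho> x] by (simp flip: assoc_mult_mat[of _ n n _ n _ n])
  finally show ?thesis using x g by (simp add: character_of_def)
qed

lemma Irr_class_function:
  fixes G (structure)
  assumes "group G" "\<chi> \<in> Irr G" "x \<in> carrier G" "g \<in> carrier G"
  shows "\<chi> (x \<otimes> g \<otimes> inv x) = \<chi> g"
  using assms character_of_class_function irreducible_representationD(1) by (metis Irr_cases)

text \<open>The class sum weighted by \<open>f\<close> acts as a scalar \<open>c\<close>.
  Multiplying it by \<open>\<rho> h\<close> and taking traces gives \<open>c * \<chi> h\<close> on
  one side; the case \<open>h = \<one>\<close> determines \<open>c * \<chi> \<one>\<close>, and
  eliminating \<open>c\<close> gives the product form. It is used with the conjugate of an invariant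
  character and with the indicator of a normal subgroup as \<open>f\<close>.\<close>

lemma Irr_convolution:
  fixes G (structure)
  assumes G: "group G" and \<chi>: "\<chi> \<in> Irr G" and h: "h \<in> carrier G"
    and f: "\<And>x g. x \<in> carrier G \<Longrightarrow> g \<in> carrier G \<Longrightarrow> f (x \<otimes> g \<otimes> inv x) = f g"
  shows "(\<Sum>g\<in>carrier G. f g * \<chi> (g \<otimes> h)) * \<chi> \<one> = (\<Sum>g\<in>carrier G. f g * \<chi> g) * \<chi> h"
proof -
  interpret group G by fact
  obtain n \<rho> where irr: "irreducible_representation G n \<rho>" and \<chi>_eq: "\<chi> = character_of G \<rho>" using Irr_cases[OF \<chi>] .
  note \<rho> = irreducible_representationD(1)[OF irr]
  note r = representationD(1)[OF G \<rho>]
  obtain c where c: "mat_sum n n (\<lambda>g. f g \<cdot>\<^sub>m \<rho> g) (carrier G) = c \<cdot>\<^sub>m 1\<^sub>m n"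
    using class_sum_scalar[OF G irr f] by blast
  have *: "(\<Sum>g\<in>carrier G. f g * \<chi> (g \<otimes> k)) = c * \<chi> k" if k: "k \<in> carrier G" for k
  proof -
    have "c * \<chi> k = mat_trace ((c \<cdot>\<^sub>m 1\<^sub>m n) * \<rho> k)"
      using r[OF k] k by (simp add: \<chi>_eq character_of_def mult_smult_assoc_mat[of _ n n _ n] mat_trace_smult[of _ n])
    also have "\<dots> = mat_trace (mat_sum n n (\<lambda>g. (f g \<cdot>\<^sub>m \<rho> g) * \<rho> k) (carrier G))"
      unfolding c[symmetric] using r k by (subst mat_sum_mult) auto
    also have "\<dots> = (\<Sum>g\<in>carrier G. mat_trace ((f g \<cdot>\<^sub>m \<rho> g) * \<rho> k))"
      using k by (intro mat_trace_mat_sum mult_carrier_mat[of _ _ n] smult_carrier_mat r)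
    also have "\<dots> = (\<Sum>g\<in>carrier G. f g * \<chi> (g \<otimes> k))"
    proof (intro sum.cong refl)
      fix g assume g: "g \<in> carrier G"
      have "mat_trace ((f g \<cdot>\<^sub>m \<rho> g) * \<rho> k) = f g * mat_trace (\<rho> g * \<rho> k)"
        using r[OF g] r[OF k] by (simp add: mult_smult_assoc_mat[of _ n n _ n] mat_trace_smult[of _ n])
      then show "mat_trace ((f g \<cdot>\<^sub>m \<rho> g) * \<rho> k) = f g * \<chi> (g \<otimes> k)"
        using g k by (simp add: \<chi>_eq character_of_def representationD(3)[OF G \<rho>])
    qed
    finally show ?thesis by simp
  qed
  have "(\<Sum>g\<in>carrier G. f g * \<chi> g) = c * \<chi> \<one>" using *[of \<one>] by simp
  then show ?thesis using *[OF h] by simp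
qed

subsection \<open>Decomposition into irreducible characters\<close>

text \<open>The columns of \<open>P\<close> are a maximal independent subset of \<open>W\<close>, of
  size \<open>k\<close>, followed by its completion to a basis of the whole space; \<open>Q\<close>
  reads off coordinates. The bounds \<open>0 < k < n\<close> express that \<open>W\<close> is
  neither zero nor everything.\<close>

lemma adapted_basis:
  assumes sub: "VectorSpace.subspace class_ring W (module_vec TYPE(complex) n)"
    and W: "W \<noteq> {0\<^sub>v n}" "W \<noteq> carrier_vec n"
  obtains k P Q where "0 < k" "k < n" "P \<in> carrier_mat n n" "Q \<in> carrier_mat n n" "P * Q = 1\<^sub>m n" "Q * P = 1\<^sub>m n"
    "\<And>j. j < k \<Longrightarrow> col P j \<in> W" "\<And>w i. w \<in> W \<Longrightarrow> k \<le> i \<Longrightarrow> i < n \<Longrightarrow> (Q *\<^sub>v w) $ i = 0"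
proof -
  interpret vec_space "TYPE(complex)" n .
  have WC: "W \<subseteq> carrier_vec n" using sub by (simp add: subspace_module_vec_iff)
  obtain U where U: "finite U" "maximal U (\<lambda>S. S \<subseteq> W \<and> lin_indpt S)"
    using maximal_exists[of "\<lambda>S. S \<subseteq> W \<and> lin_indpt S" n "{}"] li_le_dim[OF fin_dim] WC
    by (auto simp: dim_is_n finite_lin_indpt2) (meson dual_order.trans)
  then have UW: "U \<subseteq> W" and Uli: "lin_indpt U"
    and Umax: "\<And>S. U \<subseteq> S \<Longrightarrow> S \<subseteq> W \<Longrightarrow> lin_indpt S \<Longrightarrow> S = U" by (auto simp: maximal_def)
  have UC: "U \<subseteq> carrier_vec n" using UW WC by blast
  have WU: "W \<subseteq> span U"
  proof
    fix w assume w: "w \<in> W"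
    show "w \<in> span U"
    proof (rule ccontr)
      assume nw: "w \<notin> span U"
      then have wU: "w \<notin> U" using in_own_span[OF UC] by blast
      then have "lin_indpt (U \<union> {w})" using lin_dep_iff_in_span[OF UC Uli _ wU] nw w WC by blast
      then have "U \<union> {w} = U" using Umax w UW by blast
      then show False using wU by blast
    qed
  qed
  have "span U \<subseteq> W" using sub UW by (intro span_is_subset) (auto simp: VectorSpace.subspace_def)
  then have WU: "W = span U" using WU by blast
  obtain B where B: "finite B" "maximal B (\<lambda>S. U \<subseteq> S \<and> S \<subseteq> carrier_vec n \<and> lin_indpt S)"
    using maximal_exists[of "\<lambda>S. U \<subseteq> S \<and> S \<subseteq> carrier_vec n \<and> lin_indpt S" n U] li_le_dim[OF fin_dim] UC Uli
    by (auto simp: dim_is_n)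
  then have UB: "U \<subseteq> B" and BC: "B \<subseteq> carrier_vec n" and Bli: "lin_indpt B" by (auto simp: maximal_def)
  have "maximal B (\<lambda>S. S \<subseteq> carrier_vec n \<and> lin_indpt S)"
    using B(2) unfolding maximal_def by blast
  then have basisB: "basis B" using max_li_is_basis by simp
  then have cardB: "card B = n" using dim_basis[OF B(1)] by (simp add: dim_is_n)
  obtain us where us: "set us = U" "distinct us" using U(1) finite_distinct_list by blast
  obtain cs where cs: "set cs = B - U" "distinct cs" using B(1) finite_distinct_list[of "B - U"] by blast
  define bs where "bs = us @ cs"
  define k where "k = length us"
  have bs: "set bs = B" "distinct bs" "length bs = n"
    using us cs UB cardB distinct_card[of bs] by (auto simp: bs_def Un_absorb1)
  define P where "P = mat_of_cols n bs"
  have P: "P \<in> carrier_mat n n" using mat_of_cols_carrier(1)[of n bs] bs(3) by (simp add: P_def)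
  have colsP: "cols P = bs" unfolding P_def using bs BC by (intro cols_mat_of_cols) auto
  have "rank P = n" using lin_indpt_full_rank[OF P] colsP bs Bli by simp
  then have "det P \<noteq> 0" using det_rank_iff[OF P] by simp
  then have "P \<in> Units (ring_mat TYPE(complex) n ())" using det_non_zero_imp_unit[OF P, where b = "()"] by blast
  then obtain Q where Q: "Q \<in> carrier_mat n n" "Q * P = 1\<^sub>m n" "P * Q = 1\<^sub>m n"
    by (auto simp: Units_def ring_mat_simps)
  have colP: "col P j = bs ! j" if "j < n" for j
    using that colsP P by (metis carrier_matD(2) cols_nth)
  have kn: "k \<le> n" using bs by (simp add: k_def bs_def)
  have "k \<noteq> 0"
  proof
    assume "k = 0"
    then have "U = {}" using us by (simp add: k_def)
    then show False using WU W(1) span_empty by simp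
  qed
  moreover have "k \<noteq> n"
  proof
    assume "k = n"
    then have "cs = []" using bs by (simp add: k_def bs_def)
    then have "U = B" using cs UB by auto
    then show False using WU W(2) basisB by (simp add: basis_def)
  qed
  moreover have "col P j \<in> W" if "j < k" for j
  proof -
    have "col P j = us ! j" using that kn colP[of j] by (simp add: bs_def k_def nth_append)
    then show ?thesis using that us UW nth_mem[of j us] by (auto simp: k_def)
  qed
  moreover have "(Q *\<^sub>v w) $ i = 0" if w: "w \<in> W" and i: "k \<le> i" "i < n" for w i
  proof -
    obtain a where a: "w = lincomb a U" using w unfolding WU finite_span[OF U(1) UC] by auto
    \<comment> \<open>The coefficients of \<open>w\<close> over \<open>U\<close>, extended by 0 to
      \<open>B\<close>. They are the coordinates \<open>Q\<close> computes, and positions from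
      \<open>k\<close> on belong to basis vectors outside \<open>U\<close>.\<close>
    define b where "b u = (if u \<in> U then a u else 0)" for u
    have "lincomb b B = w"
    proof (rule eq_vecI)
      show "dim_vec (lincomb b B) = dim_vec w"
        using lincomb_dim[OF B(1) BC] w WC by auto
      fix i assume "i < dim_vec w"
      then have i: "i < n" using w WC by auto
      have "lincomb b B $ i = (\<Sum>x\<in>B. b x * x $ i)" by (rule lincomb_index[OF i BC])
      also have "\<dots> = (\<Sum>x\<in>U. a x * x $ i)"
        using B(1) UB by (intro sum.mono_neutral_cong_right) (auto simp: b_def)
      also have "\<dots> = w $ i" unfolding a by (rule lincomb_index[OF i UC, symmetric])
      finally show "lincomb b B $ i = w $ i" .
    qed
    then have "w = P *\<^sub>v vec n (\<lambda>i. b (col P i))"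
      using mat_mult_eq_lincomb[OF P, of b] colsP bs by simp
    then have "Q *\<^sub>v w = (Q * P) *\<^sub>v vec n (\<lambda>i. b (col P i))"
      using assoc_mult_mat_vec[OF Q(1) P vec_carrier] by metis
    then have "(Q *\<^sub>v w) $ i = b (bs ! i)" using Q i colP by simp
    moreover have "bs ! i \<notin> U"
    proof -
      have "bs ! i = cs ! (i - k)" using i by (simp add: bs_def k_def nth_append)
      moreover have "i - k < length cs" using i bs by (simp add: bs_def k_def)
      ultimately show ?thesis using cs nth_mem[of "i - k" cs] by auto
    qed
    ultimately show ?thesis by (simp add: b_def)
  qed
  ultimately show ?thesis using that[of k P Q] P Q kn by simp
qed

text \<open>In a basis adapted to an invariant subspace all matrices are block upper triangular.
  Each diagonal block is multiplicative by itself and the trace is the sum of the two block traces;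
  the upper right block does not affect the character.\<close>

lemma reducible_representation_split:
  fixes G (structure)
  assumes G: "group G" and \<rho>: "representation G n \<rho>" and n: "n \<noteq> 0" and red: "\<not> irreducible_representation G n \<rho>"
  obtains m1 m2 \<rho>1 \<rho>2 where "m1 < n" "m2 < n" "representation G m1 \<rho>1" "representation G m2 \<rho>2"
    "\<And>g. character_of G \<rho> g = character_of G \<rho>1 g + character_of G \<rho>2 g"
proof -
  interpret group G by fact
  obtain W where W: "VectorSpace.subspace class_ring W (module_vec TYPE(complex) n)"
     "\<And>g w. g \<in> carrier G \<Longrightarrow> w \<in> W \<Longrightarrow> \<rho> g *\<^sub>v w \<in> W" "W \<noteq> {0\<^sub>v n}" "W \<noteq> carrier_vec n"
    using \<rho> n red unfolding irreducible_representation_def by blast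
  obtain k P Q where k: "0 < k" "k < n" and P: "P \<in> carrier_mat n n" and Q: "Q \<in> carrier_mat n n"
    and PQ: "P * Q = 1\<^sub>m n" "Q * P = 1\<^sub>m n"
    and colP: "\<And>j. j < k \<Longrightarrow> col P j \<in> W" and QW: "\<And>w i. w \<in> W \<Longrightarrow> k \<le> i \<Longrightarrow> i < n \<Longrightarrow> (Q *\<^sub>v w) $ i = 0"
    using adapted_basis[OF W(1,3,4)] by metis
  note r = representationD(1)[OF G \<rho>]
  define S where "S g = Q * \<rho> g * P" for g
  have S: "S g \<in> carrier_mat n n" if "g \<in> carrier G" for g
    unfolding S_def by (rule mult_carrier_mat[OF mult_carrier_mat[OF Q r[OF that]] P])
  have S_mult: "S (g \<otimes> h) = S g * S h" if g: "g \<in> carrier G" and h: "h \<in> carrier G" for g h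
  proof -
    have rr: "\<rho> g \<in> carrier_mat n n" "\<rho> h \<in> carrier_mat n n" using r g h by auto
    have "S g * S h = Q * \<rho> g * ((P * Q) * (\<rho> h * P))"
      unfolding S_def using P Q rr by (simp add: assoc_mult_mat[of _ n n _ n _ n] del: PQ)
    also have "\<dots> = Q * (\<rho> g * \<rho> h) * P"
      using P Q rr PQ by (simp add: assoc_mult_mat[of _ n n _ n _ n])
    finally show ?thesis using g h by (simp add: S_def representationD(3)[OF G \<rho>])
  qed
  have S_one: "S \<one> = 1\<^sub>m n" using P Q PQ by (simp add: S_def representationD(2)[OF G \<rho>])
  \<comment> \<open>The lower left block vanishes: the first \<open>k\<close> columns of
    \<open>P\<close> lie in \<open>W\<close>, which \<open>\<rho> g\<close> preserves, and
    \<open>Q\<close> gives vectors of \<open>W\<close> no coordinate beyond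
    \<open>k\<close>.\<close>
  have S_zero: "S g $$ (i,j) = 0" if g: "g \<in> carrier G" and ij: "k \<le> i" "i < n" "j < k" for g i j
  proof -
    have "S g $$ (i,j) = (Q *\<^sub>v (\<rho> g *\<^sub>v col P j)) $ i"
    proof -
      have "S g = Q * (\<rho> g * P)" unfolding S_def using P Q r[OF g] by (simp add: assoc_mult_mat[of _ n n _ n _ n])
      then have "S g $$ (i,j) = row Q i \<bullet> col (\<rho> g * P) j" using ij k P Q r[OF g] by simp
      also have "col (\<rho> g * P) j = \<rho> g *\<^sub>v col P j" using ij k P r[OF g] by (intro col_mult2[of _ n n _ n]) auto
      finally show ?thesis using ij Q by simp
    qed
    also have "\<dots> = 0" using QW[OF W(2)[OF g colP[OF ij(3)]] ij(1,2)] .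
    finally show ?thesis .
  qed
  define \<rho>1 where "\<rho>1 g = mat k k (\<lambda>(i,j). S g $$ (i,j))" for g
  define \<rho>2 where "\<rho>2 g = mat (n-k) (n-k) (\<lambda>(i,j). S g $$ (k+i,k+j))" for g
  have S_mult_index: "S (g \<otimes> h) $$ (i,j) = (\<Sum>l<k. S g $$ (i,l) * S h $$ (l,j)) + (\<Sum>l<n-k. S g $$ (i,k+l) * S h $$ (k+l,j))"
    if g: "g \<in> carrier G" and h: "h \<in> carrier G" and ij: "i < n" "j < n" for g h i j
  proof -
    have "S (g \<otimes> h) $$ (i,j) = (\<Sum>l<n. S g $$ (i,l) * S h $$ (l,j))"
      using S[OF g] S[OF h] ij by (simp add: S_mult[OF g h] scalar_prod_def atLeast0LessThan)
    also have "\<dots> = (\<Sum>l\<in>{0..<k}. S g $$ (i,l) * S h $$ (l,j)) + (\<Sum>l\<in>{k..<n}. S g $$ (i,l) * S h $$ (l,j))"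
      using k by (simp add: sum.atLeastLessThan_concat flip: atLeast0LessThan)
    also have "(\<Sum>l\<in>{k..<n}. S g $$ (i,l) * S h $$ (l,j)) = (\<Sum>l<n-k. S g $$ (i,k+l) * S h $$ (k+l,j))"
      using k by (intro sum.reindex_bij_witness[of _ "\<lambda>l. k + l" "\<lambda>l. l - k"]) auto
    finally show ?thesis by (simp add: atLeast0LessThan)
  qed
  have rep1: "representation G k \<rho>1"
    unfolding representation_iff[OF G]
  proof (intro conjI ballI)
    fix g assume "g \<in> carrier G" then show "\<rho>1 g \<in> carrier_mat k k" by (simp add: \<rho>1_def)
  next
    show "\<rho>1 \<one> = 1\<^sub>m k" using k by (intro eq_matI) (auto simp: \<rho>1_def S_one)
  next
    fix g h assume gh: "g \<in> carrier G" "h \<in> carrier G"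
    show "\<rho>1 (g \<otimes> h) = \<rho>1 g * \<rho>1 h"
    proof (rule eq_matI)
      fix i j assume "i < dim_row (\<rho>1 g * \<rho>1 h)" "j < dim_col (\<rho>1 g * \<rho>1 h)"
      then have ij: "i < k" "j < k" by (auto simp: \<rho>1_def)
      have "S (g \<otimes> h) $$ (i,j) = (\<Sum>l<k. S g $$ (i,l) * S h $$ (l,j))"
        using ij k S_mult_index[OF gh, of i j] S_zero[OF gh(2), of _ j] by simp
      then show "\<rho>1 (g \<otimes> h) $$ (i,j) = (\<rho>1 g * \<rho>1 h) $$ (i,j)"
        using ij by (simp add: \<rho>1_def scalar_prod_def atLeast0LessThan)
    qed (auto simp: \<rho>1_def)
  qed
  have rep2: "representation G (n - k) \<rho>2"
    unfolding representation_iff[OF G]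
  proof (intro conjI ballI)
    fix g assume "g \<in> carrier G" then show "\<rho>2 g \<in> carrier_mat (n-k) (n-k)" by (simp add: \<rho>2_def)
  next
    show "\<rho>2 \<one> = 1\<^sub>m (n-k)" using k by (intro eq_matI) (auto simp: \<rho>2_def S_one)
  next
    fix g h assume gh: "g \<in> carrier G" "h \<in> carrier G"
    show "\<rho>2 (g \<otimes> h) = \<rho>2 g * \<rho>2 h"
    proof (rule eq_matI)
      fix i j assume "i < dim_row (\<rho>2 g * \<rho>2 h)" "j < dim_col (\<rho>2 g * \<rho>2 h)"
      then have ij: "i < n - k" "j < n - k" by (auto simp: \<rho>2_def)
      have "S (g \<otimes> h) $$ (k+i,k+j) = (\<Sum>l<n-k. S g $$ (k+i,k+l) * S h $$ (k+l,k+j))"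
        using ij k S_mult_index[OF gh, of "k+i" "k+j"] S_zero[OF gh(1), of "k+i"] by simp
      then show "\<rho>2 (g \<otimes> h) $$ (i,j) = (\<rho>2 g * \<rho>2 h) $$ (i,j)"
        using ij by (simp add: \<rho>2_def scalar_prod_def atLeast0LessThan)
    qed (auto simp: \<rho>2_def)
  qed
  have "character_of G \<rho> g = character_of G \<rho>1 g + character_of G \<rho>2 g" for g
  proof (cases "g \<in> carrier G")
    case g: True
    have rg: "\<rho> g \<in> carrier_mat n n" by (rule r[OF g])
    have "mat_trace (S g) = mat_trace (P * (Q * \<rho> g))"
      unfolding S_def using P Q rg by (intro mat_trace_mult_comm[of _ n n]) auto
    also have "P * (Q * \<rho> g) = \<rho> g" using P Q rg PQ by (simp flip: assoc_mult_mat[of _ n n _ n _ n])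
    finally have "mat_trace (\<rho> g) = (\<Sum>i<n. S g $$ (i,i))"
      using S[OF g] by (simp add: mat_trace_def)
    also have "\<dots> = (\<Sum>i\<in>{0..<k}. S g $$ (i,i)) + (\<Sum>i\<in>{k..<n}. S g $$ (i,i))"
      using k by (simp add: sum.atLeastLessThan_concat flip: atLeast0LessThan)
    also have "(\<Sum>i\<in>{k..<n}. S g $$ (i,i)) = (\<Sum>i<n-k. S g $$ (k+i,k+i))"
      using k by (intro sum.reindex_bij_witness[of _ "\<lambda>l. k + l" "\<lambda>l. l - k"]) auto
    finally show ?thesis using g by (simp add: character_of_def mat_trace_def \<rho>1_def \<rho>2_def atLeast0LessThan)
  qed (simp add: character_of_def)
  then show ?thesis using that[of k "n-k" \<rho>1 \<rho>2] k rep1 rep2 by simp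
qed

text \<open>Induction on the degree. A list is used rather than a set because it records
  multiplicities; a representation of degree 0 corresponds to the empty list.\<close>

lemma character_of_decompose:
  fixes G (structure)
  assumes G: "group G" and \<rho>: "representation G n \<rho>"
  obtains xs where "set xs \<subseteq> Irr G" "\<And>g. character_of G \<rho> g = (\<Sum>\<chi>\<leftarrow>xs. \<chi> g)"
proof -
  have "\<exists>xs. set xs \<subseteq> Irr G \<and> (\<forall>g. character_of G \<rho> g = (\<Sum>\<chi>\<leftarrow>xs. \<chi> g))"
    using \<rho>
  proof (induction n arbitrary: \<rho> rule: less_induct)
    case (less n)
    consider "n = 0" | "irreducible_representation G n \<rho>" | "n \<noteq> 0" "\<not> irreducible_representation G n \<rho>" by blast
    then show ?case
    proof cases
      case 1
      then have "character_of G \<rho> g = 0" for g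
        using representationD(1)[OF G less.prems, of g] by (auto simp: character_of_def mat_trace_def)
      then show ?thesis by (intro exI[of _ "[]"]) simp
    next
      case 2
      then have "character_of G \<rho> \<in> Irr G" by (auto simp: Irr_def)
      then show ?thesis by (intro exI[of _ "[character_of G \<rho>]"]) simp
    next
      case 3
      obtain m1 m2 \<rho>1 \<rho>2 where m: "m1 < n" "m2 < n" "representation G m1 \<rho>1" "representation G m2 \<rho>2"
        and sum: "\<And>g. character_of G \<rho> g = character_of G \<rho>1 g + character_of G \<rho>2 g"
        using reducible_representation_split[OF G less.prems 3] by metis
      obtain xs ys where "set xs \<subseteq> Irr G" "\<forall>g. character_of G \<rho>1 g = (\<Sum>\<chi>\<leftarrow>xs. \<chi> g)"
        "set ys \<subseteq> Irr G" "\<forall>g. character_of G \<rho>2 g = (\<Sum>\<chi>\<leftarrow>ys. \<chi> g)"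
        using less.IH m by metis
      then show ?thesis using sum by (intro exI[of _ "xs @ ys"]) auto
    qed
  qed
  then show ?thesis using that by blast
qed

text \<open>Irreducibility passes to \<open>\<rho>\<close> when each of its invariant subspaces is
  also invariant under \<open>\<sigma>\<close>. The groups may differ; the uses are twists and
  conjugates of a representation.\<close>

lemma irreducible_representation_cong:
  assumes "group G" "group K" "representation G n \<rho>" "irreducible_representation K n \<sigma>"
    and "\<And>W h w. \<lbrakk>VectorSpace.subspace class_ring W (module_vec TYPE(complex) n);
      \<And>g w. g \<in> carrier G \<Longrightarrow> w \<in> W \<Longrightarrow> \<rho> g *\<^sub>v w \<in> W; h \<in> carrier K; w \<in> W\<rbrakk> \<Longrightarrow> \<sigma> h *\<^sub>v w \<in> W"
  shows "irreducible_representation G n \<rho>"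
  using assms unfolding irreducible_representation_def by blast

text \<open>The scalars \<open>l h\<close> are nonzero, so the twist has the same invariant
  subspaces.\<close>

lemma Irr_twist:
  fixes G (structure)
  assumes G: "group G" and \<chi>: "\<chi> \<in> Irr G" and l: "\<And>g h. g \<in> carrier G \<Longrightarrow> h \<in> carrier G \<Longrightarrow> l (g \<otimes> h) = l g * l h"
    and l1: "l \<one> = 1"
  shows "(\<lambda>g. l g * \<chi> g) \<in> Irr G"
proof -
  interpret group G by fact
  obtain n \<rho> where irr: "irreducible_representation G n \<rho>" and \<chi>_eq: "\<chi> = character_of G \<rho>" using Irr_cases[OF \<chi>] .
  note \<rho> = irreducible_representationD(1)[OF irr]
  note r = representationD(1)[OF G \<rho>]
  have rep: "representation G n (\<lambda>g. l g \<cdot>\<^sub>m \<rho> g)"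
    unfolding representation_iff[OF G]
  proof (intro conjI ballI)
    fix g h assume gh: "g \<in> carrier G" "h \<in> carrier G"
    show "l (g \<otimes> h) \<cdot>\<^sub>m \<rho> (g \<otimes> h) = (l g \<cdot>\<^sub>m \<rho> g) * (l h \<cdot>\<^sub>m \<rho> h)"
      using r[OF gh(1)] r[OF gh(2)]
      by (intro eq_matI) (auto simp: l gh representationD(3)[OF G \<rho>])
  qed (use r l1 representationD(2)[OF G \<rho>] in auto)
  have "irreducible_representation G n (\<lambda>g. l g \<cdot>\<^sub>m \<rho> g)"
  proof (rule irreducible_representation_cong[OF G G rep irr])
    fix W h w assume sub: "VectorSpace.subspace class_ring W (module_vec TYPE(complex) n)"
      and inv: "\<And>g w. g \<in> carrier G \<Longrightarrow> w \<in> W \<Longrightarrow> (l g \<cdot>\<^sub>m \<rho> g) *\<^sub>v w \<in> W" and h: "h \<in> carrier G" and w: "w \<in> W"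
    have "l h * l (inv h) = 1" using l[of h "inv h"] h l1 by simp
    then have lh: "l h \<noteq> 0" by auto
    have wc: "w \<in> carrier_vec n" using sub w by (auto simp: subspace_module_vec_iff)
    have "\<rho> h *\<^sub>v w = (1 / l h) \<cdot>\<^sub>v ((l h \<cdot>\<^sub>m \<rho> h) *\<^sub>v w)"
      using r[OF h] wc lh by (intro eq_vecI) (auto simp: scalar_prod_def sum_distrib_left)
    then show "\<rho> h *\<^sub>v w \<in> W" using inv[OF h w] sub by (simp add: subspace_module_vec_iff)
  qed
  moreover have "character_of G (\<lambda>g. l g \<cdot>\<^sub>m \<rho> g) = (\<lambda>g. l g * \<chi> g)"
    using r by (auto simp: \<chi>_eq character_of_def mat_trace_smult[of _ n] fun_eq_iff)
  ultimately show ?thesis unfolding Irr_def by (metis (mono_tags, lifting) mem_Collect_eq)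
qed

text \<open>Conjugation by \<open>x\<close> permutes \<open>H\<close>, so precomposing with it
  changes neither the set of matrices nor the invariant subspaces.\<close>

lemma conj_char_Irr:
  fixes G (structure)
  assumes H: "H \<lhd> G" and \<alpha>: "\<alpha> \<in> Irr (G\<lparr>carrier := H\<rparr>)" and x: "x \<in> carrier G"
  shows "conj_char G H x \<alpha> \<in> Irr (G\<lparr>carrier := H\<rparr>)"
proof -
  interpret normal H G by fact
  have GH: "group (G\<lparr>carrier := H\<rparr>)" using subgroup_axioms is_group by (rule subgroup.subgroup_is_group)
  obtain n \<rho> where irr: "irreducible_representation (G\<lparr>carrier := H\<rparr>) n \<rho>" and \<alpha>_eq: "\<alpha> = character_of (G\<lparr>carrier := H\<rparr>) \<rho>"
    using Irr_cases[OF \<alpha>] .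
  note \<rho> = irreducible_representationD(1)[OF irr]
  note r = \<rho>[unfolded representation_iff[OF GH], simplified]
  have conj_in: "x \<otimes> h \<otimes> inv x \<in> H" if "h \<in> H" for h using inv_op_closed2[OF x that] .
  have conj_mult: "x \<otimes> (g \<otimes> h) \<otimes> inv x = (x \<otimes> g \<otimes> inv x) \<otimes> (x \<otimes> h \<otimes> inv x)" if "g \<in> H" "h \<in> H" for g h
  proof -
    have "g \<in> carrier G" "h \<in> carrier G" using that subset by auto
    moreover have "inv x \<otimes> (x \<otimes> (h \<otimes> inv x)) = h \<otimes> inv x" using x \<open>h \<in> carrier G\<close> by (simp flip: m_assoc)
    ultimately show ?thesis using x by (simp add: m_assoc)
  qed
  have rep: "representation (G\<lparr>carrier := H\<rparr>) n (\<lambda>h. \<rho> (x \<otimes> h \<otimes> inv x))"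
    unfolding representation_iff[OF GH] using r conj_in conj_mult x by simp
  have "irreducible_representation (G\<lparr>carrier := H\<rparr>) n (\<lambda>h. \<rho> (x \<otimes> h \<otimes> inv x))"
  proof (rule irreducible_representation_cong[OF GH GH rep irr])
    fix W h w assume inv: "\<And>g w. g \<in> carrier (G\<lparr>carrier := H\<rparr>) \<Longrightarrow> w \<in> W \<Longrightarrow> \<rho> (x \<otimes> g \<otimes> inv x) *\<^sub>v w \<in> W"
      and h: "h \<in> carrier (G\<lparr>carrier := H\<rparr>)" and w: "w \<in> W"
    have hG: "h \<in> carrier G" using h subset by auto
    have "x \<otimes> (inv x \<otimes> h \<otimes> x) \<otimes> inv x = h"
    proof -
      have "x \<otimes> (inv x \<otimes> h) = h" using x hG by (simp flip: m_assoc)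
      then show ?thesis using x hG by (simp add: m_assoc)
    qed
    moreover have "inv x \<otimes> h \<otimes> x \<in> H" using inv_op_closed1[OF x] h by simp
    ultimately show "\<rho> h *\<^sub>v w \<in> W" using inv[of "inv x \<otimes> h \<otimes> x" w] w by simp
  qed
  moreover have "character_of (G\<lparr>carrier := H\<rparr>) (\<lambda>h. \<rho> (x \<otimes> h \<otimes> inv x)) = conj_char G H x \<alpha>"
    using conj_in by (auto simp: \<alpha>_eq character_of_def conj_char_def restrict_char_def fun_eq_iff)
  ultimately show ?thesis unfolding Irr_def by (metis (mono_tags, lifting) mem_Collect_eq)
qed

lemma restrict_Irr_decompose:
  fixes G (structure)
  assumes G: "group G" and H: "subgroup H G" and \<chi>: "\<chi> \<in> Irr G"
  obtains xs where "set xs \<subseteq> Irr (G\<lparr>carrier := H\<rparr>)" "\<And>g. restrict_char H \<chi> g = (\<Sum>\<xi>\<leftarrow>xs. \<xi> g)"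
proof -
  interpret group G by fact
  interpret H: subgroup H G by fact
  have GH: "group (G\<lparr>carrier := H\<rparr>)" using H G by (rule subgroup.subgroup_is_group)
  obtain n \<rho> where irr: "irreducible_representation G n \<rho>" and \<chi>_eq: "\<chi> = character_of G \<rho>" using Irr_cases[OF \<chi>] .
  have "representation (G\<lparr>carrier := H\<rparr>) n \<rho>"
    using irreducible_representationD(1)[OF irr] unfolding representation_iff[OF GH] representation_iff[OF G] by auto
  moreover have "character_of (G\<lparr>carrier := H\<rparr>) \<rho> = restrict_char H \<chi>"
    by (auto simp: \<chi>_eq character_of_def restrict_char_def fun_eq_iff)
  ultimately show ?thesis using character_of_decompose[OF GH] that by metis
qed

text \<open>The representation consists of the permutation matrices of left multiplication, with
  \<open>e\<close> numbering the group elements. The trace counts fixed points, and only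
  \<open>\<one>\<close> has any. This supplies the irreducible characters lying over a given
  one.\<close>

lemma regular_character_decompose:
  fixes G (structure)
  assumes G: "group G" and fin: "finite (carrier G)"
  obtains xs where "set xs \<subseteq> Irr G" "\<And>g. (\<Sum>\<chi>\<leftarrow>xs. \<chi> g) = (if g = \<one> then of_nat (card (carrier G)) else 0)"
proof -
  interpret group G by fact
  define n where "n = card (carrier G)"
  obtain e where e: "bij_betw e {0..<n} (carrier G)" using ex_bij_betw_nat_finite[OF fin] n_def by blast
  define \<rho> :: "_ \<Rightarrow> complex mat" where "\<rho> g = mat n n (\<lambda>(i,j). if e i = g \<otimes> e j then 1 else 0)" for g
  have eG: "e i \<in> carrier G" if "i < n" for i using e that by (auto simp: bij_betw_def)
  have inj: "e i = e j \<longleftrightarrow> i = j" if "i < n" "j < n" for i j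
    using e that by (auto simp: bij_betw_def inj_on_def)
  have rep: "representation G n \<rho>"
    unfolding representation_iff[OF G]
  proof (intro conjI ballI)
    show "\<rho> \<one> = 1\<^sub>m n" by (intro eq_matI) (auto simp: \<rho>_def eG inj)
  next
    fix g h assume gh: "g \<in> carrier G" "h \<in> carrier G"
    show "\<rho> (g \<otimes> h) = \<rho> g * \<rho> h"
    proof (rule eq_matI)
      fix i j assume "i < dim_row (\<rho> g * \<rho> h)" "j < dim_col (\<rho> g * \<rho> h)"
      then have ij: "i < n" "j < n" by (auto simp: \<rho>_def)
      obtain l where l: "l < n" "e l = h \<otimes> e j"
        using e gh eG[OF ij(2)] by (metis atLeastLessThan_iff bij_betw_iff_bijections m_closed)
      have "(\<rho> g * \<rho> h) $$ (i,j) = (\<Sum>a<n. (if e i = g \<otimes> e a then 1 else 0) * (if e a = h \<otimes> e j then 1 else 0))"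
        using ij by (simp add: \<rho>_def scalar_prod_def atLeast0LessThan)
      also have "\<dots> = (\<Sum>a<n. if a = l then (if e i = g \<otimes> e a then 1 else 0) else 0)"
      proof (intro sum.cong refl)
        fix a assume "a \<in> {..<n}"
        then have "e a = h \<otimes> e j \<longleftrightarrow> a = l" using inj[of a l] l by simp
        then show "(if e i = g \<otimes> e a then 1 else 0) * (if e a = h \<otimes> e j then 1 else 0) =
          (if a = l then (if e i = g \<otimes> e a then 1 else 0) else 0 :: complex)" by simp
      qed
      also have "\<dots> = \<rho> (g \<otimes> h) $$ (i,j)" using l ij gh eG[OF ij(2)] by (simp add: \<rho>_def m_assoc)
      finally show "\<rho> (g \<otimes> h) $$ (i,j) = (\<rho> g * \<rho> h) $$ (i,j)" by simp
    qed (auto simp: \<rho>_def)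
  qed (simp add: \<rho>_def)
  have "character_of G \<rho> g = (if g = \<one> then of_nat n else 0)" for g
  proof (cases "g \<in> carrier G")
    case g: True
    have "mat_trace (\<rho> g) = (\<Sum>i<n. if e i = g \<otimes> e i then 1 else 0)" by (simp add: \<rho>_def mat_trace_def)
    also have "\<dots> = (\<Sum>i<n. if g = \<one> then 1 else 0)"
    proof (intro sum.cong refl)
      fix i assume "i \<in> {..<n}"
      then have "e i \<in> carrier G" using eG by simp
      then have "e i = g \<otimes> e i \<longleftrightarrow> g = \<one>" using g by (metis l_one one_closed r_cancel)
      then show "(if e i = g \<otimes> e i then 1 else 0) = (if g = \<one> then 1 else 0 :: complex)" by simp
    qed
    finally show ?thesis using g by (simp add: character_of_def)
  qed (auto simp: character_of_def)
  then show ?thesis using character_of_decompose[OF G rep] that n_def by metis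
qed

subsection \<open>Inner products and induction\<close>

lemma char_inner_sum_list:
  "char_inner K (\<lambda>g. \<Sum>\<chi>\<leftarrow>xs. \<chi> g) \<xi> = (\<Sum>\<chi>\<leftarrow>xs. char_inner K \<chi> \<xi>)"
  by (induction xs) (simp_all add: char_inner_def sum.distrib algebra_simps)

lemma char_inner_cong:
  "(\<And>k. k \<in> K \<Longrightarrow> f k = f' k) \<Longrightarrow> (\<And>k. k \<in> K \<Longrightarrow> g k = g' k) \<Longrightarrow> char_inner K f g = char_inner K f' g'"
  by (simp add: char_inner_def)

lemma char_inner_commute: "char_inner K f g = cnj (char_inner K g f)"
  by (simp add: char_inner_def mult.commute)

lemma char_inner_Irr_list:
  assumes "group G" "finite (carrier G)" "set xs \<subseteq> Irr G" "\<xi> \<in> Irr G"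
  shows "char_inner (carrier G) (\<lambda>g. \<Sum>\<chi>\<leftarrow>xs. \<chi> g) \<xi> = of_nat (count_list xs \<xi>)"
  unfolding char_inner_sum_list using assms(3)
  by (induction xs) (auto simp: Irr_orthonormal[OF assms(1,2) _ assms(4)])

lemma sum_list_if_eq: "(\<Sum>x\<leftarrow>xs. if x = a then c else 0) = of_nat (count_list xs a) * (c :: complex)"
  by (induction xs) (simp_all add: algebra_simps)

text \<open>The squared distance of \<open>f\<close> and \<open>g\<close> is \<open>2 - 2 e\<close>
  in the normalised inner product, hence at most 0 for \<open>e \<ge> 1\<close>. It identifies an
  induced function, known only through its norm, with an irreducible character.\<close>

lemma char_inner_eqI:
  assumes fin: "finite K" and ne: "K \<noteq> {}" and f: "char_inner K f f = 1" and g: "char_inner K g g = 1"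
    and fg: "char_inner K f g = of_nat e" and e: "e \<noteq> 0" and k: "k \<in> K"
  shows "f k = g k"
proof -
  have card: "card K \<noteq> 0" using fin ne by auto
  have gf: "char_inner K g f = of_nat e" using fg char_inner_commute[of K g f] by simp
  have "of_real (\<Sum>k\<in>K. (cmod (f k - g k))\<^sup>2) = (\<Sum>k\<in>K. (f k - g k) * cnj (f k - g k))"
    by (simp add: complex_norm_square[symmetric] del: complex_cnj_diff)
  also have "\<dots> = of_nat (card K) * (char_inner K f f - char_inner K f g - char_inner K g f + char_inner K g g)"
    using card by (simp add: char_inner_def algebra_simps sum.distrib sum_subtractf)
  also have "\<dots> = of_real (real (card K) * (2 - 2 * real e))" by (simp add: f g fg gf)
  finally have eq: "(\<Sum>k\<in>K. (cmod (f k - g k))\<^sup>2) = real (card K) * (2 - 2 * real e)" using of_real_eq_iff by blast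
  have "real (card K) * (2 - 2 * real e) \<le> 0" using e by (intro mult_nonneg_nonpos) auto
  then have "(\<Sum>k\<in>K. (cmod (f k - g k))\<^sup>2) = 0" using eq sum_nonneg[of K "\<lambda>k. (cmod (f k - g k))\<^sup>2"] by simp
  then show ?thesis using fin k by (subst (asm) sum_nonneg_eq_0_iff) auto
qed

lemma sum_conj_invariant:
  fixes G (structure)
  assumes "group G" "x \<in> carrier G"
  shows "(\<Sum>g\<in>carrier G. f (x \<otimes> g \<otimes> inv x)) = (\<Sum>g\<in>carrier G. f g)"
  using sum.reindex_bij_betw[OF bij_betw_conj[OF assms], of f] .

text \<open>Since \<open>\<chi>\<close> is constant on classes, it can be conjugated along with
  \<open>\<xi>\<close>; after exchanging the sums every \<open>x\<close> contributes the same
  amount, and the group order cancels. As \<open>\<chi>\<close> may be any class function, an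
  induced function can take its place.\<close>

lemma frobenius_reciprocity:
  fixes G (structure)
  assumes G: "group G" and fin: "finite (carrier G)" and K: "subgroup K G"
    and \<chi>: "\<And>x g. x \<in> carrier G \<Longrightarrow> g \<in> carrier G \<Longrightarrow> \<chi> (x \<otimes> g \<otimes> inv x) = \<chi> g"
  shows "char_inner (carrier G) (induced_char G K \<xi>) \<chi> = char_inner K \<xi> \<chi>"
proof -
  interpret group G by fact
  have KG: "K \<subseteq> carrier G" using subgroup.subset[OF K] .
  have card: "card (carrier G) \<noteq> 0" using fin by (auto simp: card_eq_0_iff)
  have "(\<Sum>g\<in>carrier G. induced_char G K \<xi> g * cnj (\<chi> g))
     = 1 / of_nat (card K) * (\<Sum>g\<in>carrier G. \<Sum>x\<in>carrier G. restrict_char K \<xi> (x \<otimes> g \<otimes> inv x) * cnj (\<chi> (x \<otimes> g \<otimes> inv x)))"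
    by (simp add: induced_char_def \<chi> sum_distrib_left sum_distrib_right mult.assoc)
  also have "(\<Sum>g\<in>carrier G. \<Sum>x\<in>carrier G. restrict_char K \<xi> (x \<otimes> g \<otimes> inv x) * cnj (\<chi> (x \<otimes> g \<otimes> inv x)))
     = (\<Sum>x\<in>carrier G. \<Sum>g\<in>carrier G. restrict_char K \<xi> g * cnj (\<chi> g))"
    by (subst sum.swap) (intro sum.cong refl sum_conj_invariant[OF G, of _ "\<lambda>g. restrict_char K \<xi> g * cnj (\<chi> g)"])
  also have "(\<Sum>g\<in>carrier G. restrict_char K \<xi> g * cnj (\<chi> g)) = (\<Sum>g\<in>K. \<xi> g * cnj (\<chi> g))"
    using KG fin by (intro sum.mono_neutral_cong_right) (auto simp: restrict_char_def)
  finally show ?thesis using card by (simp add: char_inner_def)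
qed

lemma induced_char_class_function:
  fixes G (structure)
  assumes G: "group G" and x: "x \<in> carrier G" and g: "g \<in> carrier G"
  shows "induced_char G K \<xi> (x \<otimes> g \<otimes> inv x) = induced_char G K \<xi> g"
proof -
  interpret group G by fact
  have "(\<Sum>y\<in>carrier G. restrict_char K \<xi> (y \<otimes> (x \<otimes> g \<otimes> inv x) \<otimes> inv y))
     = (\<Sum>y\<in>carrier G. restrict_char K \<xi> ((y \<otimes> x) \<otimes> g \<otimes> inv (y \<otimes> x)))"
    using x g by (intro sum.cong refl) (simp add: m_assoc inv_mult_group)
  also have "\<dots> = (\<Sum>y\<in>carrier G. restrict_char K \<xi> (y \<otimes> g \<otimes> inv y))"
    using sum.reindex_bij_betw[OF bij_betw_mult_right[OF G x], of "\<lambda>y. restrict_char K \<xi> (y \<otimes> g \<otimes> inv y)"] .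
  finally show ?thesis using x g by (simp add: induced_char_def)
qed

lemma induced_char_degree:
  fixes G (structure)
  assumes G: "group G" and K: "subgroup K G"
  shows "induced_char G K \<xi> \<one> = of_nat (card (carrier G)) / of_nat (card K) * \<xi> \<one>"
proof -
  interpret group G by fact
  show ?thesis using subgroup.one_closed[OF K] by (simp add: induced_char_def restrict_char_def)
qed

lemma induced_char_trans:
  fixes G (structure)
  assumes G: "group G" and fin: "finite (carrier G)" and K: "subgroup K G" and H: "subgroup H G" and HK: "H \<subseteq> K"
  shows "induced_char G K (induced_char (G\<lparr>carrier := K\<rparr>) H \<alpha>) = induced_char G H \<alpha>"
proof
  fix g
  interpret group G by fact
  interpret K: subgroup K G by fact
  have KG: "K \<subseteq> carrier G" using subgroup.subset[OF K] .
  have cK: "card K \<noteq> 0" using fin KG K.one_closed by (metis card_eq_0_iff empty_iff finite_subset)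
  show "induced_char G K (induced_char (G\<lparr>carrier := K\<rparr>) H \<alpha>) g = induced_char G H \<alpha> g"
  proof (cases "g \<in> carrier G")
    case g: True
    \<comment> \<open>The formula also covers \<open>y\<close> outside \<open>K\<close>: no
      conjugate of such a \<open>y\<close> by an element of \<open>K\<close> lies in
      \<open>H\<close>, so both sides are 0.\<close>
    have inner: "restrict_char K (induced_char (G\<lparr>carrier := K\<rparr>) H \<alpha>) y
       = 1 / of_nat (card H) * (\<Sum>k\<in>K. restrict_char H \<alpha> (k \<otimes> y \<otimes> inv k))" if y: "y \<in> carrier G" for y
    proof (cases "y \<in> K")
      case True
      have "(\<Sum>k\<in>K. restrict_char H \<alpha> (k \<otimes> y \<otimes> inv\<^bsub>G\<lparr>carrier := K\<rparr>\<^esub> k)) = (\<Sum>k\<in>K. restrict_char H \<alpha> (k \<otimes> y \<otimes> inv k))"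
        by (intro sum.cong refl) (simp add: m_inv_consistent[OF K])
      then show ?thesis using True by (simp add: restrict_char_def induced_char_def)
    next
      case False
      have "k \<otimes> y \<otimes> inv k \<notin> H" if k: "k \<in> K" for k
      proof
        assume "k \<otimes> y \<otimes> inv k \<in> H"
        then have "inv k \<otimes> (k \<otimes> y \<otimes> inv k) \<otimes> k \<in> K" using HK k by auto
        moreover have "inv k \<otimes> (k \<otimes> y \<otimes> inv k) \<otimes> k = y"
        proof -
          have kG: "k \<in> carrier G" using k KG by auto
          then have "inv k \<otimes> (k \<otimes> y) = y" using y by (simp flip: m_assoc)
          then show ?thesis using kG y by (simp add: m_assoc)
        qed
        ultimately show False using False by simp
      qed
      then have "(\<Sum>k\<in>K. restrict_char H \<alpha> (k \<otimes> y \<otimes> inv k)) = 0" by (intro sum.neutral) (simp add: restrict_char_def)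
      then show ?thesis using False by (simp add: restrict_char_def)
    qed
    have "(\<Sum>x\<in>carrier G. restrict_char K (induced_char (G\<lparr>carrier := K\<rparr>) H \<alpha>) (x \<otimes> g \<otimes> inv x))
       = 1 / of_nat (card H) * (\<Sum>x\<in>carrier G. \<Sum>k\<in>K. restrict_char H \<alpha> (k \<otimes> (x \<otimes> g \<otimes> inv x) \<otimes> inv k))"
      using g by (simp add: inner sum_distrib_left)
    also have "(\<Sum>x\<in>carrier G. \<Sum>k\<in>K. restrict_char H \<alpha> (k \<otimes> (x \<otimes> g \<otimes> inv x) \<otimes> inv k))
       = (\<Sum>k\<in>K. \<Sum>x\<in>carrier G. restrict_char H \<alpha> ((k \<otimes> x) \<otimes> g \<otimes> inv (k \<otimes> x)))"
      using g KG by (subst sum.swap) (intro sum.cong refl, simp add: m_assoc inv_mult_group subset_iff)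
    \<comment> \<open>Absorbing \<open>k\<close> into \<open>x\<close> leaves \<open>card K\<close>
      equal copies, which cancel the factor from the outer induction.\<close>
    also have "\<dots> = (\<Sum>k\<in>K. \<Sum>x\<in>carrier G. restrict_char H \<alpha> (x \<otimes> g \<otimes> inv x))"
    proof (rule sum.cong[OF refl])
      fix k assume "k \<in> K"
      then have "k \<in> carrier G" using KG by auto
      from sum.reindex_bij_betw[OF bij_betw_mult_left[OF G this], of "\<lambda>x. restrict_char H \<alpha> (x \<otimes> g \<otimes> inv x)"]
      show "(\<Sum>x\<in>carrier G. restrict_char H \<alpha> ((k \<otimes> x) \<otimes> g \<otimes> inv (k \<otimes> x))) = (\<Sum>x\<in>carrier G. restrict_char H \<alpha> (x \<otimes> g \<otimes> inv x))" .
    qed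
    finally show ?thesis using g cK by (simp add: induced_char_def)
  qed (simp add: induced_char_def)
qed

lemma subgroup_card_nonzero:
  assumes "finite (carrier G)" "subgroup H G"
  shows "card H \<noteq> 0"
  using finite_subset[OF subgroup.subset[OF assms(2)] assms(1)] subgroup.one_closed[OF assms(2)]
  by (metis card_eq_0_iff empty_iff)

text \<open>\<open>G Mod H\<close> is cyclic of order \<open>r\<close> with a generator
  \<open>c\<close>, and the coset \<open>c\<close> to the power \<open>i\<close> is sent to
  \<open>\<omega> ^ i\<close> for a primitive \<open>r\<close>-th root of unity
  \<open>\<omega>\<close>. Primality makes each power \<open>l ^ j\<close> with
  \<open>0 < j < r\<close> differ from 1 at every element off \<open>H\<close>, not just at some of
  them.\<close>

lemma prime_index_linear_character:
  fixes G (structure)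
  assumes H: "H \<lhd> G" and fin: "finite (carrier G)" and card: "card (carrier G) = r * card H" and r: "Factorial_Ring.prime r"
  obtains l :: "'a \<Rightarrow> complex" where "\<And>g h. g \<in> carrier G \<Longrightarrow> h \<in> carrier G \<Longrightarrow> l (g \<otimes> h) = l g * l h"
    "\<And>g. g \<in> H \<Longrightarrow> l g = 1" "\<And>g. g \<in> carrier G \<Longrightarrow> l g ^ r = 1"
    "\<And>g j. g \<in> carrier G \<Longrightarrow> g \<notin> H \<Longrightarrow> 0 < j \<Longrightarrow> j < r \<Longrightarrow> l g ^ j \<noteq> 1"
proof -
  interpret normal H G by fact
  define Q where "Q = G Mod H"
  interpret Q: group Q unfolding Q_def by (rule factorgroup_is_group)
  have Hsub: "subgroup H G" ..
  have cH: "card H \<noteq> 0" by (rule subgroup_card_nonzero[OF fin Hsub])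
  have "card (rcosets H) * card H = r * card H" using lagrange[OF Hsub] card by (simp add: Coset.order_def)
  then have cardQ: "card (carrier Q) = r" using cH by (simp add: Q_def FactGroup_def)
  have r1: "r > 1" using r prime_gt_1_nat by blast
  have finQ: "finite (carrier Q)" using cardQ r1 by (auto intro: card_ge_0_finite)
  have "carrier Q \<noteq> {\<one>\<^bsub>Q\<^esub>}" using cardQ r1 by auto
  moreover have "carrier Q = {\<one>\<^bsub>Q\<^esub>}" if "\<forall>c\<in>carrier Q. c = \<one>\<^bsub>Q\<^esub>"
    using that Q.one_closed by auto
  ultimately obtain c where c: "c \<in> carrier Q" "c \<noteq> \<one>\<^bsub>Q\<^esub>" by blast
  have "Q.ord c dvd r" using Q.ord_dvd_group_order[OF c(1)] cardQ by (simp add: Coset.order_def)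
  moreover have "Q.ord c \<noteq> 1" using Q.ord_eq_1[OF c(1)] c(2) by simp
  ultimately have ordc: "Q.ord c = r" using r unfolding prime_nat_iff by blast
  have "card (generate Q {c}) = card (carrier Q)" using Q.generate_pow_card[OF c(1)] ordc cardQ by simp
  then have "generate Q {c} = carrier Q"
    using finQ Q.generate_incl[of "{c}"] c(1) by (intro card_subset_eq) auto
  then have gen: "\<exists>i::nat. C = c [^]\<^bsub>Q\<^esub> i" if "C \<in> carrier Q" for C
    using that Q.generate_pow_on_finite_carrier[OF finQ c(1)] by auto
  have coset: "H #> g \<in> carrier Q" if "g \<in> carrier G" for g
    using that by (simp add: Q_def carrier_FactGroup)
  \<comment> \<open>The chosen exponent is determined only modulo \<open>r\<close>;
    \<open>\<omega>_cong\<close> makes this harmless.\<close>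
  define d where "d g = (SOME i::nat. H #> g = c [^]\<^bsub>Q\<^esub> i)" for g
  have d: "H #> g = c [^]\<^bsub>Q\<^esub> d g" if "g \<in> carrier G" for g
    unfolding d_def using gen[OF coset[OF that]] by (rule someI_ex)
  define \<omega> where "\<omega> = cis (2 * pi / real r)"
  have \<omega>_pow: "\<omega> ^ i = cis (2 * pi * real i / real r)" for i
    by (simp add: \<omega>_def DeMoivre mult.commute)
  have \<omega>r: "\<omega> ^ r = 1" using r1 by (simp add: \<omega>_pow)
  have \<omega>_mod: "\<omega> ^ i = \<omega> ^ (i mod r)" for i
  proof -
    have "\<omega> ^ i = \<omega> ^ (r * (i div r) + i mod r)" by simp
    also have "\<dots> = \<omega> ^ (i mod r)" by (simp only: power_add power_mult \<omega>r power_one mult_1)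
    finally show ?thesis .
  qed
  have \<omega>_eq_1: "\<omega> ^ i = 1 \<longleftrightarrow> r dvd i" for i
  proof
    assume "\<omega> ^ i = 1"
    then have "cis (2 * pi * real (i mod r) / real r) = cis (2 * pi * real 0 / real r)"
      using \<omega>_mod[of i] \<omega>_pow[of "i mod r"] by simp
    then have "i mod r = 0"
      using bij_betw_imp_inj_on[OF bij_betw_roots_unity[of r]] r1 by (auto simp: inj_on_def)
    then show "r dvd i" by auto
  next
    assume "r dvd i" then show "\<omega> ^ i = 1" using \<omega>_mod[of i] by simp
  qed
  have \<omega>_le: "\<omega> ^ i = \<omega> ^ j" if "c [^]\<^bsub>Q\<^esub> i = c [^]\<^bsub>Q\<^esub> j" "i \<le> j" for i j :: nat
  proof -
    have "c [^]\<^bsub>Q\<^esub> i \<otimes>\<^bsub>Q\<^esub> c [^]\<^bsub>Q\<^esub> (j - i) = c [^]\<^bsub>Q\<^esub> i" 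
      using Q.nat_pow_mult[OF c(1), of i "j - i"] that by simp
    then have "c [^]\<^bsub>Q\<^esub> (j - i) = \<one>\<^bsub>Q\<^esub>" 
      using Q.l_cancel_one[OF Q.nat_pow_closed[OF c(1)] Q.nat_pow_closed[OF c(1)]] by simp
    then have "\<omega> ^ (j - i) = 1" using Q.pow_eq_id[OF c(1)] ordc \<omega>_eq_1 by simp
    then show ?thesis using that(2) power_add[of \<omega> i "j - i"] by simp
  qed
  have \<omega>_cong: "\<omega> ^ i = \<omega> ^ j" if "c [^]\<^bsub>Q\<^esub> i = c [^]\<^bsub>Q\<^esub> j" for i j :: nat
  proof (cases "i \<le> j")
    case True
    show ?thesis by (rule \<omega>_le[OF that True])
  next
    case False
    then have "j \<le> i" by simp
    show ?thesis by (rule \<omega>_le[OF that[symmetric] \<open>j \<le> i\<close>, symmetric])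
  qed
  show ?thesis
  proof (rule that[of "\<lambda>g. \<omega> ^ d g"])
    fix g h assume gh: "g \<in> carrier G" "h \<in> carrier G"
    have "c [^]\<^bsub>Q\<^esub> d (g \<otimes> h) = H #> (g \<otimes> h)" using d gh by simp
    also have "\<dots> = (H #> g) \<otimes>\<^bsub>Q\<^esub> (H #> h)" using rcos_sum[OF gh] by (simp add: Q_def)
    also have "\<dots> = c [^]\<^bsub>Q\<^esub> (d g + d h)" using d gh c(1) by (simp add: Q.nat_pow_mult)
    finally show "\<omega> ^ d (g \<otimes> h) = \<omega> ^ d g * \<omega> ^ d h" unfolding power_add[symmetric] by (rule \<omega>_cong)
  next
    fix g assume g: "g \<in> H"
    then have "H #> g = \<one>\<^bsub>Q\<^esub>" using subset by (simp add: Q_def rcos_const)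
    then have "c [^]\<^bsub>Q\<^esub> d g = c [^]\<^bsub>Q\<^esub> (0::nat)" using d[of g] g subset by auto
    then have "\<omega> ^ d g = \<omega> ^ 0" by (rule \<omega>_cong)
    then show "\<omega> ^ d g = 1" by simp
  next
    fix g show "(\<omega> ^ d g) ^ r = 1" by (simp add: power_mult[symmetric] \<omega>_eq_1)
  next
    fix g j assume g: "g \<in> carrier G" "g \<notin> H" and j: "0 < j" "j < r"
    have "\<not> r dvd d g"
    proof
      assume "r dvd d g"
      then have "H #> g = H" using d[OF g(1)] Q.pow_eq_id[OF c(1)] ordc by (simp add: Q_def)
      then show False using g rcos_self[OF g(1) Hsub] by simp
    qed
    then have "\<not> r dvd d g * j" using r j nat_dvd_not_less[OF j] by (simp add: prime_dvd_mult_iff)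
    then show "(\<omega> ^ d g) ^ j \<noteq> 1" using \<omega>_eq_1 by (simp flip: power_mult)
  qed
qed

subsection \<open>Clifford theory for prime index\<close>

text \<open>The inner product is a multiplicity in a decomposition. Being a natural number, it is at
  least 1 once it is nonzero, as \<open>char_inner_eqI\<close> demands.\<close>

lemma restrict_Irr_inner:
  fixes G (structure)
  assumes G: "group G" and fin: "finite (carrier G)" and H: "subgroup H G" and \<chi>: "\<chi> \<in> Irr G"
    and \<alpha>: "\<alpha> \<in> Irr (G\<lparr>carrier := H\<rparr>)"
  obtains e :: nat where "char_inner H (restrict_char H \<chi>) \<alpha> = of_nat e"
proof -
  obtain xs where xs: "set xs \<subseteq> Irr (G\<lparr>carrier := H\<rparr>)" "\<And>g. restrict_char H \<chi> g = (\<Sum>\<xi>\<leftarrow>xs. \<xi> g)"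
    using restrict_Irr_decompose[OF G H \<chi>] by blast
  have GH: "group (G\<lparr>carrier := H\<rparr>)" using H G by (rule subgroup.subgroup_is_group)
  have "restrict_char H \<chi> = (\<lambda>g. \<Sum>\<xi>\<leftarrow>xs. \<xi> g)" using xs(2) by blast
  then have "char_inner H (restrict_char H \<chi>) \<alpha> = of_nat (count_list xs \<alpha>)"
    using char_inner_Irr_list[OF GH _ xs(1) \<alpha>] finite_subset[OF subgroup.subset[OF H] fin] by simp
  then show ?thesis using that by blast
qed

text \<open>The squared norm of the induced function is the number of \<open>x\<close> fixing
  \<open>\<alpha>\<close>, divided by \<open>card H\<close>, hence 1. Its inner product with
  \<open>\<psi>\<close> is a nonzero multiplicity by Frobenius reciprocity, so the two functions
  coincide.\<close>

lemma Irr_induced_of_trivial_inertia: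
  fixes G (structure)
  assumes H: "H \<lhd> G" and fin: "finite (carrier G)"
    and \<alpha>: "\<alpha> \<in> Irr (G\<lparr>carrier := H\<rparr>)" and \<psi>: "\<psi> \<in> Irr G"
    and over: "char_inner H (restrict_char H \<psi>) \<alpha> \<noteq> 0"
    and inertia: "inertia_group G H \<alpha> = H"
  shows "induced_char G H \<alpha> = \<psi>"
proof -
  interpret normal H G by fact
  have G: "group G" by (rule is_group)
  have Hsub: "subgroup H G" ..
  have GH: "group (G\<lparr>carrier := H\<rparr>)" using Hsub G by (rule subgroup.subgroup_is_group)
  have finH: "finite H" using finite_subset[OF subset fin] .
  have cH: "card H \<noteq> 0" by (rule subgroup_card_nonzero[OF fin Hsub])
  obtain e where e: "char_inner H (restrict_char H \<psi>) \<alpha> = of_nat e" using restrict_Irr_inner[OF G fin Hsub \<psi> \<alpha>] .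
  have e0: "e \<noteq> 0" using over e by auto
  have rest: "char_inner H \<alpha> \<psi> = cnj (char_inner H (restrict_char H \<psi>) \<alpha>)"
    unfolding char_inner_commute[of H \<alpha>] by (intro arg_cong[of _ _ cnj] char_inner_cong) (auto simp: restrict_char_def)
  have 1: "char_inner (carrier G) (induced_char G H \<alpha>) \<psi> = of_nat e"
    using frobenius_reciprocity[OF G fin Hsub, of \<psi> \<alpha>] Irr_class_function[OF G \<psi>] rest e by simp
  have "char_inner (carrier G) (induced_char G H \<alpha>) (induced_char G H \<alpha>) = char_inner H \<alpha> (induced_char G H \<alpha>)"
    using frobenius_reciprocity[OF G fin Hsub, of "induced_char G H \<alpha>" \<alpha>] induced_char_class_function[OF G] by simp
  \<comment> \<open>On the normal subgroup \<open>H\<close> the induced function is the sum of all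
    conjugates of \<open>\<alpha>\<close>, divided by \<open>card H\<close>.\<close>
  also have "\<dots> = (\<Sum>x\<in>carrier G. char_inner H \<alpha> (conj_char G H x \<alpha>)) / of_nat (card H)"
  proof -
    have "\<alpha> h * cnj (induced_char G H \<alpha> h) = (\<Sum>x\<in>carrier G. \<alpha> h * cnj (conj_char G H x \<alpha> h)) / of_nat (card H)"
      if h: "h \<in> H" for h
    proof -
      have "restrict_char H \<alpha> (x \<otimes> h \<otimes> inv x) = conj_char G H x \<alpha> h" if "x \<in> carrier G" for x
        using inv_op_closed2[OF that h] h by (simp add: restrict_char_def conj_char_def)
      then have "induced_char G H \<alpha> h = (\<Sum>x\<in>carrier G. conj_char G H x \<alpha> h) / of_nat (card H)"
        using h subset by (simp add: induced_char_def subset_iff)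
      then show ?thesis by (simp add: sum_distrib_left)
    qed
    then have "(\<Sum>h\<in>H. \<alpha> h * cnj (induced_char G H \<alpha> h))
       = (\<Sum>x\<in>carrier G. \<Sum>h\<in>H. \<alpha> h * cnj (conj_char G H x \<alpha> h)) / of_nat (card H)"
      by (subst sum.swap) (simp add: sum_divide_distrib)
    then show ?thesis by (simp add: char_inner_def sum_divide_distrib)
  qed
  also have "\<dots> = (\<Sum>x\<in>carrier G. if x \<in> H then 1 else 0) / of_nat (card H)"
  proof -
    have "char_inner H \<alpha> (conj_char G H x \<alpha>) = (if x \<in> H then 1 else 0)" if x: "x \<in> carrier G" for x
    proof -
      have "x \<in> inertia_group G H \<alpha> \<longleftrightarrow> conj_char G H x \<alpha> = \<alpha>" using x by (simp add: inertia_group_def)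
      then have "\<alpha> = conj_char G H x \<alpha> \<longleftrightarrow> x \<in> H" unfolding inertia by auto
      then show ?thesis using Irr_orthonormal[OF GH _ \<alpha> conj_char_Irr[OF H \<alpha> x]] finH by simp
    qed
    then show ?thesis by simp
  qed
  also have "(\<Sum>x\<in>carrier G. if x \<in> H then 1 else 0) = (of_nat (card H) :: complex)"
    using fin subset by (simp add: sum.If_cases Int_absorb1)
  finally have 2: "char_inner (carrier G) (induced_char G H \<alpha>) (induced_char G H \<alpha>) = 1" using cH by simp
  have 3: "char_inner (carrier G) \<psi> \<psi> = 1" using Irr_orthonormal[OF G fin \<psi> \<psi>] by simp
  have "induced_char G H \<alpha> g = \<psi> g" for g
  proof (cases "g \<in> carrier G")
    case True
    then show ?thesis using char_inner_eqI[OF fin _ 2 3 1 e0 True] by blast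
  qed (simp add: induced_char_def Irr_outside[OF \<psi>])
  then show ?thesis by blast
qed

text \<open>Clifford's theorem for an invariant constituent, obtained by comparing the convolution
  of \<open>\<psi>\<close> with \<open>cnj \<alpha>\<close> over \<open>G\<close> and over \<open>H\<close>.\<close>

lemma restrict_Irr_over_invariant:
  fixes G (structure)
  assumes H: "H \<lhd> G" and fin: "finite (carrier G)"
    and \<alpha>: "\<alpha> \<in> Irr (G\<lparr>carrier := H\<rparr>)" and \<psi>: "\<psi> \<in> Irr G"
    and over: "char_inner H (restrict_char H \<psi>) \<alpha> \<noteq> 0"
    and inertia: "inertia_group G H \<alpha> = carrier G"
  obtains e :: nat where "\<And>h. h \<in> H \<Longrightarrow> \<psi> h = of_nat e * \<alpha> h"
proof -
  interpret normal H G by fact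
  have G: "group G" by (rule is_group)
  have Hsub: "subgroup H G" ..
  have GH: "group (G\<lparr>carrier := H\<rparr>)" using Hsub G by (rule subgroup.subgroup_is_group)
  have finH: "finite H" using finite_subset[OF subset fin] .
  have cH: "card H \<noteq> 0" by (rule subgroup_card_nonzero[OF fin Hsub])
  obtain xs where xs: "set xs \<subseteq> Irr (G\<lparr>carrier := H\<rparr>)" "\<And>g. restrict_char H \<psi> g = (\<Sum>\<xi>\<leftarrow>xs. \<xi> g)"
    using restrict_Irr_decompose[OF G Hsub \<psi>] by blast
  have xs_eq: "restrict_char H \<psi> = (\<lambda>g. \<Sum>\<xi>\<leftarrow>xs. \<xi> g)" using xs(2) by blast
  define e where "e = count_list xs \<alpha>"
  have e: "char_inner H (restrict_char H \<psi>) \<alpha> = of_nat e"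
    using char_inner_Irr_list[OF GH _ xs(1) \<alpha>] finH by (simp add: xs_eq e_def)
  have e0: "e \<noteq> 0" using over e by auto
  obtain a where a: "a \<noteq> 0" "\<alpha> \<one> = of_nat a" using Irr_degree[OF GH \<alpha>] by auto
  have out: "\<alpha> g = 0" if "g \<notin> H" for g using Irr_outside[OF \<alpha>, of g] that by simp
  \<comment> \<open>Because \<open>\<alpha>\<close> is 0 off the normal subgroup \<open>H\<close>,
    its invariance makes it a class function on all of \<open>G\<close>, so its conjugate is an
    admissible weight there.\<close>
  have inv: "\<alpha> (x \<otimes> g \<otimes> inv x) = \<alpha> g" if x: "x \<in> carrier G" and g: "g \<in> carrier G" for x g
  proof (cases "g \<in> H")
    case True
    have "x \<in> inertia_group G H \<alpha>" unfolding inertia by (rule x)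
    then have "conj_char G H x \<alpha> = \<alpha>" by (simp add: inertia_group_def)
    then have "conj_char G H x \<alpha> g = \<alpha> g" by simp
    then show ?thesis using True by (simp add: conj_char_def restrict_char_def)
  next
    case False
    have "x \<otimes> g \<otimes> inv x \<notin> H"
    proof
      assume "x \<otimes> g \<otimes> inv x \<in> H"
      then have "inv x \<otimes> (x \<otimes> g \<otimes> inv x) \<otimes> x \<in> H" using inv_op_closed1[OF x] by simp
      moreover have "inv x \<otimes> (x \<otimes> g \<otimes> inv x) \<otimes> x = g"
      proof -
        have "inv x \<otimes> (x \<otimes> g) = g" using x g by (simp flip: m_assoc)
        then show ?thesis using x g by (simp add: m_assoc)
      qed
      ultimately show False using False by simp
    qed
    then show ?thesis using False out by simp
  qed
  have sumH: "(\<Sum>g\<in>carrier G. cnj (\<alpha> g) * f g) = (\<Sum>g\<in>H. cnj (\<alpha> g) * f g)" for f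
    using fin subset by (intro sum.mono_neutral_right) (auto simp: out)
  \<comment> \<open>Over \<open>H\<close>, convolution with the conjugate of \<open>\<alpha>\<close>
    annihilates every irreducible character except \<open>\<alpha>\<close>, which it
    rescales.\<close>
  have cross: "(\<Sum>g\<in>H. cnj (\<alpha> g) * \<beta> (g \<otimes> h)) = (if \<beta> = \<alpha> then of_nat (card H) * \<alpha> h / \<alpha> \<one> else 0)"
    if \<beta>: "\<beta> \<in> Irr (G\<lparr>carrier := H\<rparr>)" and h: "h \<in> H" for \<beta> h
  proof -
    obtain b where b: "b \<noteq> 0" "\<beta> \<one> = of_nat b" using Irr_degree[OF GH \<beta>] by auto
    have cf: "cnj (\<alpha> (x \<otimes>\<^bsub>G\<lparr>carrier := H\<rparr>\<^esub> g \<otimes>\<^bsub>G\<lparr>carrier := H\<rparr>\<^esub> inv\<^bsub>G\<lparr>carrier := H\<rparr>\<^esub> x)) = cnj (\<alpha> g)"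
      if "x \<in> carrier (G\<lparr>carrier := H\<rparr>)" "g \<in> carrier (G\<lparr>carrier := H\<rparr>)" for x g
      using Irr_class_function[OF GH \<alpha> that] by simp
    have "(\<Sum>g\<in>H. cnj (\<alpha> g) * \<beta> (g \<otimes> h)) * \<beta> \<one> = (\<Sum>g\<in>H. cnj (\<alpha> g) * \<beta> g) * \<beta> h"
      using Irr_convolution[OF GH \<beta>, of h "\<lambda>g. cnj (\<alpha> g)", OF _ cf] h by simp
    also have "(\<Sum>g\<in>H. cnj (\<alpha> g) * \<beta> g) = of_nat (card H) * char_inner H \<beta> \<alpha>"
      using cH by (simp add: char_inner_def mult.commute)
    also have "char_inner H \<beta> \<alpha> = (if \<beta> = \<alpha> then 1 else 0)"
      using Irr_orthonormal[OF GH _ \<beta> \<alpha>] finH by simp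
    finally show ?thesis using b a by (auto simp: field_simps)
  qed
  \<comment> \<open>The convolution of \<open>\<psi>\<close> is computed over \<open>G\<close>,
    where it is a multiple of \<open>\<psi>\<close>, and over \<open>H\<close>, where only the
    \<open>e\<close> copies of \<open>\<alpha>\<close> survive. The common factor
    \<open>e * card H\<close> is nonzero and cancels.\<close>
  have ratio: "\<psi> h * \<alpha> \<one> = \<alpha> h * \<psi> \<one>" if h: "h \<in> H" for h
  proof -
    have hG: "h \<in> carrier G" using h subset by auto
    have cf: "cnj (\<alpha> (x \<otimes> g \<otimes> inv x)) = cnj (\<alpha> g)" if "x \<in> carrier G" "g \<in> carrier G" for x g
      using inv[OF that] by simp
    have "(\<Sum>g\<in>H. cnj (\<alpha> g) * \<psi> (g \<otimes> h)) * \<psi> \<one> = (\<Sum>g\<in>H. cnj (\<alpha> g) * \<psi> g) * \<psi> h"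
      using Irr_convolution[OF G \<psi> hG, of "\<lambda>g. cnj (\<alpha> g)", OF cf] by (simp add: sumH)
    also have "(\<Sum>g\<in>H. cnj (\<alpha> g) * \<psi> g) = of_nat (card H) * char_inner H (restrict_char H \<psi>) \<alpha>"
      using cH by (simp add: char_inner_def restrict_char_def mult.commute)
    also have "(\<Sum>g\<in>H. cnj (\<alpha> g) * \<psi> (g \<otimes> h)) = (\<Sum>g\<in>H. \<Sum>\<beta>\<leftarrow>xs. cnj (\<alpha> g) * \<beta> (g \<otimes> h))"
    proof (intro sum.cong refl)
      fix g assume g: "g \<in> H"
      have "\<psi> (g \<otimes> h) = restrict_char H \<psi> (g \<otimes> h)" using g h by (simp add: restrict_char_def)
      then show "cnj (\<alpha> g) * \<psi> (g \<otimes> h) = (\<Sum>\<beta>\<leftarrow>xs. cnj (\<alpha> g) * \<beta> (g \<otimes> h))"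
        by (simp add: xs(2) sum_list_const_mult)
    qed
    also have "\<dots> = (\<Sum>\<beta>\<leftarrow>xs. \<Sum>g\<in>H. cnj (\<alpha> g) * \<beta> (g \<otimes> h))"
      by (induction xs) (simp_all add: sum.distrib)
    also have "\<dots> = (\<Sum>\<beta>\<leftarrow>xs. if \<beta> = \<alpha> then of_nat (card H) * \<alpha> h / \<alpha> \<one> else 0)"
      using xs(1) cross[OF _ h] by (intro arg_cong[of _ _ sum_list] map_cong refl) auto
    also have "\<dots> = of_nat e * (of_nat (card H) * \<alpha> h / \<alpha> \<one>)" by (simp only: sum_list_if_eq e_def)
    finally show ?thesis using e e0 cH a by (simp add: field_simps)
  qed
  \<comment> \<open>Pairing with \<open>\<alpha>\<close> identifies the ratio of the degrees with
    the multiplicity \<open>e\<close>.\<close>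
  have "of_nat e = char_inner H (restrict_char H \<psi>) \<alpha>" using e by simp
  also have "\<dots> = \<psi> \<one> / \<alpha> \<one> * char_inner H \<alpha> \<alpha>"
  proof -
    have "restrict_char H \<psi> h = \<psi> \<one> / \<alpha> \<one> * \<alpha> h" if "h \<in> H" for h
      using ratio[OF that] that a by (simp add: restrict_char_def field_simps)
    then show ?thesis by (simp add: char_inner_def sum_distrib_left mult_ac)
  qed
  also have "char_inner H \<alpha> \<alpha> = 1" using Irr_orthonormal[OF GH _ \<alpha> \<alpha>] finH by simp
  finally have "\<psi> \<one> = of_nat e * \<alpha> \<one>" using a by (simp add: field_simps)
  then have "\<psi> h = of_nat e * \<alpha> h" if "h \<in> H" for h using ratio[OF that] a by simp
  then show ?thesis using that by blast
qed

text \<open>With \<open>\<psi>\<^sub>H = e\<alpha>\<close>: twisting \<open>\<psi>\<close> by the \<open>r\<close> linear characters of \<open>G/H\<close> gives either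
  distinct characters, and then \<open>e\<^sup>2 = 1\<close>, or \<open>\<psi>\<close> vanishes off \<open>H\<close>, and then \<open>e\<^sup>2 = r\<close>.\<close>

lemma Irr_extends_invariant_prime_index:
  fixes G (structure)
  assumes H: "H \<lhd> G" and fin: "finite (carrier G)" and card: "card (carrier G) = r * card H" and r: "Factorial_Ring.prime r"
    and \<alpha>: "\<alpha> \<in> Irr (G\<lparr>carrier := H\<rparr>)" and \<psi>: "\<psi> \<in> Irr G"
    and over: "char_inner H (restrict_char H \<psi>) \<alpha> \<noteq> 0"
    and inertia: "inertia_group G H \<alpha> = carrier G"
  shows "restrict_char H \<psi> = \<alpha>"
proof -
  interpret normal H G by fact
  have G: "group G" by (rule is_group)
  have Hsub: "subgroup H G" ..
  have GH: "group (G\<lparr>carrier := H\<rparr>)" using Hsub G by (rule subgroup.subgroup_is_group)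
  have finH: "finite H" using finite_subset[OF subset fin] .
  have cH: "card H \<noteq> 0" by (rule subgroup_card_nonzero[OF fin Hsub])
  have r0: "r > 1" using prime_gt_1_nat[OF r] .
  obtain e where e: "\<And>h. h \<in> H \<Longrightarrow> \<psi> h = of_nat e * \<alpha> h"
    using restrict_Irr_over_invariant[OF H fin \<alpha> \<psi> over inertia] by blast
  have "char_inner H \<psi> \<psi> = char_inner H (\<lambda>h. of_nat e * \<alpha> h) (\<lambda>h. of_nat e * \<alpha> h)"
    by (intro char_inner_cong e)
  also have "\<dots> = of_nat e ^ 2 * char_inner H \<alpha> \<alpha>"
    by (simp add: char_inner_def sum_distrib_left power2_eq_square mult_ac)
  also have "char_inner H \<alpha> \<alpha> = 1" using Irr_orthonormal[OF GH _ \<alpha> \<alpha>] finH by simp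
  finally have normH: "char_inner H \<psi> \<psi> = of_nat (e ^ 2)" by simp
  obtain l :: "'a \<Rightarrow> complex" where l: "\<And>g h. g \<in> carrier G \<Longrightarrow> h \<in> carrier G \<Longrightarrow> l (g \<otimes> h) = l g * l h"
    "\<And>g. g \<in> H \<Longrightarrow> l g = 1" "\<And>g. g \<in> carrier G \<Longrightarrow> l g ^ r = 1"
    "\<And>g j. g \<in> carrier G \<Longrightarrow> g \<notin> H \<Longrightarrow> 0 < j \<Longrightarrow> j < r \<Longrightarrow> l g ^ j \<noteq> 1"
    by (rule prime_index_linear_character[OF H fin card r]) (rule that)
  have norm: "char_inner (carrier G) \<psi> \<psi> = 1" using Irr_orthonormal[OF G fin \<psi> \<psi>] by simp
  have twist: "(\<lambda>g. l g ^ j * \<psi> g) \<in> Irr G" for j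
    using Irr_twist[OF G \<psi>, of "\<lambda>g. l g ^ j"] l(1,2) subgroup.one_closed[OF Hsub] by (simp add: power_mult_distrib)
  have sumH: "(\<Sum>g\<in>carrier G. if g \<in> H then f g else 0) = (\<Sum>g\<in>H. f g)" for f :: "'a \<Rightarrow> complex"
    using fin subset by (simp add: sum.If_cases Int_absorb1)
  have "e = 1"
  proof (cases "\<exists>j. 0 < j \<and> j < r \<and> (\<lambda>g. l g ^ j * \<psi> g) = \<psi>")
    case True
    then obtain j where j: "0 < j" "j < r" "\<And>g. l g ^ j * \<psi> g = \<psi> g" by metis
    \<comment> \<open>A twist that fixes \<open>\<psi>\<close> multiplies it off \<open>H\<close> by
      a number different from 1.\<close>
    have van: "\<psi> g = 0" if g: "g \<in> carrier G" "g \<notin> H" for g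
      using j(3)[of g] l(4)[OF g j(1,2)] by auto
    have "(\<Sum>g\<in>carrier G. \<psi> g * cnj (\<psi> g)) = (\<Sum>g\<in>H. \<psi> g * cnj (\<psi> g))"
      using fin subset van by (intro sum.mono_neutral_right) auto
    then have "of_nat (card (carrier G)) * char_inner (carrier G) \<psi> \<psi> = of_nat (card H) * char_inner H \<psi> \<psi>"
      using cH r0 by (simp add: char_inner_def card)
    then have "of_nat (r * card H) = (of_nat (card H * e ^ 2) :: complex)" using norm normH card by simp
    then have "r * card H = card H * e ^ 2" by (simp only: of_nat_eq_iff)
    \<comment> \<open>A prime is not a square; the factorisation of \<open>r\<close> yields the goal
      \<open>e = 1\<close> directly.\<close>
    then have "r = e * e" using cH by (simp add: power2_eq_square)
    then show ?thesis using prime_product[of e e] r by auto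
  next
    case False
    have orth: "char_inner (carrier G) (\<lambda>g. l g ^ j * \<psi> g) \<psi> = (if j = 0 then 1 else 0)" if "j < r" for j
    proof (cases "j = 0")
      case True
      then show ?thesis using norm by simp
    next
      case j: False
      then have "(\<lambda>g. l g ^ j * \<psi> g) \<noteq> \<psi>" using False that by auto
      then show ?thesis using j Irr_orthonormal[OF G fin twist \<psi>] by simp
    qed
    \<comment> \<open>The powers of \<open>l\<close> add up to \<open>r\<close> times the indicator
      of \<open>H\<close>. The inner products of all twists with \<open>\<psi>\<close> therefore sum
      to the norm of \<open>\<psi>\<close> over \<open>H\<close>, which is \<open>e ^ 2\<close>,
      while only \<open>j = 0\<close> contributes.\<close>
    have geo: "(\<Sum>j<r. l g ^ j) = (if g \<in> H then of_nat r else 0)" if g: "g \<in> carrier G" for g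
    proof (cases "g \<in> H")
      case False
      have "l g ^ 1 \<noteq> 1" using l(4)[OF g False, of 1] r0 by simp
      then have "(\<Sum>j<r. l g ^ j) = (l g ^ r - 1) / (l g - 1)" by (intro geometric_sum) simp
      then show ?thesis using False l(3)[OF g] by simp
    qed (simp add: l(2))
    have "1 = (\<Sum>j<r. char_inner (carrier G) (\<lambda>g. l g ^ j * \<psi> g) \<psi>)"
      using r0 by (simp add: orth)
    also have "\<dots> = 1 / of_nat (card (carrier G)) * (\<Sum>g\<in>carrier G. \<Sum>j<r. l g ^ j * (\<psi> g * cnj (\<psi> g)))"
      unfolding char_inner_def by (subst sum.swap) (simp add: sum_distrib_left mult.assoc)
    also have "(\<Sum>g\<in>carrier G. \<Sum>j<r. l g ^ j * (\<psi> g * cnj (\<psi> g)))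
       = (\<Sum>g\<in>carrier G. if g \<in> H then of_nat r * (\<psi> g * cnj (\<psi> g)) else 0)"
      by (intro sum.cong refl) (simp add: geo flip: sum_distrib_right)
    also have "\<dots> = (\<Sum>g\<in>H. of_nat r * (\<psi> g * cnj (\<psi> g)))" by (rule sumH)
    also have "1 / of_nat (card (carrier G)) * (\<Sum>g\<in>H. of_nat r * (\<psi> g * cnj (\<psi> g))) = char_inner H \<psi> \<psi>"
      using r0 by (simp add: char_inner_def card flip: sum_distrib_left)
    finally have "of_nat (e ^ 2) = (of_nat 1 :: complex)" using normH by simp
    then have "e ^ 2 = 1" by (simp only: of_nat_eq_iff)
    then show ?thesis by simp
  qed
  then have "restrict_char H \<psi> h = \<alpha> h" for h
    using e[of h] Irr_outside[OF \<alpha>, of h] by (simp add: restrict_char_def)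
  then show ?thesis by blast
qed

subsection \<open>Maximal normal subgroups and inertia groups\<close>

lemma card_index_normal:
  fixes G (structure)
  assumes "N \<lhd> G"
  shows "card (carrier G) = Coset.order (G Mod N) * card N"
proof -
  interpret normal N G by fact
  have "subgroup N G" ..
  from lagrange[OF this] show ?thesis by (simp add: Coset.order_def FactGroup_def)
qed

text \<open>The preimage \<open>K\<close> of \<open>S\<close> in \<open>G\<close> is normal and
  contains \<open>N\<close>, so maximality leaves only \<open>N\<close> and the whole group.\<close>

lemma quotient_maximal_normal_simple:
  fixes G (structure)
  assumes max: "maximal_normal G N" and S: "S \<lhd> G Mod N"
  shows "S = {\<one>\<^bsub>G Mod N\<^esub>} \<or> S = carrier (G Mod N)"
proof -
  have N: "N \<lhd> G" using max by (simp add: maximal_normal_def)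
  interpret normal N G by fact
  have G: "group G" by (rule is_group)
  let ?Q = "G Mod N"
  interpret Q: group ?Q by (rule factorgroup_is_group)
  interpret S: normal S ?Q by fact
  have Ssub: "subgroup S ?Q" ..
  have Nsub: "subgroup N G" ..
  have hom: "N #> (x \<otimes> y) = (N #> x) \<otimes>\<^bsub>?Q\<^esub> (N #> y)" if "x \<in> carrier G" "y \<in> carrier G" for x y
    using rcos_sum[OF that] by simp
  have inv_hom: "N #> inv x = inv\<^bsub>?Q\<^esub> (N #> x)" if "x \<in> carrier G" for x
    using that inv_FactGroup[of "N #> x"] rcos_inv[OF that] by (simp add: carrier_FactGroup)
  have coset: "N #> x \<in> carrier ?Q" if "x \<in> carrier G" for x using that by (simp add: carrier_FactGroup)
  define K where "K = {g \<in> carrier G. N #> g \<in> S}"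
  have "K \<lhd> G"
  proof (rule normal_invI)
    show "subgroup K G"
    proof (rule subgroupI)
      have "\<one> \<in> K" using subgroup.one_closed[OF Ssub] rcos_const[OF G subgroup.one_closed[OF Nsub]] by (simp add: K_def)
      then show "K \<noteq> {}" by blast
      show "K \<subseteq> carrier G" by (auto simp: K_def)
      fix a assume "a \<in> K"
      then show "inv a \<in> K" using subgroup.m_inv_closed[OF Ssub] by (simp add: K_def inv_hom)
    next
      fix a b assume "a \<in> K" "b \<in> K"
      then show "a \<otimes> b \<in> K" using subgroup.m_closed[OF Ssub] hom[of a b] by (simp add: K_def)
    qed
  next
    fix x h assume x: "x \<in> carrier G" and h: "h \<in> K"
    then have "N #> (x \<otimes> h \<otimes> inv x) = (N #> x) \<otimes>\<^bsub>?Q\<^esub> (N #> h) \<otimes>\<^bsub>?Q\<^esub> inv\<^bsub>?Q\<^esub> (N #> x)"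
      using hom[of "x \<otimes> h" "inv x"] hom[of x h] by (simp add: K_def inv_hom)
    also have "\<dots> \<in> S" using S.inv_op_closed2[OF coset[OF x]] h by (simp add: K_def)
    finally show "x \<otimes> h \<otimes> inv x \<in> K" using x h by (simp add: K_def)
  qed
  moreover have "N \<subseteq> K"
    using subset subgroup.one_closed[OF Ssub] rcos_const[OF G] by (auto simp: K_def)
  ultimately have "K = carrier G \<or> K = N" using max by (auto simp: maximal_normal_def)
  then show ?thesis
  proof
    assume K: "K = carrier G"
    have "carrier ?Q \<subseteq> S"
    proof
      fix C assume "C \<in> carrier ?Q"
      then obtain g where g: "g \<in> carrier G" "C = N #> g" by (auto simp: carrier_FactGroup)
      then have "g \<in> K" by (simp add: K)
      then show "C \<in> S" using g by (simp add: K_def)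
    qed
    then show ?thesis using subgroup.subset[OF Ssub] by blast
  next
    assume K: "K = N"
    have S: "C = N" if C: "C \<in> S" for C
    proof -
      have "C \<in> carrier ?Q" using C subgroup.subset[OF Ssub] by blast
      then obtain g where g: "g \<in> carrier G" "C = N #> g" by (auto simp: carrier_FactGroup)
      then have "g \<in> K" using C by (simp add: K_def)
      then have "g \<in> N" by (simp add: K)
      then show ?thesis using g rcos_const[OF G] by simp
    qed
    have "N \<in> S" using subgroup.one_closed[OF Ssub] by simp
    then have "S = {N}" using S by blast
    then show ?thesis by simp
  qed
qed

text \<open>The quotient is simple and solvable. Its derived subgroup is proper, hence trivial, so
  the quotient is abelian; a subgroup of prime order is then normal and must be everything.\<close>

lemma maximal_normal_prime_index:
  fixes G (structure)
  assumes G: "group G" and fin: "finite (carrier G)" and solv: "solvable G" and max: "maximal_normal G N"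
  shows "Factorial_Ring.prime (Coset.order (G Mod N))"
proof -
  have N: "N \<lhd> G" using max by (simp add: maximal_normal_def)
  interpret normal N G by fact
  have Nsub: "subgroup N G" ..
  define Q where "Q = G Mod N"
  interpret Q: group Q unfolding Q_def by (rule factorgroup_is_group)
  note simple = quotient_maximal_normal_simple[OF max, folded Q_def]
  have finQ: "finite (carrier Q)" using fin by (simp add: Q_def carrier_FactGroup)
  have nontriv: "carrier Q \<noteq> {\<one>\<^bsub>Q\<^esub>}"
  proof
    assume "carrier Q = {\<one>\<^bsub>Q\<^esub>}"
    then have "N #> g = N" if "g \<in> carrier G" for g using that by (auto simp: Q_def carrier_FactGroup)
    then have "carrier G \<subseteq> N" using rcos_self[OF _ Nsub] by blast
    then show False using max subset by (auto simp: maximal_normal_def)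
  qed
  have "group_hom G Q (\<lambda>g. N #> g)"
    using r_coset_hom_Mod by (simp add: group_hom_def group_hom_axioms_def Q_def G factorgroup_is_group)
  moreover have "(\<lambda>g. N #> g) ` carrier G = carrier Q" by (simp add: Q_def carrier_FactGroup)
  ultimately have "solvable Q" by (rule group_hom.surj_hom_imp_solvable[OF _ _ solv])
  then obtain n where n: "(derived Q ^^ n) (carrier Q) = {\<one>\<^bsub>Q\<^esub>}" using Q.solvable_iff_trivial_derived_seq by blast
  have "derived Q (carrier Q) \<noteq> carrier Q"
  proof
    assume "derived Q (carrier Q) = carrier Q"
    then have "(derived Q ^^ n) (carrier Q) = carrier Q" by (induction n) simp_all
    then show False using n nontriv by simp
  qed
  then have der: "derived Q (carrier Q) = {\<one>\<^bsub>Q\<^esub>}"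
    using simple[OF Q.derived_is_normal[OF Q.normal_self]] by blast
  have comm: "comm_group Q"
  proof (rule Q.group_comm_groupI)
    fix x y assume xy: "x \<in> carrier Q" "y \<in> carrier Q"
    have "x \<otimes>\<^bsub>Q\<^esub> y \<otimes>\<^bsub>Q\<^esub> inv\<^bsub>Q\<^esub> x \<otimes>\<^bsub>Q\<^esub> inv\<^bsub>Q\<^esub> y \<in> derived Q (carrier Q)"
      unfolding derived_def using xy by (intro generate.incl) blast
    then have "x \<otimes>\<^bsub>Q\<^esub> y \<otimes>\<^bsub>Q\<^esub> (inv\<^bsub>Q\<^esub> x \<otimes>\<^bsub>Q\<^esub> inv\<^bsub>Q\<^esub> y) = \<one>\<^bsub>Q\<^esub>" using xy by (simp add: der Q.m_assoc)
    moreover have "inv\<^bsub>Q\<^esub> x \<otimes>\<^bsub>Q\<^esub> inv\<^bsub>Q\<^esub> y = inv\<^bsub>Q\<^esub> (y \<otimes>\<^bsub>Q\<^esub> x)" using xy by (simp add: Q.inv_mult_group)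
    ultimately show "x \<otimes>\<^bsub>Q\<^esub> y = y \<otimes>\<^bsub>Q\<^esub> x"
      using xy by (metis Q.inv_inv Q.inv_equality Q.m_closed Q.inv_closed)
  qed
  have "card (carrier Q) \<noteq> 1"
  proof
    assume "card (carrier Q) = 1"
    then obtain a where "carrier Q = {a}" using card_1_singletonE by blast
    then show False using nontriv Q.one_closed by auto
  qed
  then obtain p where p: "Factorial_Ring.prime p" "p dvd card (carrier Q)" using prime_factor_nat by blast
  then obtain m where "card (carrier Q) = p * m" by blast
  \<comment> \<open>Sylow's theorem with exponent 1 plays the role of Cauchy's theorem;
    \<open>p\<close> may still divide the cofactor \<open>m\<close>.\<close>
  then obtain S where S: "subgroup S Q" "card S = p"
    using sylow_thm[OF p(1) Q.is_group, of 1 m] finQ by (auto simp: Coset.order_def)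
  have "S \<noteq> {\<one>\<^bsub>Q\<^esub>}" using S(2) p(1) not_prime_1 by auto
  then have "S = carrier Q" using simple[OF comm_group.subgroup_imp_normal[OF comm S(1)]] by blast
  then show ?thesis using S(2) p(1) by (simp add: Q_def Coset.order_def)
qed

text \<open>Lagrange's theorem, applied twice, factors the prime \<open>r\<close> into the indices
  of \<open>K\<close> in \<open>G\<close> and of \<open>H\<close> in \<open>K\<close>.\<close>

lemma intermediate_subgroup_prime_index:
  fixes G (structure)
  assumes G: "group G" and fin: "finite (carrier G)" and H: "subgroup H G" and K: "subgroup K G" and HK: "H \<subseteq> K"
    and card: "card (carrier G) = r * card H" and r: "Factorial_Ring.prime r"
  shows "K = H \<or> K = carrier G"
proof -
  interpret group G by fact
  have GK: "group (G\<lparr>carrier := K\<rparr>)" using K G by (rule subgroup.subgroup_is_group)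
  have KG: "K \<subseteq> carrier G" using subgroup.subset[OF K] .
  have finK: "finite K" using finite_subset[OF KG fin] .
  have HsubK: "subgroup H (G\<lparr>carrier := K\<rparr>)" using subgroup_incl[OF H K HK] .
  have "card (rcosets\<^bsub>G\<lparr>carrier := K\<rparr>\<^esub> H) * card H = card K"
    using group.lagrange[OF GK HsubK] by (simp add: Coset.order_def)
  then obtain s where s: "card K = s * card H" by metis
  have "card (rcosets K) * card K = card (carrier G)" using lagrange[OF K] by (simp add: Coset.order_def)
  then obtain t where t: "card (carrier G) = t * card K" by metis
  have "r = t * s" using s t card subgroup_card_nonzero[OF fin H] by simp
  then have "t = 1 \<or> s = 1" using prime_product[of t s] r by simp
  then show ?thesis
  proof
    assume "t = 1" then show ?thesis using t card_subset_eq[OF fin KG] by simp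
  next
    assume "s = 1" then show ?thesis using s card_subset_eq[OF finK HK] by simp
  qed
qed

text \<open>The product of the two subgroups is normal and contains both; were it proper, maximality
  would make it equal to each. So it is \<open>G\<close>, and the second isomorphism theorem
  identifies \<open>N1\<close> modulo the intersection with \<open>G Mod N2\<close>.\<close>

lemma distinct_maximal_normal_index:
  fixes G (structure)
  assumes fin: "finite (carrier G)" and max1: "maximal_normal G N1" and max2: "maximal_normal G N2" and ne: "N1 \<noteq> N2"
  shows "card N1 = Coset.order (G Mod N2) * card (N1 \<inter> N2)"
proof -
  have N1: "N1 \<lhd> G" and N2: "N2 \<lhd> G" using max1 max2 by (simp_all add: maximal_normal_def)
  interpret N1: normal N1 G by fact
  interpret N2: normal N2 G by fact
  have sub1: "subgroup N1 G" ..
  have snd: "second_isomorphism_grp N2 G N1"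
    by (intro second_isomorphism_grp.intro N2 second_isomorphism_grp_axioms.intro sub1)
  have "N2 <#> N1 \<lhd> G" using N1.normal_subgroup_set_mult_closed[OF N2 N1] .
  moreover have "N2 \<subseteq> N2 <#> N1" "N1 \<subseteq> N2 <#> N1"
    using second_isomorphism_grp.H_contained_in_set_mult[OF snd] second_isomorphism_grp.S_contained_in_set_mult[OF snd] by auto
  ultimately have eq: "N2 <#> N1 = carrier G"
    using max1 max2 ne unfolding maximal_normal_def by blast
  have "card (carrier ((G\<lparr>carrier := N1\<rparr>) Mod (N2 \<inter> N1))) = card (carrier (G Mod N2))"
    using second_isomorphism_grp.normal_intersection_quotient_isom[OF snd] eq
    by (auto simp: iso_def dest!: bij_betw_same_card)
  moreover have "N1 \<inter> N2 \<lhd> G\<lparr>carrier := N1\<rparr>"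
    using second_isomorphism_grp.normal_subgrp_intersection_normal[OF snd] .
  ultimately show ?thesis
    using card_index_normal[of "N1 \<inter> N2" "G\<lparr>carrier := N1\<rparr>"] by (simp add: Coset.order_def Int_commute)
qed

lemma inertia_group_subgroup:
  fixes G (structure)
  assumes H: "H \<lhd> G" and \<alpha>: "\<alpha> \<in> Irr (G\<lparr>carrier := H\<rparr>)"
  shows "subgroup (inertia_group G H \<alpha>) G" "H \<subseteq> inertia_group G H \<alpha>"
proof -
  interpret normal H G by fact
  have G: "group G" by (rule is_group)
  have Hsub: "subgroup H G" ..
  have GH: "group (G\<lparr>carrier := H\<rparr>)" using Hsub G by (rule subgroup.subgroup_is_group)
  have out: "\<alpha> g = 0" if "g \<notin> H" for g using Irr_outside[OF \<alpha>, of g] that by simp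
  \<comment> \<open>Equality of the two functions is tested on \<open>H\<close> alone, as both
    vanish elsewhere.\<close>
  have iff: "x \<in> inertia_group G H \<alpha> \<longleftrightarrow> x \<in> carrier G \<and> (\<forall>h\<in>H. \<alpha> (x \<otimes> h \<otimes> inv x) = \<alpha> h)" for x
    using out by (auto simp: inertia_group_def conj_char_def restrict_char_def fun_eq_iff)
  show HI: "H \<subseteq> inertia_group G H \<alpha>"
  proof
    fix x assume x: "x \<in> H"
    have "\<alpha> (x \<otimes> h \<otimes> inv x) = \<alpha> h" if "h \<in> H" for h
      using Irr_class_function[OF GH \<alpha>, of x h] x that m_inv_consistent[OF Hsub x] by simp
    then show "x \<in> inertia_group G H \<alpha>" using x subset by (auto simp: iff)
  qed
  show "subgroup (inertia_group G H \<alpha>) G"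
  proof (rule subgroupI)
    show "inertia_group G H \<alpha> \<subseteq> carrier G" by (auto simp: inertia_group_def)
    show "inertia_group G H \<alpha> \<noteq> {}" using HI subgroup.one_closed[OF Hsub] by blast
  next
    fix x assume "x \<in> inertia_group G H \<alpha>"
    then have x: "x \<in> carrier G" "\<And>h. h \<in> H \<Longrightarrow> \<alpha> (x \<otimes> h \<otimes> inv x) = \<alpha> h" by (auto simp: iff)
    have "\<alpha> (inv x \<otimes> h \<otimes> inv (inv x)) = \<alpha> h" if h: "h \<in> H" for h
    proof -
      have hG: "h \<in> carrier G" using h subset by auto
      have "inv x \<otimes> h \<otimes> x \<in> H" using inv_op_closed1[OF x(1) h] .
      then have "\<alpha> (x \<otimes> (inv x \<otimes> h \<otimes> x) \<otimes> inv x) = \<alpha> (inv x \<otimes> h \<otimes> x)" by (rule x(2))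
      moreover have "x \<otimes> (inv x \<otimes> h \<otimes> x) \<otimes> inv x = h"
      proof -
        have "x \<otimes> (inv x \<otimes> h) = h" using x(1) hG by (simp flip: m_assoc)
        then show ?thesis using x(1) hG by (simp add: m_assoc)
      qed
      ultimately show ?thesis using x(1) by simp
    qed
    then show "inv x \<in> inertia_group G H \<alpha>" using x(1) by (simp add: iff)
  next
    fix x y assume "x \<in> inertia_group G H \<alpha>" "y \<in> inertia_group G H \<alpha>"
    then have x: "x \<in> carrier G" "\<And>h. h \<in> H \<Longrightarrow> \<alpha> (x \<otimes> h \<otimes> inv x) = \<alpha> h"
      and y: "y \<in> carrier G" "\<And>h. h \<in> H \<Longrightarrow> \<alpha> (y \<otimes> h \<otimes> inv y) = \<alpha> h" by (auto simp: iff)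
    have "\<alpha> (x \<otimes> y \<otimes> h \<otimes> inv (x \<otimes> y)) = \<alpha> h" if h: "h \<in> H" for h
    proof -
      have "h \<in> carrier G" using h subset by auto
      then have "x \<otimes> y \<otimes> h \<otimes> inv (x \<otimes> y) = x \<otimes> (y \<otimes> h \<otimes> inv y) \<otimes> inv x"
        using x(1) y(1) by (simp add: m_assoc inv_mult_group)
      then show ?thesis using x(2)[OF inv_op_closed2[OF y(1) h]] y(2)[OF h] by simp
    qed
    then show "x \<otimes> y \<in> inertia_group G H \<alpha>" using x(1) y(1) by (simp add: iff)
  qed
qed

lemma inertia_group_restrict:
  fixes G (structure)
  assumes "group G" "subgroup N G"
  shows "inertia_group (G\<lparr>carrier := N\<rparr>) H \<alpha> = inertia_group G H \<alpha> \<inter> N"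
proof -
  interpret group G by fact
  have "conj_char (G\<lparr>carrier := N\<rparr>) H x \<alpha> = conj_char G H x \<alpha>" if "x \<in> N" for x
    using m_inv_consistent[OF assms(2) that] by (simp add: conj_char_def)
  then show ?thesis using subgroup.subset[OF assms(2)] by (auto simp: inertia_group_def)
qed

text \<open>Inside \<open>N\<close> the inertia group is either \<open>H\<close> or
  \<open>N\<close>, since the index is prime, and the two preceding Clifford lemmas apply. The
  result speaks of the inertia group in \<open>G\<close>, so that its instances for
  \<open>N1\<close> and \<open>N2\<close> concern the same subgroup.\<close>

lemma Irr_over_dichotomy:
  fixes G (structure)
  assumes H: "H \<lhd> G" and fin: "finite (carrier G)" and N: "subgroup N G" and HN: "H \<subseteq> N"
    and card: "card N = r * card H" and r: "Factorial_Ring.prime r"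
    and \<alpha>: "\<alpha> \<in> Irr (G\<lparr>carrier := H\<rparr>)" and \<psi>: "\<psi> \<in> Irr (G\<lparr>carrier := N\<rparr>)"
    and over: "char_inner H (restrict_char H \<psi>) \<alpha> \<noteq> 0"
  shows "inertia_group G H \<alpha> \<inter> N = H \<and> induced_char (G\<lparr>carrier := N\<rparr>) H \<alpha> = \<psi> \<or>
    N \<subseteq> inertia_group G H \<alpha> \<and> restrict_char H \<psi> = \<alpha>"
proof -
  interpret normal H G by fact
  have G: "group G" by (rule is_group)
  have Hsub: "subgroup H G" ..
  let ?N = "G\<lparr>carrier := N\<rparr>"
  have GN: "group ?N" using N G by (rule subgroup.subgroup_is_group)
  have finN: "finite (carrier ?N)" using finite_subset[OF subgroup.subset[OF N] fin] by simp
  have HN': "H \<lhd> ?N" using normal_restrict_supergroup[OF N H HN] .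
  have \<alpha>': "\<alpha> \<in> Irr (?N\<lparr>carrier := H\<rparr>)" using \<alpha> by simp
  have cardN: "card (carrier ?N) = r * card H" using card by simp
  note I = inertia_group_restrict[OF G N, of H \<alpha>]
  have "inertia_group ?N H \<alpha> = H \<or> inertia_group ?N H \<alpha> = carrier ?N"
    using intermediate_subgroup_prime_index[OF GN finN _ inertia_group_subgroup[OF HN' \<alpha>'] cardN r]
      subgroup_incl[OF Hsub N HN] by blast
  then show ?thesis
  proof
    assume i: "inertia_group ?N H \<alpha> = H"
    show ?thesis using Irr_induced_of_trivial_inertia[OF HN' finN \<alpha>' \<psi> over i] i I by simp
  next
    assume i: "inertia_group ?N H \<alpha> = carrier ?N"
    then have "N \<subseteq> inertia_group G H \<alpha>" using I by auto
    then show ?thesis using Irr_extends_invariant_prime_index[OF HN' finN cardN r \<alpha>' \<psi> over i] by simp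
  qed
qed

section \<open>Existence of irreducible characters above and between given ones\<close>

lemma sum_list_nonzeroE:
  assumes "(\<Sum>x\<leftarrow>xs. f x) \<noteq> (0 :: complex)"
  obtains x where "x \<in> set xs" "f x \<noteq> 0"
  using assms by (metis sum_list_0 map_cong)

text \<open>On \<open>H\<close> the regular character of \<open>G\<close> has the nonzero inner
  product \<open>card (carrier G) * \<alpha> \<one> / card H\<close> with \<open>\<alpha>\<close>,
  so one of its constituents lies over \<open>\<alpha>\<close>.\<close>

lemma Irr_over_exists:
  fixes G (structure)
  assumes G: "group G" and fin: "finite (carrier G)" and H: "subgroup H G" and \<alpha>: "\<alpha> \<in> Irr (G\<lparr>carrier := H\<rparr>)"
  obtains \<chi> where "\<chi> \<in> Irr G" "char_inner H (restrict_char H \<chi>) \<alpha> \<noteq> 0"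
proof -
  interpret group G by fact
  have GH: "group (G\<lparr>carrier := H\<rparr>)" using H G by (rule subgroup.subgroup_is_group)
  have finH: "finite H" using finite_subset[OF subgroup.subset[OF H] fin] .
  obtain xs where xs: "set xs \<subseteq> Irr G" "\<And>g. (\<Sum>\<chi>\<leftarrow>xs. \<chi> g) = (if g = \<one> then of_nat (card (carrier G)) else 0)"
    using regular_character_decompose[OF G fin] by blast
  obtain a where a: "a \<noteq> 0" "\<alpha> \<one> = of_nat a" using Irr_degree[OF GH \<alpha>] by auto
  have "(\<Sum>h\<in>H. (\<Sum>\<chi>\<leftarrow>xs. \<chi> h) * cnj (\<alpha> h)) = (\<Sum>h\<in>H. if h = \<one> then of_nat (card (carrier G)) * cnj (\<alpha> h) else 0)"
    by (intro sum.cong) (auto simp: xs(2))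
  also have "\<dots> = of_nat (card (carrier G)) * of_nat a"
    using finH subgroup.one_closed[OF H] a by simp
  finally have "char_inner H (\<lambda>g. \<Sum>\<chi>\<leftarrow>xs. \<chi> g) \<alpha> \<noteq> 0"
    using a subgroup_card_nonzero[OF fin H] subgroup_card_nonzero[OF fin subgroup_self] by (simp add: char_inner_def)
  then obtain \<chi> where "\<chi> \<in> set xs" "char_inner H \<chi> \<alpha> \<noteq> 0"
    unfolding char_inner_sum_list by (rule sum_list_nonzeroE)
  moreover have "char_inner H (restrict_char H \<chi>) \<alpha> = char_inner H \<chi> \<alpha>"
    by (intro char_inner_cong) (auto simp: restrict_char_def)
  ultimately show ?thesis using that xs(1) by auto
qed

text \<open>The inner product with \<open>\<alpha>\<close> is additive over the constituents of
  \<open>\<chi>\<close> on \<open>K\<close>; one of them must contribute. Both links, from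
  \<open>\<gamma>\<close> up to \<open>\<chi>\<close> and down to \<open>\<alpha>\<close>, hold for
  the same \<open>\<gamma>\<close>.\<close>

lemma Irr_between_exists:
  fixes G (structure)
  assumes G: "group G" and fin: "finite (carrier G)" and K: "subgroup K G" and HK: "H \<subseteq> K"
    and \<chi>: "\<chi> \<in> Irr G" and over: "char_inner H (restrict_char H \<chi>) \<alpha> \<noteq> 0"
  obtains \<gamma> where "\<gamma> \<in> Irr (G\<lparr>carrier := K\<rparr>)" "char_inner K (restrict_char K \<chi>) \<gamma> \<noteq> 0" "char_inner H (restrict_char H \<gamma>) \<alpha> \<noteq> 0"
proof -
  have GK: "group (G\<lparr>carrier := K\<rparr>)" using K G by (rule subgroup.subgroup_is_group)
  have finK: "finite K" using finite_subset[OF subgroup.subset[OF K] fin] .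
  obtain xs where xs: "set xs \<subseteq> Irr (G\<lparr>carrier := K\<rparr>)" "\<And>g. restrict_char K \<chi> g = (\<Sum>\<xi>\<leftarrow>xs. \<xi> g)"
    using restrict_Irr_decompose[OF G K \<chi>] by blast
  have xs_eq: "restrict_char K \<chi> = (\<lambda>g. \<Sum>\<xi>\<leftarrow>xs. \<xi> g)" using xs(2) by blast
  have "char_inner H (restrict_char H \<chi>) \<alpha> = char_inner H (restrict_char K \<chi>) \<alpha>"
    using HK by (intro char_inner_cong) (auto simp: restrict_char_def)
  then have "(\<Sum>\<xi>\<leftarrow>xs. char_inner H \<xi> \<alpha>) \<noteq> 0" using over by (simp add: xs_eq char_inner_sum_list)
  then obtain \<gamma> where \<gamma>: "\<gamma> \<in> set xs" "char_inner H \<gamma> \<alpha> \<noteq> 0" by (rule sum_list_nonzeroE)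
  have \<gamma>Irr: "\<gamma> \<in> Irr (G\<lparr>carrier := K\<rparr>)" using \<gamma>(1) xs(1) by blast
  have "char_inner K (restrict_char K \<chi>) \<gamma> = of_nat (count_list xs \<gamma>)"
    using char_inner_Irr_list[OF GK _ xs(1) \<gamma>Irr] finK by (simp add: xs_eq)
  then have "char_inner K (restrict_char K \<chi>) \<gamma> \<noteq> 0" using \<gamma>(1) by (simp add: count_list_0_iff)
  moreover have "char_inner H (restrict_char H \<gamma>) \<alpha> = char_inner H \<gamma> \<alpha>"
    by (intro char_inner_cong) (auto simp: restrict_char_def)
  ultimately show ?thesis using that \<gamma>Irr \<gamma>(2) by simp
qed

text \<open>For \<open>g\<close> outside \<open>N\<close> all of
  \<open>\<chi> (m \<otimes> g)\<close> equal \<open>\<chi> g\<close>. Convolution with the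
  indicator of \<open>M\<close> then shows that, if \<open>\<chi> g\<close> is nonzero, the sum
  \<open>S\<close> of \<open>\<chi>\<close> over \<open>M\<close> is
  \<open>card M * \<chi> \<one>\<close>, so nonzero; the same convolution at points of
  \<open>M\<close> makes \<open>\<chi>\<close> constant there, contrary to
  \<open>ker\<close>.\<close>

lemma camina_triple_Irr_vanishes:
  fixes G (structure)
  assumes cam: "camina_triple G N M" and fin: "finite (carrier G)" and \<chi>: "\<chi> \<in> Irr G"
    and ker: "\<not> M \<subseteq> char_kernel G \<chi>" and g: "g \<in> carrier G" "g \<notin> N"
  shows "\<chi> g = 0"
proof (rule ccontr)
  assume nz: "\<chi> g \<noteq> 0"
  have G: "group G" and M: "M \<lhd> G"
    and conj: "\<And>y. y \<in> g <# M \<Longrightarrow> \<exists>x\<in>carrier G. y = inv x \<otimes> g \<otimes> x"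
    using cam g unfolding camina_triple_def by auto
  interpret normal M G by fact
  have Msub: "subgroup M G" ..
  have GM: "group (G\<lparr>carrier := M\<rparr>)" using Msub G by (rule subgroup.subgroup_is_group)
  have cM: "card M \<noteq> 0" by (rule subgroup_card_nonzero[OF fin Msub])
  obtain d where d: "d \<noteq> 0" "\<chi> \<one> = of_nat d" using Irr_degree[OF G \<chi>] .
  define S where "S = (\<Sum>m\<in>M. \<chi> m)"
  define f :: "_ \<Rightarrow> complex" where "f k = (if k \<in> M then 1 else 0)" for k
  have f: "f (x \<otimes> k \<otimes> inv x) = f k" if x: "x \<in> carrier G" and k: "k \<in> carrier G" for x k
  proof -
    have "x \<otimes> k \<otimes> inv x \<in> M \<Longrightarrow> k \<in> M"
    proof -
      assume "x \<otimes> k \<otimes> inv x \<in> M"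
      then have "inv x \<otimes> (x \<otimes> k \<otimes> inv x) \<otimes> x \<in> M" using inv_op_closed1[OF x] by simp
      moreover have "inv x \<otimes> (x \<otimes> k \<otimes> inv x) \<otimes> x = k"
      proof -
        have "inv x \<otimes> (x \<otimes> k) = k" using x k by (simp flip: m_assoc)
        then show ?thesis using x k by (simp add: m_assoc)
      qed
      ultimately show "k \<in> M" by simp
    qed
    then show ?thesis using inv_op_closed2[OF x] by (auto simp: f_def)
  qed
  have sumM: "(\<Sum>k\<in>carrier G. f k * F k) = (\<Sum>m\<in>M. F m)" for F
    using fin subset by (intro sum.mono_neutral_cong_right) (auto simp: f_def)
  have conv: "(\<Sum>m\<in>M. \<chi> (m \<otimes> h)) * \<chi> \<one> = S * \<chi> h" if "h \<in> carrier G" for h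
    using Irr_convolution[OF G \<chi> that, of f] f by (simp add: sumM S_def)
  have "\<chi> (m \<otimes> g) = \<chi> g" if m: "m \<in> M" for m
  proof -
    have mG: "m \<in> carrier G" using m subset by auto
    \<comment> \<open>Normality of \<open>M\<close> turns the right translate into an element of the
      left coset that the Camina condition speaks of.\<close>
    have "g \<otimes> (inv g \<otimes> m \<otimes> g) = m \<otimes> g" using mG g(1) by (simp flip: m_assoc)
    then have "m \<otimes> g \<in> g <# M" using inv_op_closed1[OF g(1) m] by (auto simp: l_coset_def intro!: bexI[of _ "inv g \<otimes> m \<otimes> g"])
    then obtain x where x: "x \<in> carrier G" "m \<otimes> g = inv x \<otimes> g \<otimes> x" using conj by blast
    then show ?thesis using Irr_class_function[OF G \<chi>, of "inv x" g] g(1) by simp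
  qed
  then have "of_nat (card M) * \<chi> g * \<chi> \<one> = S * \<chi> g" using conv[OF g(1)] by simp
  then have S: "S = of_nat (card M) * \<chi> \<one>" using nz by simp
  have "\<chi> m = \<chi> \<one>" if m: "m \<in> M" for m
  proof -
    \<comment> \<open>Translation by \<open>m\<close> permutes \<open>M\<close>, so the sum is
      \<open>S\<close> again.\<close>
    have "(\<Sum>k\<in>M. \<chi> (k \<otimes> m)) = S"
      using sum.reindex_bij_betw[OF bij_betw_mult_right[OF GM, of m], of \<chi>] m by (simp add: S_def)
    then have "S * \<chi> \<one> = S * \<chi> m" using conv[of m] m subset by auto
    moreover have "S \<noteq> 0" using S cM d by simp
    ultimately show ?thesis by simp
  qed
  then have "M \<subseteq> char_kernel G \<chi>" unfolding char_kernel_def using subset by blast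
  then show False using ker by simp
qed

text \<open>In (a), \<open>\<psi>\<close> is required to lie in \<open>Irr_relative\<close> when
  \<open>\<alpha>\<close> is invariant under \<open>G\<close>: in that case the Camina condition has
  to make the character induced from \<open>\<psi>\<close> irreducible. Otherwise
  \<open>\<psi>\<close> and \<open>\<gamma>\<close> are both induced from \<open>\<alpha>\<close>,
  and transitivity of induction suffices.\<close>

theorem theorem1p2:
  fixes G :: "('a, 'b) monoid_scheme" and N1 N2 M1 H :: "'a set"
  assumes "group G" and "finite (carrier G)" and "solvable G"
    and "maximal_normal G N1" and "N1 \<noteq> {\<one>\<^bsub>G\<^esub>}"
    and "maximal_normal G N2" and "N2 \<noteq> {\<one>\<^bsub>G\<^esub>}"
    and "N1 \<noteq> N2"
    and "H = N1 \<inter> N2"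
    and "camina_triple G N1 M1"
  shows
    "(\<forall>\<psi> \<alpha>.
        \<psi> \<in> Irr (G\<lparr>carrier := N1\<rparr>) \<and> \<alpha> \<in> Irr_constituents G H \<psi> \<and>
        inertia_condition G N1 N2 \<alpha> \<and>
        (inertia_group G H \<alpha> = carrier G \<longrightarrow> \<psi> \<in> Irr_relative (G\<lparr>carrier := N1\<rparr>) M1)
        \<longrightarrow> (\<exists>\<gamma> \<in> Irr (G\<lparr>carrier := N2\<rparr>). induced_char G N2 \<gamma> = induced_char G N1 \<psi>))
     \<and>
     (\<forall>\<psi> \<gamma> \<alpha>.
        \<psi> \<in> Irr_relative (G\<lparr>carrier := N1\<rparr>) M1 \<and> \<gamma> \<in> Irr (G\<lparr>carrier := N2\<rparr>) \<and>
        induced_char G N2 \<gamma> = induced_char G N1 \<psi> \<and>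
        \<alpha> \<in> Irr_constituents G H \<psi> \<inter> Irr_constituents G H \<gamma>
        \<longrightarrow> inertia_condition G N1 N2 \<alpha>)"
proof -
  note G = assms(1) and fin = assms(2) and max1 = assms(4) and max2 = assms(6)
  interpret group G by fact
  have N1: "N1 \<lhd> G" and N2: "N2 \<lhd> G" using max1 max2 by (simp_all add: maximal_normal_def)
  have sub1: "subgroup N1 G" and sub2: "subgroup N2 G" using N1 N2 by (simp_all add: normal_imp_subgroup)
  have HG: "H \<lhd> G" unfolding assms(9) by (rule normal_subgroup_intersect[OF N1 N2])
  have subH: "subgroup H G" by (rule normal_imp_subgroup[OF HG])
  note oneH = subgroup.one_closed[OF subH]
  have HN1: "H \<subseteq> N1" and HN2: "H \<subseteq> N2" using assms(9) by auto
  interpret H: normal H G by (rule HG)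
  interpret N1: normal N1 G by (rule N1)
  interpret N2: normal N2 G by (rule N2)
  have gN1: "group (G\<lparr>carrier := N1\<rparr>)" using sub1 G by (rule subgroup.subgroup_is_group)
  have gN2: "group (G\<lparr>carrier := N2\<rparr>)" using sub2 G by (rule subgroup.subgroup_is_group)
  have gH: "group (G\<lparr>carrier := H\<rparr>)" using subH G by (rule subgroup.subgroup_is_group)
  define p where "p = Coset.order (G Mod N1)"
  define q where "q = Coset.order (G Mod N2)"
  have p: "Factorial_Ring.prime p" unfolding p_def by (rule maximal_normal_prime_index[OF G fin assms(3) max1])
  have q: "Factorial_Ring.prime q" unfolding q_def by (rule maximal_normal_prime_index[OF G fin assms(3) max2])
  have p1: "p > 1" and q1: "q > 1" using prime_gt_1_nat p q by auto
  have cG1: "card (carrier G) = p * card N1" unfolding p_def by (rule card_index_normal[OF N1])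
  have cG2: "card (carrier G) = q * card N2" unfolding q_def by (rule card_index_normal[OF N2])
  have cN1: "card N1 = q * card H" unfolding q_def assms(9)
    by (rule distinct_maximal_normal_index[OF fin max1 max2 assms(8)])
  have cN2: "card N2 = p * card H" unfolding p_def assms(9) Int_commute[of N1]
    by (rule distinct_maximal_normal_index[OF fin max2 max1 assms(8)[symmetric]])
  have cardH0: "card H \<noteq> 0" and card10: "card N1 \<noteq> 0" and card20: "card N2 \<noteq> 0"
    by (rule subgroup_card_nonzero[OF fin subH], rule subgroup_card_nonzero[OF fin sub1], rule subgroup_card_nonzero[OF fin sub2])
  have cond_iff: "inertia_condition G N1 N2 \<alpha> \<longleftrightarrow>
     (gcd p q = 1 \<longrightarrow> inertia_group G H \<alpha> = H) \<and>
     (gcd p q \<noteq> 1 \<longrightarrow> inertia_group G H \<alpha> \<noteq> N1 \<and> inertia_group G H \<alpha> \<noteq> N2)" for \<alpha>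
    unfolding inertia_condition_def p_def q_def assms(9) by simp
  have constituentD: "\<alpha> \<in> Irr (G\<lparr>carrier := H\<rparr>)" "char_inner H (restrict_char H \<psi>) \<alpha> \<noteq> 0"
    if "\<alpha> \<in> Irr_constituents G H \<psi>" for \<alpha> \<psi>
    using that by (auto simp: Irr_constituents_def)
  note dich1 = Irr_over_dichotomy[OF HG fin sub1 HN1 cN1 q]
  note dich2 = Irr_over_dichotomy[OF HG fin sub2 HN2 cN2 p]
  show ?thesis
  proof (intro conjI allI impI; elim conjE)

    \<comment> \<open>Part (a): finding \<open>\<gamma>\<close> from the inertia group of
      \<open>\<alpha>\<close>\<close>
    fix \<psi> \<alpha>
    assume \<psi>: "\<psi> \<in> Irr (G\<lparr>carrier := N1\<rparr>)" and const: "\<alpha> \<in> Irr_constituents G H \<psi>"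
      and cond: "inertia_condition G N1 N2 \<alpha>"
      and rel: "inertia_group G H \<alpha> = carrier G \<longrightarrow> \<psi> \<in> Irr_relative (G\<lparr>carrier := N1\<rparr>) M1"
    note \<alpha> = constituentD(1)[OF const] and over = constituentD(2)[OF const]
    define I where "I = inertia_group G H \<alpha>"
    have I: "subgroup I G" "H \<subseteq> I" unfolding I_def using inertia_group_subgroup[OF HG \<alpha>] by auto
    note d1 = dich1[OF \<alpha> \<psi> over, folded I_def]
    show "\<exists>\<gamma>\<in>Irr (G\<lparr>carrier := N2\<rparr>). induced_char G N2 \<gamma> = induced_char G N1 \<psi>"
    proof (cases "I = carrier G")
      case False
      have large1: "I = N1" if "N1 \<subseteq> I" using intermediate_subgroup_prime_index[OF G fin sub1 I(1) that cG1 p] False by blast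
      have large2: "I = N2" if "N2 \<subseteq> I" using intermediate_subgroup_prime_index[OF G fin sub2 I(1) that cG2 q] False by blast
      \<comment> \<open>Both versions of the condition give this: for coprime indices
        \<open>I = H\<close>, and \<open>H\<close> is smaller than \<open>N1\<close> and
        \<open>N2\<close>.\<close>
      have neq: "I \<noteq> N1" "I \<noteq> N2"
      proof -
        have "H \<noteq> N1" "H \<noteq> N2" using cN1 cN2 p1 q1 cardH0 by auto
        then show "I \<noteq> N1" "I \<noteq> N2" using cond unfolding cond_iff I_def[symmetric] by metis+
      qed
      \<comment> \<open>Any irreducible character of \<open>N2\<close> over \<open>\<alpha>\<close>
        will do; the dichotomy forces it to be the one induced from \<open>\<alpha>\<close>.\<close>
      obtain \<gamma> where \<gamma>: "\<gamma> \<in> Irr (G\<lparr>carrier := N2\<rparr>)" "char_inner H (restrict_char H \<gamma>) \<alpha> \<noteq> 0"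
        using Irr_over_exists[OF gN2, of H \<alpha>] finite_subset[OF N2.subset fin] subgroup_incl[OF subH sub2 HN2] \<alpha> by auto
      have "\<psi> = induced_char (G\<lparr>carrier := N1\<rparr>) H \<alpha>" using d1 large1 neq(1) by blast
      moreover have "\<gamma> = induced_char (G\<lparr>carrier := N2\<rparr>) H \<alpha>"
        using dich2[OF \<alpha> \<gamma>, folded I_def] large2 neq(2) by blast
      ultimately have "induced_char G N2 \<gamma> = induced_char G N1 \<psi>"
        using induced_char_trans[OF G fin sub1 subH HN1, of \<alpha>] induced_char_trans[OF G fin sub2 subH HN2, of \<alpha>] by simp
      then show ?thesis using \<gamma>(1) by blast
    next
      case IG: True
      \<comment> \<open>The intersection is now all of \<open>N1\<close>, which exceeds
        \<open>H\<close>, so only the extension alternative of the dichotomy remains.\<close>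
      have "\<not> I \<inter> N1 = H" using IG N1.subset cN1 q1 cardH0 by (auto simp: Int_absorb1)
      then have \<psi>H: "restrict_char H \<psi> = \<alpha>" using d1 by blast
      have \<psi>_eq: "\<psi> h = \<alpha> h" if "h \<in> H" for h using fun_cong[OF \<psi>H, of h] that by (simp add: restrict_char_def)
      have rel': "\<not> M1 \<subseteq> char_kernel (G\<lparr>carrier := N1\<rparr>) \<psi>" using rel IG by (auto simp: I_def Irr_relative_def)
      have M1: "M1 \<subseteq> N1" using assms(10) by (simp add: camina_triple_def)
      obtain a where a: "a \<noteq> 0" "\<alpha> \<one>\<^bsub>G\<^esub> = of_nat a" using Irr_degree[OF gH \<alpha>] by auto
      obtain \<chi> where \<chi>: "\<chi> \<in> Irr G" "char_inner N1 (restrict_char N1 \<chi>) \<psi> \<noteq> 0"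
        using Irr_over_exists[OF G fin sub1 \<psi>] .
      have "inertia_group G N1 \<psi> = N1 \<or> inertia_group G N1 \<psi> = carrier G"
        using intermediate_subgroup_prime_index[OF G fin sub1 _ _ cG1 p] inertia_group_subgroup[OF N1 \<psi>] by blast
      \<comment> \<open>If \<open>\<psi>\<close> were invariant, \<open>\<chi>\<close> would extend
        it, would not have \<open>M1\<close> in its kernel, and would vanish off \<open>N1\<close>.
        The sums of squares of \<open>\<chi>\<close> over \<open>G\<close> and of
        \<open>\<psi>\<close> over \<open>N1\<close> would coincide, and norm 1 for both would force
        the two groups to have the same order.\<close>
      moreover have "inertia_group G N1 \<psi> \<noteq> carrier G"
      proof
        assume "inertia_group G N1 \<psi> = carrier G"
        then have r: "restrict_char N1 \<chi> = \<psi>"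
          by (rule Irr_extends_invariant_prime_index[OF N1 fin cG1 p \<psi> \<chi>])
        have r': "\<chi> k = \<psi> k" if "k \<in> N1" for k using fun_cong[OF r, of k] that by (simp add: restrict_char_def)
        obtain m where m: "m \<in> M1" "\<psi> m \<noteq> \<psi> \<one>\<^bsub>G\<^esub>" using rel' M1 by (auto simp: char_kernel_def)
        then have "\<chi> m \<noteq> \<chi> \<one>\<^bsub>G\<^esub>" using r' M1 subgroup.one_closed[OF sub1] by auto
        then have "\<not> M1 \<subseteq> char_kernel G \<chi>" using m(1) by (auto simp: char_kernel_def)
        then have van: "\<chi> g = 0" if "g \<in> carrier G" "g \<notin> N1" for g
          using camina_triple_Irr_vanishes[OF assms(10) fin \<chi>(1)] that by blast
        have "(\<Sum>g\<in>carrier G. \<chi> g * cnj (\<chi> g)) = (\<Sum>g\<in>N1. \<psi> g * cnj (\<psi> g))"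
          using fin N1.subset by (intro sum.mono_neutral_cong_right) (auto simp: van r')
        then have "of_nat (card (carrier G)) * char_inner (carrier G) \<chi> \<chi> = of_nat (card N1) * char_inner N1 \<psi> \<psi>"
          using card10 p1 by (simp add: char_inner_def cG1)
        then have "(of_nat (card (carrier G)) :: complex) = of_nat (card N1)"
          using Irr_orthonormal[OF G fin \<chi>(1) \<chi>(1)] Irr_orthonormal[OF gN1 _ \<psi> \<psi>] finite_subset[OF N1.subset fin] by simp
        then have "card (carrier G) = card N1" by (simp only: of_nat_eq_iff)
        then show False using cG1 p1 card10 by simp
      qed
      ultimately have \<chi>_ind: "induced_char G N1 \<psi> = \<chi>"
        using Irr_induced_of_trivial_inertia[OF N1 fin \<psi> \<chi>] by blast
      \<comment> \<open>By the invariance of \<open>\<alpha>\<close> every conjugate of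
        \<open>\<psi>\<close> agrees with \<open>\<alpha>\<close> on \<open>H\<close>; the factor is
        the index of \<open>N1\<close>.\<close>
      have \<chi>H: "\<chi> h = of_nat p * \<alpha> h" if h: "h \<in> H" for h
      proof -
        have "restrict_char N1 \<psi> (x \<otimes>\<^bsub>G\<^esub> h \<otimes>\<^bsub>G\<^esub> inv\<^bsub>G\<^esub> x) = \<alpha> h" if x: "x \<in> carrier G" for x
        proof -
          have c: "x \<otimes>\<^bsub>G\<^esub> h \<otimes>\<^bsub>G\<^esub> inv\<^bsub>G\<^esub> x \<in> H" using H.inv_op_closed2[OF x h] .
          have "x \<in> inertia_group G H \<alpha>" using x IG by (simp add: I_def)
          then have "conj_char G H x \<alpha> h = \<alpha> h" by (simp add: inertia_group_def)
          then have "\<alpha> (x \<otimes>\<^bsub>G\<^esub> h \<otimes>\<^bsub>G\<^esub> inv\<^bsub>G\<^esub> x) = \<alpha> h" using h by (simp add: conj_char_def restrict_char_def)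
          then show ?thesis using \<psi>_eq[OF c] c HN1 by (auto simp: restrict_char_def)
        qed
        then have "induced_char G N1 \<psi> h = of_nat (card (carrier G)) / of_nat (card N1) * \<alpha> h"
          using h H.subset by (auto simp: induced_char_def)
        then show ?thesis using card10 by (simp add: \<chi>_ind cG1)
      qed
      have "char_inner H (restrict_char H \<chi>) \<alpha> = of_nat p * char_inner H \<alpha> \<alpha>"
        by (simp add: char_inner_def restrict_char_def \<chi>H sum_distrib_left mult_ac)
      also have "\<dots> \<noteq> 0" using Irr_orthonormal[OF gH _ \<alpha> \<alpha>] finite_subset[OF H.subset fin] p1 by simp
      finally have over\<chi>: "char_inner H (restrict_char H \<chi>) \<alpha> \<noteq> 0" .
      \<comment> \<open>Lying under \<open>\<chi>\<close> ties \<open>\<gamma>\<close> to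
        \<open>G\<close>, lying over \<open>\<alpha>\<close> fixes its degree.\<close>
      obtain \<gamma> where \<gamma>: "\<gamma> \<in> Irr (G\<lparr>carrier := N2\<rparr>)" "char_inner N2 (restrict_char N2 \<chi>) \<gamma> \<noteq> 0"
          "char_inner H (restrict_char H \<gamma>) \<alpha> \<noteq> 0"
        using Irr_between_exists[OF G fin sub2 HN2 \<chi>(1) over\<chi>] .
      have "\<not> I \<inter> N2 = H" using IG N2.subset cN2 p1 cardH0 by (auto simp: Int_absorb1)
      then have r\<gamma>: "restrict_char H \<gamma> = \<alpha>" using dich2[OF \<alpha> \<gamma>(1,3), folded I_def] by blast
      have \<gamma>1: "\<gamma> \<one>\<^bsub>G\<^esub> = \<alpha> \<one>\<^bsub>G\<^esub>" using fun_cong[OF r\<gamma>, of "\<one>\<^bsub>G\<^esub>"] oneH by (simp add: restrict_char_def)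
      have "inertia_group G N2 \<gamma> = N2 \<or> inertia_group G N2 \<gamma> = carrier G"
        using intermediate_subgroup_prime_index[OF G fin sub2 _ _ cG2 q] inertia_group_subgroup[OF N2 \<gamma>(1)] by blast
      moreover have "inertia_group G N2 \<gamma> \<noteq> carrier G"
      proof
        assume "inertia_group G N2 \<gamma> = carrier G"
        then have r: "restrict_char N2 \<chi> = \<gamma>"
          by (rule Irr_extends_invariant_prime_index[OF N2 fin cG2 q \<gamma>(1) \<chi>(1) \<gamma>(2)])
        have "\<chi> \<one>\<^bsub>G\<^esub> = \<gamma> \<one>\<^bsub>G\<^esub>" using fun_cong[OF r, of "\<one>\<^bsub>G\<^esub>"] subgroup.one_closed[OF sub2] by (simp add: restrict_char_def)
        then have "of_nat p * \<alpha> \<one>\<^bsub>G\<^esub> = \<alpha> \<one>\<^bsub>G\<^esub>" using \<gamma>1 \<chi>H[OF oneH] by simp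
        then show False using a p1 by simp
      qed
      ultimately have "induced_char G N2 \<gamma> = \<chi>"
        using Irr_induced_of_trivial_inertia[OF N2 fin \<gamma>(1) \<chi>(1) \<gamma>(2)] by blast
      then show ?thesis using \<gamma>(1) \<chi>_ind by auto
    qed
  next

    \<comment> \<open>Part (b): restricting the inertia group by degrees\<close>
    fix \<psi> \<gamma> \<alpha>
    assume \<psi>_rel: "\<psi> \<in> Irr_relative (G\<lparr>carrier := N1\<rparr>) M1" and \<gamma>: "\<gamma> \<in> Irr (G\<lparr>carrier := N2\<rparr>)"
      and eq: "induced_char G N2 \<gamma> = induced_char G N1 \<psi>"
      and const: "\<alpha> \<in> Irr_constituents G H \<psi> \<inter> Irr_constituents G H \<gamma>"
    have \<psi>: "\<psi> \<in> Irr (G\<lparr>carrier := N1\<rparr>)" using \<psi>_rel by (simp add: Irr_relative_def)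
    have \<alpha>: "\<alpha> \<in> Irr (G\<lparr>carrier := H\<rparr>)" and over1: "char_inner H (restrict_char H \<psi>) \<alpha> \<noteq> 0"
      and over2: "char_inner H (restrict_char H \<gamma>) \<alpha> \<noteq> 0"
      using const constituentD by blast+
    obtain a where a: "a \<noteq> 0" "\<alpha> \<one>\<^bsub>G\<^esub> = of_nat a" using Irr_degree[OF gH \<alpha>] by auto
    define I where "I = inertia_group G H \<alpha>"
    have I: "subgroup I G" "H \<subseteq> I" unfolding I_def using inertia_group_subgroup[OF HG \<alpha>] by auto
    have "induced_char G N1 \<psi> \<one>\<^bsub>G\<^esub> = of_nat p * \<psi> \<one>\<^bsub>G\<^esub>"
      using induced_char_degree[OF G sub1, of \<psi>] card10 by (simp add: cG1)
    moreover have "induced_char G N2 \<gamma> \<one>\<^bsub>G\<^esub> = of_nat q * \<gamma> \<one>\<^bsub>G\<^esub>"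
      using induced_char_degree[OF G sub2, of \<gamma>] card20 by (simp add: cG2)
    ultimately have deg: "of_nat p * \<psi> \<one>\<^bsub>G\<^esub> = of_nat q * \<gamma> \<one>\<^bsub>G\<^esub>"
      using eq by simp
    have deg1: "I \<inter> N1 = H \<and> \<psi> \<one>\<^bsub>G\<^esub> = of_nat q * \<alpha> \<one>\<^bsub>G\<^esub> \<or> N1 \<subseteq> I \<and> \<psi> \<one>\<^bsub>G\<^esub> = \<alpha> \<one>\<^bsub>G\<^esub>"
      using dich1[OF \<alpha> \<psi> over1, folded I_def]
    proof (elim disjE conjE)
      assume i: "I \<inter> N1 = H" and "induced_char (G\<lparr>carrier := N1\<rparr>) H \<alpha> = \<psi>"
      then have "\<psi> \<one>\<^bsub>G\<^esub> = of_nat q * \<alpha> \<one>\<^bsub>G\<^esub>"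
        using induced_char_degree[OF gN1 subgroup_incl[OF subH sub1 HN1], of \<alpha>] cardH0 by (simp add: cN1)
      then show ?thesis using i by blast
    next
      assume i: "N1 \<subseteq> I" and r: "restrict_char H \<psi> = \<alpha>"
      have "\<psi> \<one>\<^bsub>G\<^esub> = \<alpha> \<one>\<^bsub>G\<^esub>" using fun_cong[OF r, of "\<one>\<^bsub>G\<^esub>"] oneH by (simp add: restrict_char_def)
      then show ?thesis using i by blast
    qed
    have deg2: "I \<inter> N2 = H \<and> \<gamma> \<one>\<^bsub>G\<^esub> = of_nat p * \<alpha> \<one>\<^bsub>G\<^esub> \<or> N2 \<subseteq> I \<and> \<gamma> \<one>\<^bsub>G\<^esub> = \<alpha> \<one>\<^bsub>G\<^esub>"
      using dich2[OF \<alpha> \<gamma> over2, folded I_def]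
    proof (elim disjE conjE)
      assume i: "I \<inter> N2 = H" and "induced_char (G\<lparr>carrier := N2\<rparr>) H \<alpha> = \<gamma>"
      then have "\<gamma> \<one>\<^bsub>G\<^esub> = of_nat p * \<alpha> \<one>\<^bsub>G\<^esub>"
        using induced_char_degree[OF gN2 subgroup_incl[OF subH sub2 HN2], of \<alpha>] cardH0 by (simp add: cN2)
      then show ?thesis using i by blast
    next
      assume i: "N2 \<subseteq> I" and r: "restrict_char H \<gamma> = \<alpha>"
      have "\<gamma> \<one>\<^bsub>G\<^esub> = \<alpha> \<one>\<^bsub>G\<^esub>" using fun_cong[OF r, of "\<one>\<^bsub>G\<^esub>"] oneH by (simp add: restrict_char_def)
      then show ?thesis using i by blast
    qed
    have deg_nat: "x = y" if "of_nat x * \<alpha> \<one>\<^bsub>G\<^esub> = of_nat y * \<alpha> \<one>\<^bsub>G\<^esub>" for x y :: nat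
      using that a by simp
    \<comment> \<open>If exactly one of \<open>\<psi>\<close> and \<open>\<gamma>\<close> extends
      \<open>\<alpha>\<close>, the degree equation becomes \<open>p q = q\<close> or
      \<open>p = q p\<close>, impossible for primes. If both do, it gives \<open>p = q\<close>; if
      neither does, it reads \<open>p q = q p\<close>.\<close>
    have mixed: "I \<inter> N1 = H \<and> I \<inter> N2 = H \<or> N1 \<subseteq> I \<and> N2 \<subseteq> I \<and> p = q"
    proof -
      consider "I \<inter> N1 = H" "I \<inter> N2 = H"
        | "\<psi> \<one>\<^bsub>G\<^esub> = of_nat q * \<alpha> \<one>\<^bsub>G\<^esub>" "\<gamma> \<one>\<^bsub>G\<^esub> = \<alpha> \<one>\<^bsub>G\<^esub>"
        | "\<psi> \<one>\<^bsub>G\<^esub> = \<alpha> \<one>\<^bsub>G\<^esub>" "\<gamma> \<one>\<^bsub>G\<^esub> = of_nat p * \<alpha> \<one>\<^bsub>G\<^esub>"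
        | "N1 \<subseteq> I" "N2 \<subseteq> I" "\<psi> \<one>\<^bsub>G\<^esub> = \<alpha> \<one>\<^bsub>G\<^esub>" "\<gamma> \<one>\<^bsub>G\<^esub> = \<alpha> \<one>\<^bsub>G\<^esub>"
        using deg1 deg2 by blast
      then show ?thesis
      proof cases
        case 2
        then have "p * q = q" using deg by (intro deg_nat) (simp add: mult.assoc)
        then show ?thesis using p1 q1 by simp
      next
        case 3
        then have "p = q * p" using deg by (intro deg_nat) (simp add: mult.assoc)
        then show ?thesis using p1 q1 by simp
      next
        case 4
        then have "p = q" using deg by (intro deg_nat) simp
        then show ?thesis using 4 by blast
      qed blast
    qed
    show "inertia_condition G N1 N2 \<alpha>"
      unfolding cond_iff I_def[symmetric]
    proof (intro conjI impI)
      assume g: "gcd p q = 1"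
      then have "p \<noteq> q" using p1 by auto
      then have i: "I \<inter> N1 = H" "I \<inter> N2 = H" using mixed by auto
      interpret Q: group "G Mod H" by (rule H.factorgroup_is_group)
      \<comment> \<open>For \<open>x\<close> in \<open>I\<close> the power with exponent the index
        of \<open>N\<close> lies in \<open>I \<inter> N = H\<close>. Taken for \<open>N1\<close> and
        \<open>N2\<close>, this makes the order of the coset of \<open>x\<close> divide the coprime
        numbers \<open>p\<close> and \<open>q\<close>.\<close>
      have pow: "(H #>\<^bsub>G\<^esub> x) [^]\<^bsub>G Mod H\<^esub> n = \<one>\<^bsub>G Mod H\<^esub>"
        if x: "x \<in> I" and N: "N \<lhd> G" and ord: "Coset.order (G Mod N) = n" and IN: "I \<inter> N = H" for x N n
      proof -
        interpret N: normal N G by (rule N)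
        have subN: "subgroup N G" by (rule normal_imp_subgroup[OF N])
        interpret QN: group "G Mod N" by (rule N.factorgroup_is_group)
        have xG: "x \<in> carrier G" using x subgroup.subset[OF I(1)] by blast
        have pow_hom: "H' #>\<^bsub>G\<^esub> (x [^]\<^bsub>G\<^esub> m) = (H' #>\<^bsub>G\<^esub> x) [^]\<^bsub>G Mod H'\<^esub> m" if "H' \<lhd> G" for H' and m :: nat
          using group_hom.hom_nat_pow[of G "G Mod H'" "\<lambda>g. H' #>\<^bsub>G\<^esub> g" x m]
            normal.r_coset_hom_Mod[OF that] normal.factorgroup_is_group[OF that] G xG
          by (simp add: group_hom_def group_hom_axioms_def)
        have "(N #>\<^bsub>G\<^esub> x) [^]\<^bsub>G Mod N\<^esub> n = \<one>\<^bsub>G Mod N\<^esub>"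
          unfolding ord[symmetric] by (rule QN.pow_order_eq_1) (use xG in \<open>simp add: carrier_FactGroup\<close>)
        then have "N #>\<^bsub>G\<^esub> (x [^]\<^bsub>G\<^esub> n) = N" using pow_hom[OF N] by simp
        then have "x [^]\<^bsub>G\<^esub> n \<in> N" using rcos_self[OF nat_pow_closed[OF xG] subN, of n] by simp
        moreover have "x [^]\<^bsub>G\<^esub> n \<in> I"
          using x by (induction n) (auto intro: subgroup.m_closed[OF I(1)] subgroup.one_closed[OF I(1)])
        ultimately have "x [^]\<^bsub>G\<^esub> n \<in> H" using IN by blast
        then show ?thesis using pow_hom[OF HG, of n] H.rcos_const by simp
      qed
      have "x \<in> H" if x: "x \<in> I" for x
      proof -
        have xG: "x \<in> carrier G" using x subgroup.subset[OF I(1)] by blast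
        then have cG: "H #>\<^bsub>G\<^esub> x \<in> carrier (G Mod H)" by (simp add: carrier_FactGroup)
        have "group.ord (G Mod H) (H #>\<^bsub>G\<^esub> x) dvd p" "group.ord (G Mod H) (H #>\<^bsub>G\<^esub> x) dvd q"
          using pow[OF x N1 p_def[symmetric] i(1)] pow[OF x N2 q_def[symmetric] i(2)] Q.pow_eq_id[OF cG] by auto
        then have "group.ord (G Mod H) (H #>\<^bsub>G\<^esub> x) = 1" using g by (metis gcd_greatest nat_dvd_1_iff_1)
        then have "H #>\<^bsub>G\<^esub> x = H" using Q.ord_eq_1[OF cG] by simp
        then show ?thesis using rcos_self[OF xG subH] by simp
      qed
      then show "I = H" using I(2) by blast
    next
      \<comment> \<open>If \<open>I\<close> were \<open>N1\<close>, its intersection with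
        \<open>N1\<close> would exceed \<open>H\<close>, so \<open>N2\<close> would lie in
        \<open>N1\<close> and equal \<open>H\<close>, against its order
        \<open>p * card H\<close>.\<close>
      show "I \<noteq> N1"
      proof
        assume IN: "I = N1"
        have "I \<inter> N1 \<noteq> H" using IN cN1 q1 cardH0 by auto
        then have "N2 \<subseteq> N1" using mixed IN by blast
        then have "H = N2" using assms(9) by blast
        then show False using cN2 p1 cardH0 by auto
      qed
      show "I \<noteq> N2"
      proof
        assume IN: "I = N2"
        have "I \<inter> N2 \<noteq> H" using IN cN2 p1 cardH0 by auto
        then have "N1 \<subseteq> N2" using mixed IN by blast
        then have "H = N1" using assms(9) by blast
        then show False using cN1 q1 cardH0 by auto
      qed
    qed
  qed
qed

end
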